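(* Let $V$ be a vertex operator algebra, $z\in\mathbb{C}^{\times}$, and let $W_1,W_2$ be $V$-modules such that the generalized module $W_1\diamond_{P(z)}W_2$ is a $V$-module. Let $W_1\boxtimes_{P(z)}W_2=(W_1\diamond_{P(z)}W_2)'$ be its contragredient module, with vertex operator map $Y_{P(z)}$, and let $\boxtimes_{P(z)}:W_1\otimes W_2\to\overline{W_1\boxtimes_{P(z)}W_2}$ be the canonical $P(z)$-intertwining map. Then the $P(z)$-product $(W_1\boxtimes_{P(z)}W_2,Y_{P(z)};\boxtimes_{P(z)})$ is a $P(z)$-tensor product of $W_1$ and $W_2$.
   Context: Basic conventions. Everything is over $\mathbb{C}$. $V=(V,Y,\mathbf 1,\omega)$ is a vertex operator algebra ($\mathbb{Z}$-graded, with finite-dimensional weight spaces that vanish for sufficiently negative weight), $Y(\omega,x)=\sum_n L(n)x^{-n-2}$. A $V$-module is a $\mathbb{C}$-graded space $W=\coprod_{n\in\mathbb{C}}W_{(n)}$, graded by $L(0)$-eigenvalues, with a vertex operator map satisfying the usual axioms (lower truncation, vacuum property, Jacobi identity, $L(-1)$-derivative property), such that $\dim W_{(n)}<\infty$ for all $n$ and $W_{(n)}=0$ for $n$ whose real part is sufficiently small. A generalized $V$-module satisfies all these axioms except the last two conditions on the grading. For a module $W$, $\overline W=\prod_nW_{(n)}$ is the formal completion and $W'=\coprod_nW_{(n)}^*$ is the contragredient module, with $\langle Y'(v,x)w',w\rangle=\langle w',Y^*(v,x)w\rangle$, where $Y^*(v,x)=Y(e^{xL(1)}(-x^{-2})^{L(0)}v,x^{-1})$.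 Modules $W_i$ have vertex operator maps $Y_i$. Formal delta function: $\delta(x)=\sum_{n\in\mathbb{Z}}x^n$; powers of binomials are expanded in nonnegative powers of the second summand. For $v\in V$, $Y_t(v,x)=v\otimes t^{-1}\delta(x/t)$, so the coefficient of $x^{-n-1}$ is $v\otimes t^n$. $\iota_+$ denotes expansion of a rational function of $t$ in the direction of positive powers of $t$. $P(z)$-tensor products. A $P(z)$-intertwining map of type $\binom{W_3}{W_1W_2}$ is a linear map $F:W_1\otimes W_2\to\overline{W}_3$ with $$x_0^{-1}\delta\bigl(\tfrac{x_1-z}{x_0}\bigr)Y_3(v,x_1)F(w_{(1)}\otimes w_{(2)})=z^{-1}\delta\bigl(\tfrac{x_1-x_0}{z}\bigr)F(Y_1(v,x_0)w_{(1)}\otimes w_{(2)})+x_0^{-1}\delta\bigl(\tfrac{z-x_1}{-x_0}\bigr)F(w_{(1)}\otimes Y_2(v,x_1)w_{(2)})$$ for $v\in V$, $w_{(i)}\in W_i$. A $P(z)$-product of $W_1$ and $W_2$ is a $V$-module $(W_3,Y_3)$ with a $P(z)$-intertwining map $F$ of type $\binom{W_3}{W_1W_2}$, written $(W_3,Y_3;F)$. A morphism $(W_3,Y_3;F)\to(W_4,Y_4;G)$ is a module map $\eta:W_3\to W_4$ with $G=\overline\eta\circ F$, where $\overline\eta:\overline{W}_3\to\overline{W}_4$ is the natural extension. A $P(z)$-tensor product of $W_1$ and $W_2$ is a $P(z)$-product from which there is a unique morphism to every $P(z)$-product. The action $\tau_{P(z)}$. The linear map $\tau_{P(z)}:V\otimes\iota_+\mathbb{C}[t,t^{-1},(z^{-1}-t)^{-1}]\to\mathrm{End}\,(W_1\otimes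 W_2)^*$ is defined by $$\Bigl(\tau_{P(z)}\bigl(x_0^{-1}\delta\bigl(\tfrac{x_1^{-1}-z}{x_0}\bigr)Y_t(v,x_1)\bigr)\lambda\Bigr)(w_{(1)}\otimes w_{(2)})=z^{-1}\delta\bigl(\tfrac{x_1^{-1}-x_0}{z}\bigr)\lambda\bigl(Y_1(e^{x_1L(1)}(-x_1^{-2})^{L(0)}v,x_0)w_{(1)}\otimes w_{(2)}\bigr)+x_0^{-1}\delta\bigl(\tfrac{z-x_1^{-1}}{-x_0}\bigr)\lambda\bigl(w_{(1)}\otimes Y_2^*(v,x_1)w_{(2)}\bigr).$$ Put $Y'_{P(z)}(v,x)=\tau_{P(z)}(Y_t(v,x))$ and $Y'_{P(z)}(\omega,x)=\sum_nL'_{P(z)}(n)x^{-n-2}$. An element $\lambda\in(W_1\otimes W_2)^*$ satisfies the $P(z)$-compatibility condition if for all $v\in V$: $Y'_{P(z)}(v,x)\lambda$ involves only finitely many negative powers of $x$, and $\tau_{P(z)}\bigl(x_0^{-1}\delta(\tfrac{x_1^{-1}-z}{x_0})Y_t(v,x_1)\bigr)\lambda=x_0^{-1}\delta(\tfrac{x_1^{-1}-z}{x_0})Y'_{P(z)}(v,x_1)\lambda$. The space $W_1\diamond_{P(z)}W_2$. A subspace $W\subset(W_1\otimes W_2)^*$ is called a $V$-module (resp. generalized $V$-module) if it is $\mathbb{C}$-graded by its $L'_{P(z)}(0)$-eigenspaces and is a module (resp. generalized module) with this grading and the action $Y'_{P(z)}(\cdot,x)$; it is $P(z)$-compatible if each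 of its elements satisfies the $P(z)$-compatibility condition. $W_1\diamond_{P(z)}W_2\subset(W_1\otimes W_2)^*$ is the sum (equivalently, the union) of all subspaces that are $P(z)$-compatible $V$-modules; it is a generalized module. When $W_1\diamond_{P(z)}W_2$ is a module, the canonical map $\boxtimes_{P(z)}$ is determined by $\langle\lambda,\boxtimes_{P(z)}(w_{(1)}\otimes w_{(2)})\rangle=\lambda(w_{(1)}\otimes w_{(2)})$ for $\lambda\in W_1\diamond_{P(z)}W_2=(W_1\boxtimes_{P(z)}W_2)'$; it is a $P(z)$-intertwining map. *)

theory Defs
  imports Complex_Main "HOL-Library.Function_Algebras" "HOL-Library.Groups_Big_Fun"
begin

section \<open>Complex vector spaces\<close>

class complex_vector = ab_group_add +
  fixes scaleC :: "complex \<Rightarrow> 'a \<Rightarrow> 'a"  (infixr "*\<^sub>C" 75)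
  assumes scaleC_add_right: "a *\<^sub>C (x + y) = a *\<^sub>C x + a *\<^sub>C y"
    and scaleC_add_left: "(a + b) *\<^sub>C x = a *\<^sub>C x + b *\<^sub>C x"
    and scaleC_scaleC: "a *\<^sub>C b *\<^sub>C x = (a * b) *\<^sub>C x"
    and scaleC_one: "1 *\<^sub>C x = x"

interpretation cvec: vector_space "scaleC :: complex \<Rightarrow> 'a \<Rightarrow> 'a::complex_vector"
  by unfold_locales
    (simp_all add: scaleC_add_right scaleC_add_left scaleC_scaleC scaleC_one)

instantiation complex :: complex_vector
begin
definition scaleC_complex :: "complex \<Rightarrow> complex \<Rightarrow> complex" where
  "scaleC_complex a x = a * x"
instance
  by standard (simp_all add: scaleC_complex_def algebra_simps)
end

instantiation "fun" :: (type, complex_vector) complex_vector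
begin
definition scaleC_fun :: "complex \<Rightarrow> ('a \<Rightarrow> 'b) \<Rightarrow> 'a \<Rightarrow> 'b" where
  "scaleC_fun a f = (\<lambda>x. a *\<^sub>C f x)"
instance
  by standard (simp_all add: scaleC_fun_def fun_eq_iff plus_fun_def
      scaleC_add_right scaleC_add_left scaleC_scaleC scaleC_one)
end

definition linear_on :: "'a::complex_vector set \<Rightarrow> ('a \<Rightarrow> 'b::complex_vector) \<Rightarrow> bool" where
  "linear_on W f \<longleftrightarrow> (\<forall>x\<in>W. \<forall>y\<in>W. f (x + y) = f x + f y) \<and> (\<forall>c. \<forall>x\<in>W. f (c *\<^sub>C x) = c *\<^sub>C f x)"

text \<open>Linear maps out of a tensor product of two subspaces are rendered as bilinear maps.\<close>

definition bilinear_on ::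
  "'a::complex_vector set \<Rightarrow> 'b::complex_vector set \<Rightarrow> ('a \<Rightarrow> 'b \<Rightarrow> 'c::complex_vector) \<Rightarrow> bool" where
  "bilinear_on A B F \<longleftrightarrow> (\<forall>b\<in>B. linear_on A (\<lambda>a. F a b)) \<and> (\<forall>a\<in>A. linear_on B (F a))"

text \<open>The dual of the tensor product of \<open>A\<close> and \<open>B\<close>. Forms are normalised to vanish off
  \<open>A \<times> B\<close>, so that each functional is represented exactly once.\<close>

definition dual_tensor ::
  "'a::complex_vector set \<Rightarrow> 'b::complex_vector set \<Rightarrow> ('a \<Rightarrow> 'b \<Rightarrow> complex) set" where
  "dual_tensor A B = {f. bilinear_on A B f \<and> (\<forall>a b. a \<notin> A \<or> b \<notin> B \<longrightarrow> f a b = 0)}"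


section \<open>Formal delta functions\<close>

text \<open>\<open>fdelta a b c\<close> is the coefficient of \<open>X\<^sup>a Y\<^sup>b Z\<^sup>c\<close> in
  \<open>X\<^sup>-\<^sup>1 \<delta>((Y - Z)/X) = (\<Sum>n\<in>\<int>. X\<^sup>-\<^sup>n\<^sup>-\<^sup>1 (Y - Z)\<^sup>n)\<close>, where \<open>(Y - Z)\<^sup>n\<close> is expanded in nonnegative
  powers of \<open>Z\<close>; \<open>fdelta_neg a b c\<close> is its coefficient in \<open>X\<^sup>-\<^sup>1 \<delta>((Y - Z)/(-X))\<close>.

  Products of formal series are written out as convolutions of coefficients. Every
  \<^const>\<open>Sum_any\<close> below (which is \<open>0\<close> for infinite support) has finite support in the situations
  in which the corresponding formal product is defined.\<close>

definition fdelta :: "int \<Rightarrow> int \<Rightarrow> int \<Rightarrow> complex" where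
  "fdelta a b c =
     (if c \<ge> 0 \<and> a + b + c = -1 then (-1) ^ nat c * (of_int (- a - 1) gchoose nat c) else 0)"

definition fdelta_neg :: "int \<Rightarrow> int \<Rightarrow> int \<Rightarrow> complex" where
  "fdelta_neg a b c = (-1) powi (a + 1) * fdelta a b c"


section \<open>Vertex operator algebras and modules\<close>

text \<open>A vertex operator map is given by its modes: \<open>vop M v n\<close> is \<open>v\<^sub>n\<close>, where
  \<open>Y(v,x) = (\<Sum>n\<in>\<int>. v\<^sub>n x\<^sup>-\<^sup>n\<^sup>-\<^sup>1)\<close>. The grading is not part of the data, since it is
  by \<open>L(0)\<close>-eigenvalues.\<close>

record ('v, 'a) vmod =
  vspace :: "'a set"
  vop :: "'v \<Rightarrow> int \<Rightarrow> 'a \<Rightarrow> 'a"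

record 'v voa =
  vertop :: "'v \<Rightarrow> int \<Rightarrow> 'v \<Rightarrow> 'v"
  vacuum :: 'v
  conformal :: 'v

definition adjoint :: "'v voa \<Rightarrow> ('v, 'v) vmod" where
  "adjoint V = \<lparr>vspace = UNIV, vop = vertop V\<rparr>"

definition Lop :: "'v voa \<Rightarrow> ('v, 'a) vmod \<Rightarrow> int \<Rightarrow> 'a \<Rightarrow> 'a" where
  "Lop V M n = vop M (conformal V) (n + 1)"

text \<open>The coefficient of \<open>x\<^sup>p\<close> in \<open>Y(v,x)\<close>.\<close>

definition Ycoeff :: "('v, 'a) vmod \<Rightarrow> 'v \<Rightarrow> int \<Rightarrow> 'a \<Rightarrow> 'a" where
  "Ycoeff M v p = vop M v (- p - 1)"

definition wt_space :: "'v voa \<Rightarrow> ('v, 'a::complex_vector) vmod \<Rightarrow> complex \<Rightarrow> 'a set" where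
  "wt_space V M n = {w \<in> vspace M. Lop V M 0 w = n *\<^sub>C w}"

definition wt_comp :: "'v voa \<Rightarrow> ('v, 'a::complex_vector) vmod \<Rightarrow> 'a \<Rightarrow> complex \<Rightarrow> 'a" where
  "wt_comp V M w = (THE c. (\<forall>n. c n \<in> wt_space V M n) \<and> finite {n. c n \<noteq> 0} \<and> Sum_any c = w)"

text \<open>The coefficient of \<open>x\<^sub>0\<^sup>a x\<^sub>1\<^sup>b x\<^sub>2\<^sup>c\<close> in
  \<open>x\<^sub>0\<^sup>-\<^sup>1 \<delta>((x\<^sub>1 - x\<^sub>2)/x\<^sub>0) Y(u,x\<^sub>1) Y(v,x\<^sub>2) w
    - x\<^sub>0\<^sup>-\<^sup>1 \<delta>((x\<^sub>2 - x\<^sub>1)/(-x\<^sub>0)) Y(v,x\<^sub>2) Y(u,x\<^sub>1) w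
    = x\<^sub>2\<^sup>-\<^sup>1 \<delta>((x\<^sub>1 - x\<^sub>0)/x\<^sub>2) Y(Y(u,x\<^sub>0)v,x\<^sub>2) w\<close>.\<close>

definition jacobi_identity :: "'v voa \<Rightarrow> ('v, 'a::complex_vector) vmod \<Rightarrow> bool" where
  "jacobi_identity V M \<longleftrightarrow> (\<forall>u v. \<forall>w\<in>vspace M. \<forall>a b c.
     Sum_any (\<lambda>(p, q). fdelta a (b - p) (c - q) *\<^sub>C Ycoeff M u p (Ycoeff M v q w))
     - Sum_any (\<lambda>(p, q). fdelta_neg a (c - q) (b - p) *\<^sub>C Ycoeff M v q (Ycoeff M u p w))
     = Sum_any (\<lambda>(p, q). fdelta (c - q) b (a - p) *\<^sub>C Ycoeff M (Ycoeff (adjoint V) u p v) q w))"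

text \<open>The coefficient of \<open>x\<^sup>-\<^sup>n\<^sup>-\<^sup>1\<close> in \<open>d/dx Y(v,x) = Y(L(-1)v,x)\<close>.\<close>

definition L_derivative :: "'v voa \<Rightarrow> ('v, 'a::complex_vector) vmod \<Rightarrow> bool" where
  "L_derivative V M \<longleftrightarrow> (\<forall>v n. \<forall>w\<in>vspace M.
     vop M (Lop V (adjoint V) (-1) v) n w = (- of_int n) *\<^sub>C vop M v (n - 1) w)"

locale generalized_module =
  fixes V :: "'v::complex_vector voa" and M :: "('v, 'a::complex_vector) vmod"
  assumes subspace: "cvec.subspace (vspace M)"
    and vop_closed: "w \<in> vspace M \<Longrightarrow> vop M v n w \<in> vspace M"
    and vop_bilinear: "bilinear_on UNIV (vspace M) (\<lambda>v. vop M v n)"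
    and graded: "vspace M = cvec.span (\<Union>n. wt_space V M n)"
    and lower_truncation: "w \<in> vspace M \<Longrightarrow> \<exists>N. \<forall>n\<ge>N. vop M v n w = 0"
    and vacuum_property: "w \<in> vspace M \<Longrightarrow> vop M (vacuum V) n w = (if n = -1 then w else 0)"
    and jacobi: "jacobi_identity V M"
    and derivative: "L_derivative V M"

locale vmodule = generalized_module +
  assumes fin_dim: "\<exists>B. finite B \<and> wt_space V M n = cvec.span B"
    and bounded_below: "\<exists>N::real. \<forall>n. Re n < N \<longrightarrow> wt_space V M n = {0}"

locale vertex_operator_algebra =
  fixes V :: "'v::complex_vector voa"
  assumes vertop_bilinear: "bilinear_on UNIV UNIV (\<lambda>u. vertop V u n)"
    and int_graded: "cvec.span (\<Union>n. wt_space V (adjoint V) (of_int n)) = UNIV"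
    and fin_dim: "\<exists>B. finite B \<and> wt_space V (adjoint V) (of_int n) = cvec.span B"
    and bounded_below: "\<exists>N. \<forall>n<N. wt_space V (adjoint V) (of_int n) = {0}"
    and lower_truncation: "\<exists>N. \<forall>n\<ge>N. vertop V u n v = 0"
    and vacuum_wt: "vacuum V \<in> wt_space V (adjoint V) 0"
    and conformal_wt: "conformal V \<in> wt_space V (adjoint V) 2"
    and vacuum_property: "vertop V (vacuum V) n v = (if n = -1 then v else 0)"
    and creation: "n \<ge> 0 \<Longrightarrow> vertop V v n (vacuum V) = 0" "vertop V v (-1) (vacuum V) = v"
    and jacobi: "jacobi_identity V (adjoint V)"
    and virasoro: "\<exists>c::complex. \<forall>m n v.
      Lop V (adjoint V) m (Lop V (adjoint V) n v) - Lop V (adjoint V) n (Lop V (adjoint V) m v)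
      = of_int (m - n) *\<^sub>C Lop V (adjoint V) (m + n) v
        + (if m + n = 0 then (of_int (m ^ 3 - m) / 12 * c) *\<^sub>C v else 0)"
    and derivative: "L_derivative V (adjoint V)"

definition module_map ::
  "('v, 'a::complex_vector) vmod \<Rightarrow> ('v, 'b::complex_vector) vmod \<Rightarrow> ('a \<Rightarrow> 'b) \<Rightarrow> bool" where
  "module_map M N \<eta> \<longleftrightarrow> linear_on (vspace M) \<eta> \<and> \<eta> ` vspace M \<subseteq> vspace N
     \<and> (\<forall>v n. \<forall>w\<in>vspace M. \<eta> (vop M v n w) = vop N v n (\<eta> w))"

text \<open>The formal completion, the product of the weight spaces.\<close>

definition completion :: "'v voa \<Rightarrow> ('v, 'a::complex_vector) vmod \<Rightarrow> (complex \<Rightarrow> 'a) set" where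
  "completion V M = {x. \<forall>n. x n \<in> wt_space V M n}"

text \<open>The weight-\<open>n\<close> component of \<open>T x\<close> for \<open>x\<close> in the completion, where \<open>T\<close> is a mode of a vertex
  operator. The sum is finite because a mode is a finite sum of operators that shift the weight.\<close>

definition extend_op ::
  "'v voa \<Rightarrow> ('v, 'a::complex_vector) vmod \<Rightarrow> ('a \<Rightarrow> 'a) \<Rightarrow> (complex \<Rightarrow> 'a) \<Rightarrow> complex \<Rightarrow> 'a" where
  "extend_op V M T x n = Sum_any (\<lambda>m. wt_comp V M (T (x m)) n)"


section \<open>Contragredient modules\<close>

text \<open>The coefficient of \<open>x\<^sup>k\<close> in the Laurent polynomial \<open>e\<^sup>x\<^sup>L\<^sup>(\<^sup>1\<^sup>) (-x\<^sup>-\<^sup>2)\<^sup>L\<^sup>(\<^sup>0\<^sup>) v\<close>, which for \<open>v\<close> of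
  weight \<open>n\<close> is \<open>(\<Sum>j\<ge>0. (-1)\<^sup>n/j! L(1)\<^sup>j v x\<^sup>j\<^sup>-\<^sup>2\<^sup>n)\<close>.\<close>

definition opp :: "'v::complex_vector voa \<Rightarrow> 'v \<Rightarrow> int \<Rightarrow> 'v" where
  "opp V v k = Sum_any (\<lambda>n::int. if k + 2 * n < 0 then 0 else
     ((-1) powi n / fact (nat (k + 2 * n))) *\<^sub>C
       (Lop V (adjoint V) 1 ^^ nat (k + 2 * n)) (wt_comp V (adjoint V) v (of_int n)))"

text \<open>The coefficient of \<open>x\<^sup>p\<close> in \<open>Y\<^sup>*(v,x) = Y(e\<^sup>x\<^sup>L\<^sup>(\<^sup>1\<^sup>) (-x\<^sup>-\<^sup>2)\<^sup>L\<^sup>(\<^sup>0\<^sup>) v, x\<^sup>-\<^sup>1)\<close>.\<close>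

definition Ystar ::
  "'v::complex_vector voa \<Rightarrow> ('v, 'a::complex_vector) vmod \<Rightarrow> 'v \<Rightarrow> int \<Rightarrow> 'a \<Rightarrow> 'a" where
  "Ystar V M v p w = Sum_any (\<lambda>k. Ycoeff M (opp V v k) (k - p) w)"

text \<open>An element of the direct sum of the duals of the weight spaces is a linear functional
  that is nonzero on only finitely many weight spaces; as above, functionals are normalised to
  vanish off the space.\<close>

definition contragredient ::
  "'v::complex_vector voa \<Rightarrow> ('v, 'a::complex_vector) vmod \<Rightarrow> ('v, 'a \<Rightarrow> complex) vmod" where
  "contragredient V M =
    \<lparr>vspace = {f. linear_on (vspace M) f \<and> (\<forall>w. w \<notin> vspace M \<longrightarrow> f w = 0)
                  \<and> finite {n. \<exists>w\<in>wt_space V M n. f w \<noteq> 0}},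
     vop = (\<lambda>v n f w. if w \<in> vspace M then f (Ystar V M v (- n - 1) w) else 0)\<rparr>"


section \<open>Intertwining maps and tensor products\<close>

text \<open>The coefficient of \<open>x\<^sub>0\<^sup>a x\<^sub>1\<^sup>b\<close> in the defining identity; here and below \<open>r\<close> is the exponent
  of \<open>z\<close>. The coefficients lie in the completion, so the identity is stated, and the sums are
  formed, in each weight \<open>n\<close> separately.\<close>

definition Pz_intertwining_map ::
  "'v::complex_vector voa \<Rightarrow> complex \<Rightarrow> ('v, 'a::complex_vector) vmod \<Rightarrow> ('v, 'b::complex_vector) vmod
    \<Rightarrow> ('v, 'c::complex_vector) vmod \<Rightarrow> ('a \<Rightarrow> 'b \<Rightarrow> complex \<Rightarrow> 'c) \<Rightarrow> bool" where
  "Pz_intertwining_map V z M1 M2 M3 F \<longleftrightarrow>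
     bilinear_on (vspace M1) (vspace M2) F
     \<and> (\<forall>w1\<in>vspace M1. \<forall>w2\<in>vspace M2. F w1 w2 \<in> completion V M3)
     \<and> (\<forall>v. \<forall>w1\<in>vspace M1. \<forall>w2\<in>vspace M2. \<forall>a b n.
          Sum_any (\<lambda>(r, p). (fdelta a (b - p) r * z powi r) *\<^sub>C
            extend_op V M3 (Ycoeff M3 v p) (F w1 w2) n)
          = Sum_any (\<lambda>(r, p). (fdelta r b (a - p) * z powi r) *\<^sub>C F (Ycoeff M1 v p w1) w2 n)
            + Sum_any (\<lambda>(r, p). (fdelta_neg a r (b - p) * z powi r) *\<^sub>C F w1 (Ycoeff M2 v p w2) n))"

definition Pz_product ::
  "'v::complex_vector voa \<Rightarrow> complex \<Rightarrow> ('v, 'a::complex_vector) vmod \<Rightarrow> ('v, 'b::complex_vector) vmod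
    \<Rightarrow> ('v, 'c::complex_vector) vmod \<Rightarrow> ('a \<Rightarrow> 'b \<Rightarrow> complex \<Rightarrow> 'c) \<Rightarrow> bool" where
  "Pz_product V z M1 M2 M3 F \<longleftrightarrow> vmodule V M3 \<and> Pz_intertwining_map V z M1 M2 M3 F"

text \<open>Module maps preserve weights, so the extension of \<open>\<eta>\<close> to completions is componentwise.\<close>

definition Pz_product_morphism ::
  "('v, 'a::complex_vector) vmod \<Rightarrow> ('v, 'b::complex_vector) vmod
    \<Rightarrow> ('v, 'c::complex_vector) vmod \<Rightarrow> ('a \<Rightarrow> 'b \<Rightarrow> complex \<Rightarrow> 'c)
    \<Rightarrow> ('v, 'd::complex_vector) vmod \<Rightarrow> ('a \<Rightarrow> 'b \<Rightarrow> complex \<Rightarrow> 'd) \<Rightarrow> ('c \<Rightarrow> 'd) \<Rightarrow> bool" where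
  "Pz_product_morphism M1 M2 M3 F M4 G \<eta> \<longleftrightarrow> module_map M3 M4 \<eta>
     \<and> (\<forall>w1\<in>vspace M1. \<forall>w2\<in>vspace M2. G w1 w2 = (\<lambda>n. \<eta> (F w1 w2 n)))"

text \<open>The universal property, tested against all products whose underlying space is a subspace
  of the type \<open>'d\<close>. HOL cannot quantify over types inside a definition, so \<open>'d\<close> is a parameter;
  leaving it free in a theorem makes the claim for all products whatsoever.\<close>

definition Pz_tensor_product ::
  "'d::complex_vector itself \<Rightarrow> 'v::complex_vector voa \<Rightarrow> complex \<Rightarrow> ('v, 'a::complex_vector) vmod
    \<Rightarrow> ('v, 'b::complex_vector) vmod \<Rightarrow> ('v, 'c::complex_vector) vmod
    \<Rightarrow> ('a \<Rightarrow> 'b \<Rightarrow> complex \<Rightarrow> 'c) \<Rightarrow> bool" where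
  "Pz_tensor_product _ V z M1 M2 M3 F \<longleftrightarrow>
     Pz_product V z M1 M2 M3 F
     \<and> (\<forall>(M4 :: ('v, 'd) vmod) G. Pz_product V z M1 M2 M4 G \<longrightarrow>
          (\<exists>\<eta>. Pz_product_morphism M1 M2 M3 F M4 G \<eta>
             \<and> (\<forall>\<eta>'. Pz_product_morphism M1 M2 M3 F M4 G \<eta>' \<longrightarrow> (\<forall>w\<in>vspace M3. \<eta>' w = \<eta> w))))"


section \<open>The action on the dual of the tensor product\<close>

text \<open>The coefficient of \<open>x\<^sub>0\<^sup>a x\<^sub>1\<^sup>b\<close> in
  \<open>\<tau>(x\<^sub>0\<^sup>-\<^sup>1 \<delta>((x\<^sub>1\<^sup>-\<^sup>1 - z)/x\<^sub>0) Y\<^sub>t(v,x\<^sub>1)) f\<close>, i.e. the value of \<open>\<tau>\<close> at \<open>v \<otimes> (t\<^sup>-\<^sup>1 - z)\<^sup>m t\<^sup>n\<close>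
  (expanded in positive powers of \<open>t\<close>) with \<open>m = -a-1\<close>, \<open>n = -b-1\<close>; these elements span the
  domain of \<open>\<tau>\<close>. The index \<open>k\<close> is the exponent of \<open>x\<^sub>1\<close> coming from
  \<^const>\<open>opp\<close>, so that the delta function contributes \<open>x\<^sub>1\<^sup>b\<^sup>-\<^sup>k\<close>, that is, the exponent
  \<open>k - b\<close> of \<open>x\<^sub>1\<^sup>-\<^sup>1\<close>.\<close>

definition tau_delta ::
  "'v::complex_vector voa \<Rightarrow> complex \<Rightarrow> ('v, 'a::complex_vector) vmod \<Rightarrow> ('v, 'b::complex_vector) vmod
    \<Rightarrow> 'v \<Rightarrow> int \<Rightarrow> int \<Rightarrow> ('a \<Rightarrow> 'b \<Rightarrow> complex) \<Rightarrow> 'a \<Rightarrow> 'b \<Rightarrow> complex" where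
  "tau_delta V z M1 M2 v a b f w1 w2 =
     (if w1 \<in> vspace M1 \<and> w2 \<in> vspace M2 then
        Sum_any (\<lambda>(r, k, p). fdelta r (k - b) (a - p) * z powi r * f (Ycoeff M1 (opp V v k) p w1) w2)
        + Sum_any (\<lambda>(r, p). fdelta_neg a r (p - b) * z powi r * f w1 (Ystar V M2 v p w2))
      else 0)"

text \<open>A subspace \<open>U\<close> of the dual with the action
  \<open>Y'(v,x) = \<tau>(Y\<^sub>t(v,x)) = Res \<tau>(x\<^sub>0\<^sup>-\<^sup>1 \<delta>((x\<^sup>-\<^sup>1 - z)/x\<^sub>0) Y\<^sub>t(v,x))\<close>, the residue being in \<open>x\<^sub>0\<close>.\<close>

definition Pz_dual ::
  "'v::complex_vector voa \<Rightarrow> complex \<Rightarrow> ('v, 'a::complex_vector) vmod \<Rightarrow> ('v, 'b::complex_vector) vmod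
    \<Rightarrow> ('a \<Rightarrow> 'b \<Rightarrow> complex) set \<Rightarrow> ('v, 'a \<Rightarrow> 'b \<Rightarrow> complex) vmod" where
  "Pz_dual V z M1 M2 U = \<lparr>vspace = U, vop = (\<lambda>v n. tau_delta V z M1 M2 v (-1) (- n - 1))\<rparr>"

definition Pz_compatible ::
  "'v::complex_vector voa \<Rightarrow> complex \<Rightarrow> ('v, 'a::complex_vector) vmod \<Rightarrow> ('v, 'b::complex_vector) vmod
    \<Rightarrow> ('a \<Rightarrow> 'b \<Rightarrow> complex) \<Rightarrow> bool" where
  "Pz_compatible V z M1 M2 f \<longleftrightarrow>
     (let Y' = Ycoeff (Pz_dual V z M1 M2 (dual_tensor (vspace M1) (vspace M2))) in
      \<forall>v. (\<exists>N. \<forall>p<N. Y' v p f = 0)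
        \<and> (\<forall>a b. tau_delta V z M1 M2 v a b f
              = Sum_any (\<lambda>(r, p). (fdelta a (p - b) r * z powi r) *\<^sub>C Y' v p f)))"

definition diamond ::
  "'v::complex_vector voa \<Rightarrow> complex \<Rightarrow> ('v, 'a::complex_vector) vmod \<Rightarrow> ('v, 'b::complex_vector) vmod
    \<Rightarrow> ('v, 'a \<Rightarrow> 'b \<Rightarrow> complex) vmod" where
  "diamond V z M1 M2 = Pz_dual V z M1 M2 (cvec.span (\<Union>{U.
     U \<subseteq> dual_tensor (vspace M1) (vspace M2) \<and> vmodule V (Pz_dual V z M1 M2 U)
     \<and> (\<forall>f\<in>U. Pz_compatible V z M1 M2 f)}))"

definition boxtimes ::
  "'v::complex_vector voa \<Rightarrow> complex \<Rightarrow> ('v, 'a::complex_vector) vmod \<Rightarrow> ('v, 'b::complex_vector) vmod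
    \<Rightarrow> ('v, ('a \<Rightarrow> 'b \<Rightarrow> complex) \<Rightarrow> complex) vmod" where
  "boxtimes V z M1 M2 = contragredient V (diamond V z M1 M2)"

text \<open>The canonical map. The pairing of an element \<open>f\<close> of a module with an element \<open>x\<close> of the
  completion of its contragredient is \<open>\<Sum>\<^sub>n x\<^sub>n(f)\<close>; the weight-\<open>n\<close> component of the canonical map
  therefore sends \<open>f\<close> to the value of \<open>f\<^sub>n\<close>, and \<open>boxtimes_map_pairing\<close> below is the property
  determining the map.\<close>

definition boxtimes_map ::
  "'v::complex_vector voa \<Rightarrow> complex \<Rightarrow> ('v, 'a::complex_vector) vmod \<Rightarrow> ('v, 'b::complex_vector) vmod
    \<Rightarrow> 'a \<Rightarrow> 'b \<Rightarrow> complex \<Rightarrow> ('a \<Rightarrow> 'b \<Rightarrow> complex) \<Rightarrow> complex" where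
  "boxtimes_map V z M1 M2 w1 w2 n f =
     (if f \<in> vspace (diamond V z M1 M2) then wt_comp V (diamond V z M1 M2) f n w1 w2 else 0)"

context generalized_module
begin

lemma Lop_closed: "w \<in> vspace M \<Longrightarrow> Lop V M n w \<in> vspace M"
  by (simp add: Lop_def vop_closed)

lemma linear_Lop: "linear_on (vspace M) (Lop V M n)"
  using vop_bilinear[of "n + 1"] unfolding bilinear_on_def Lop_def by blast

lemma wt_subspace: "cvec.subspace (wt_space V M n)"
proof -
  have "Lop V M 0 (0 *\<^sub>C 0) = 0 *\<^sub>C Lop V M 0 0"
    using linear_Lop[of 0] cvec.subspace_0[OF subspace] unfolding linear_on_def by blast
  then show ?thesis
    using linear_Lop[of 0] subspace
    unfolding cvec.subspace_def wt_space_def linear_on_def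
    by (auto simp: scaleC_add_right scaleC_scaleC mult.commute)
qed

lemma Lop_sum:
  assumes "finite S" "\<And>i. i \<in> S \<Longrightarrow> c i \<in> vspace M"
  shows "Lop V M 0 (sum c S) = (\<Sum>i\<in>S. Lop V M 0 (c i))"
  using assms
proof (induction S rule: finite_induct)
  case empty
  then show ?case
    using cvec.subspace_0[OF wt_subspace[of 0]] by (simp add: wt_space_def)
next
  case (insert i S)
  have "sum c S \<in> vspace M"
    using insert.prems by (intro cvec.subspace_sum[OF subspace]) auto
  then show ?case
    using insert linear_Lop[of 0] unfolding linear_on_def by simp
qed

lemma wt_independent:
  assumes "finite S" "\<And>n. n \<in> S \<Longrightarrow> c n \<in> wt_space V M n" "sum c S = 0"
  shows "\<forall>n\<in>S. c n = 0"
  using assms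
proof (induction S arbitrary: c rule: finite_induct)
  case (insert m S)
  define d where "d n = (n - m) *\<^sub>C c n" for n
  have wt: "c n \<in> vspace M" "Lop V M 0 (c n) = n *\<^sub>C c n" if "n \<in> insert m S" for n
    using insert.prems(1)[OF that] by (auto simp: wt_space_def)
  have "Lop V M 0 (sum c (insert m S)) = (\<Sum>n\<in>insert m S. n *\<^sub>C c n)"
    using Lop_sum[of "insert m S" c] wt insert.hyps(1) by simp
  moreover have "Lop V M 0 0 = 0"
    using cvec.subspace_0[OF wt_subspace[of 0]] by (simp add: wt_space_def)
  ultimately have 1: "(\<Sum>n\<in>insert m S. n *\<^sub>C c n) = 0"
    using insert.prems(2) by simp
  have "(\<Sum>n\<in>insert m S. m *\<^sub>C c n) = m *\<^sub>C sum c (insert m S)"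
    by (rule cvec.scale_sum_right[symmetric])
  then have 2: "(\<Sum>n\<in>insert m S. m *\<^sub>C c n) = 0"
    using insert.prems(2) by simp
  have "(\<Sum>n\<in>insert m S. d n) = 0"
    unfolding d_def cvec.scale_left_diff_distrib sum_subtractf using 1 2 by simp
  then have "sum d S = 0"
    using insert.hyps by (simp add: d_def)
  moreover have "d n \<in> wt_space V M n" if "n \<in> S" for n
    unfolding d_def using insert.prems(1)[of n] that by (intro cvec.subspace_scale[OF wt_subspace]) auto
  ultimately have "\<forall>n\<in>S. d n = 0"
    by (intro insert.IH)
  then have S: "\<forall>n\<in>S. c n = 0"
    using insert.hyps(2) by (auto simp: d_def)
  then have "c m = 0"
    using insert.prems(2) insert.hyps by simp
  with S show ?case by simp
qed simp

lemma wt_decomposition: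
  assumes "w \<in> vspace M"
  shows "\<exists>!c. (\<forall>n. c n \<in> wt_space V M n) \<and> finite {n. c n \<noteq> 0} \<and> Sum_any c = w"
proof (rule ex_ex1I)
  define D where "D c w \<longleftrightarrow> (\<forall>n. c n \<in> wt_space V M n) \<and> finite {n. c n \<noteq> 0} \<and> Sum_any c = w" for c w
  have wt0: "0 \<in> wt_space V M n" for n
    using cvec.subspace_0[OF wt_subspace] .
  have "w \<in> cvec.span (\<Union>n. wt_space V M n)"
    using assms graded by simp
  then have "\<exists>c. D c w"
  proof (induction rule: cvec.span_induct_alt)
    case base
    have "D (\<lambda>_. 0) 0"
      using wt0 by (simp add: D_def)
    then show ?case by blast
  next
    case (step a x y)
    then obtain c n where c: "D c y" and x: "x \<in> wt_space V M n"
      by auto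
    define e where "e = (\<lambda>m. if m = n then a *\<^sub>C x else 0)"
    have e: "\<forall>m. e m \<in> wt_space V M m" "{m. e m \<noteq> 0} \<subseteq> {n}"
      using x wt0 by (auto simp: e_def cvec.subspace_scale[OF wt_subspace])
    then have fe: "finite {m. e m \<noteq> 0}"
      using finite_subset by blast
    have "Sum_any e = a *\<^sub>C x"
      using Sum_any.expand_superset[OF _ e(2)] by (simp add: e_def)
    moreover have "finite {m. e m + c m \<noteq> 0}"
      by (rule finite_subset[of _ "{m. e m \<noteq> 0} \<union> {m. c m \<noteq> 0}"])
        (use fe c in \<open>auto simp: D_def\<close>)
    ultimately have "D (\<lambda>m. e m + c m) (a *\<^sub>C x + y)"
      using c e(1) fe Sum_any.distrib[of e c]
      by (auto simp: D_def cvec.subspace_add[OF wt_subspace])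
    then show ?case by blast
  qed
  then show "\<exists>c. (\<forall>n. c n \<in> wt_space V M n) \<and> finite {n. c n \<noteq> 0} \<and> Sum_any c = w"
    by (simp add: D_def)
next
  fix c d
  assume c: "(\<forall>n. c n \<in> wt_space V M n) \<and> finite {n. c n \<noteq> 0} \<and> Sum_any c = w"
    and d: "(\<forall>n. d n \<in> wt_space V M n) \<and> finite {n. d n \<noteq> 0} \<and> Sum_any d = w"
  define S where "S = {n. c n \<noteq> 0} \<union> {n. d n \<noteq> 0}"
  have S: "finite S"
    using c d by (simp add: S_def)
  have "sum c S = w" "sum d S = w"
    using c d S Sum_any.expand_superset[of S c] Sum_any.expand_superset[of S d]
    by (auto simp: S_def)
  then have 0: "(\<Sum>n\<in>S. c n - d n) = 0"
    by (simp add: sum_subtractf)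
  have wt: "c n - d n \<in> wt_space V M n" for n
    by (rule cvec.subspace_diff[OF wt_subspace]) (simp_all only: c d)
  have "\<forall>n\<in>S. c n - d n = 0"
    by (rule wt_independent[OF S wt 0])
  then have "n \<in> S \<Longrightarrow> c n = d n" for n
    by (simp only: right_minus_eq)
  moreover have "n \<notin> S \<Longrightarrow> c n = d n" for n
    unfolding S_def by simp
  ultimately have "c n = d n" for n
    by blast
  then show "c = d"
    by (rule ext)
qed

lemma wt_comp:
  assumes "w \<in> vspace M"
  shows "wt_comp V M w n \<in> wt_space V M n" "finite {n. wt_comp V M w n \<noteq> 0}"
    "Sum_any (wt_comp V M w) = w"
  using theI'[OF wt_decomposition[OF assms], folded wt_comp_def] by simp_all

end

lemma boxtimes_map_pairing:
  assumes "vmodule V (diamond V z M1 M2)" "f \<in> vspace (diamond V z M1 M2)"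
  shows "Sum_any (\<lambda>n. boxtimes_map V z M1 M2 w1 w2 n f) = f w1 w2"
proof -
  interpret vmodule V "diamond V z M1 M2" by fact
  let ?c = "wt_comp V (diamond V z M1 M2) f"
  let ?S = "{n. ?c n \<noteq> 0}"
  have S: "finite ?S"
    by (rule wt_comp(2)[OF assms(2)])
  have eval: "(sum g A) w1 w2 = (\<Sum>n\<in>A. g n w1 w2)"
    if "finite A" for A :: "complex set" and g :: "complex \<Rightarrow> 'b \<Rightarrow> 'c \<Rightarrow> complex"
    using that by (induction A rule: finite_induct) auto
  have "f w1 w2 = (sum ?c ?S) w1 w2"
    using wt_comp(3)[OF assms(2)] by (simp add: Sum_any.expand_set)
  also have "\<dots> = (\<Sum>n\<in>?S. ?c n w1 w2)"
    by (rule eval[OF S])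
  also have "\<dots> = Sum_any (\<lambda>n. ?c n w1 w2)"
    by (rule Sum_any.expand_superset[symmetric, OF S]) auto
  finally show ?thesis
    using assms(2) by (simp add: boxtimes_map_def)
qed

end

theory Submission
  imports Defs "HOL-Computational_Algebra.Formal_Power_Series"
begin

text \<open>
  The canonical map is intertwining because its defining identity, evaluated at \<open>f \<in> W\<^sub>1 \<diamond> W\<^sub>2\<close>, is
  the compatibility condition of \<open>f\<close> read through the involution
  \<open>v \<mapsto> e\<^sup>x\<^sup>L\<^sup>(\<^sup>1\<^sup>) (-x\<^sup>-\<^sup>2)\<^sup>L\<^sup>(\<^sup>0\<^sup>) v\<close>. Conversely, given a product \<open>(W\<^sub>4; G)\<close>, every \<open>\<alpha> \<in> W\<^sub>4'\<close> yields the
  functional \<open>\<langle>\<alpha>, G(w\<^sub>1 \<otimes> w\<^sub>2)\<rangle>\<close>. The intertwining identity says that these functionals are compatible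
  and that \<open>\<alpha> \<mapsto> \<langle>\<alpha>, G\<rangle>\<close> respects the actions, so its image is a compatible module and lies in
  \<open>W\<^sub>1 \<diamond> W\<^sub>2\<close>; the adjoint of this map, followed by \<open>W\<^sub>4'' = W\<^sub>4\<close>, is the required morphism. It is unique
  because the homogeneous components of the canonical map separate the finite-dimensional weight
  spaces of \<open>W\<^sub>1 \<diamond> W\<^sub>2\<close> and hence span those of its contragredient.

  The Jacobi identity for contragredient modules is obtained in terms of modes: the divided powers of
  \<open>L(1)\<close> satisfy a Leibniz rule on \<open>u\<^sub>n v\<close>, and the Borcherds identity for \<open>L(1)\<^sup>i u\<close> and \<open>L(1)\<^sup>j v\<close>,
  summed over \<open>i\<close> and \<open>j\<close>, becomes the one for the opposite modes by Vandermonde's identity.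
\<close>

section \<open>Finitely supported sums\<close>

text \<open>Both halves of the proof turn on one formula, \<open>tau_eq\<close>: \<tau> is the
  right-hand side of the intertwining identity with \<open>v\<close> replaced by e^(xL(1))
  (-x^(-2))^(L(0)) v and x_1 by its inverse. As this substitution is an involution, compatibility of
  a functional and the intertwining identity for it are transforms of each other, and it only has to
  be applied once more to pass between them.

  The obstacle that shapes the details is finiteness. Formal products are convolutions written with
  \<open>Sum_any\<close>, which is 0 on infinite support, so every rearrangement has to come with a
  finite support. There are four sources: lower truncation; local nilpotence of L(1), which makes
  e^(xL(1)) (-x^(-2))^(L(0)) v a Laurent polynomial; the lower bound on the weights, which also
  makes modes of very negative index vanish into a fixed weight of the completion; and the fact that
  an element of a contragredient module sees only finitely many weights.\<close>

lemma Sum_any_reindex: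
  assumes "inj \<phi>" "{x. g x \<noteq> 0} \<subseteq> range \<phi>"
  shows "Sum_any g = Sum_any (\<lambda>i. g (\<phi> i))"
proof -
  have "{x. g x \<noteq> 0} = \<phi> ` {i. g (\<phi> i) \<noteq> 0}"
    using assms(2) by auto
  then have "sum g {x. g x \<noteq> 0} = sum (g \<circ> \<phi>) {i. g (\<phi> i) \<noteq> 0}"
    using assms(1) by (simp add: sum.reindex inj_on_def inj_def)
  then show ?thesis
    by (simp add: Sum_any.expand_set o_def)
qed

lemma finite_support_lessThan:
  assumes "\<And>i. i \<ge> N \<Longrightarrow> g i = 0"
  shows "finite {i::nat. g i \<noteq> 0}"
  by (rule finite_subset[of _ "{..<N}"]) (use assms in \<open>auto simp: not_less[symmetric]\<close>)

lemma Sum_any_lessThan: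
  assumes "\<And>i. i \<ge> N \<Longrightarrow> g i = 0"
  shows "Sum_any g = sum g {..<N::nat}"
  by (rule Sum_any.expand_superset) (use assms in \<open>auto simp: not_less[symmetric]\<close>)

lemma sum_fun_apply: "sum g S w = (\<Sum>i\<in>S. g i w)"
  by (induction S rule: infinite_finite_induct) auto

lemma Sum_any_fun_apply:
  assumes "finite {i. g i \<noteq> 0}"
  shows "Sum_any g w = Sum_any (\<lambda>i. g i w)"
proof -
  have "Sum_any (\<lambda>i. g i w) = (\<Sum>i\<in>{i. g i \<noteq> 0}. g i w)"
    by (rule Sum_any.expand_superset[OF assms]) auto
  then show ?thesis
    by (simp add: Sum_any.expand_set sum_fun_apply)
qed

lemma Sum_any_singleton:
  assumes "\<And>i. i \<noteq> j \<Longrightarrow> g i = 0"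
  shows "Sum_any g = g j"
proof -
  have "Sum_any g = sum g {j}"
    by (rule Sum_any.expand_superset) (use assms in auto)
  then show ?thesis by simp
qed

text \<open>No finiteness is assumed: a nonzero scalar does not change the support, so both sides
  are 0 when it is infinite.\<close>

lemma Sum_any_scaleC:
  "Sum_any (\<lambda>i. c *\<^sub>C g i) = c *\<^sub>C Sum_any (g :: _ \<Rightarrow> 'a::complex_vector)"
proof (cases "c = 0")
  case False
  then show ?thesis
    by (simp add: Sum_any.expand_set cvec.scale_sum_right)
qed simp

lemma finite_support_iterated:
  assumes "finite {k. A k \<noteq> {}}" "\<And>k. finite (A k)" "\<And>k i. g k i \<noteq> 0 \<Longrightarrow> i \<in> A k"
  shows "finite {(k, i). g k i \<noteq> 0}"
proof -
  have "{(k, i). g k i \<noteq> 0} \<subseteq> Sigma {k. A k \<noteq> {}} A"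
    using assms(3) by auto
  then show ?thesis
    by (rule finite_subset) (use assms in auto)
qed

lemma Sum_any_iterated:
  assumes "finite {(k, i). g k i \<noteq> 0}"
  shows "Sum_any (\<lambda>k. Sum_any (g k)) = Sum_any (\<lambda>(k, i). g k i)"
proof -
  let ?S = "{(k, i). g k i \<noteq> 0}"
  have "{k. \<exists>i. g k i \<noteq> 0} = fst ` ?S" "{i. \<exists>k. g k i \<noteq> 0} = snd ` ?S"
    by force+
  then show ?thesis
    using assms by (intro Sum_any.cartesian_product[OF _ subset_refl]) auto
qed

lemma Sum_any_swap:
  assumes "finite {(k, i). g k i \<noteq> 0}"
  shows "Sum_any (\<lambda>k. Sum_any (g k)) = Sum_any (\<lambda>i. Sum_any (\<lambda>k. g k i))"
proof -
  let ?S = "{(k, i). g k i \<noteq> 0}"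
  have "{k. \<exists>i. g k i \<noteq> 0} = fst ` ?S" "{i. \<exists>k. g k i \<noteq> 0} = snd ` ?S"
    by force+
  then show ?thesis
    using assms by (intro Sum_any.swap[OF _ subset_refl]) auto
qed

section \<open>Linear maps\<close>

lemma scaleC_fun_apply [simp]: "(c *\<^sub>C f) x = c *\<^sub>C f x"
  by (simp add: scaleC_fun_def)

lemma linear_onD:
  assumes "linear_on W f"
  shows "x \<in> W \<Longrightarrow> y \<in> W \<Longrightarrow> f (x + y) = f x + f y" "x \<in> W \<Longrightarrow> f (c *\<^sub>C x) = c *\<^sub>C f x"
  using assms by (auto simp: linear_on_def)

lemma linear_onI:
  assumes "\<And>x y. x \<in> W \<Longrightarrow> y \<in> W \<Longrightarrow> f (x + y) = f x + f y" "\<And>c x. x \<in> W \<Longrightarrow> f (c *\<^sub>C x) = c *\<^sub>C f x"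
  shows "linear_on W f"
  using assms by (auto simp: linear_on_def)

lemma linear_on_zero:
  assumes "linear_on W f" "cvec.subspace W"
  shows "f 0 = 0"
  using linear_onD(2)[OF assms(1) cvec.subspace_0[OF assms(2)], of 0] by simp

lemma linear_on_sum:
  assumes "linear_on W f" "cvec.subspace W" "\<And>i. i \<in> S \<Longrightarrow> g i \<in> W"
  shows "f (sum g S) = (\<Sum>i\<in>S. f (g i))"
  using assms(3)
proof (induction S rule: infinite_finite_induct)
  case (insert x F)
  have "sum g F \<in> W"
    using insert.prems by (intro cvec.subspace_sum[OF assms(2)]) auto
  then show ?case
    using insert linear_onD(1)[OF assms(1)] by auto
qed (use linear_on_zero[OF assms(1,2)] in auto)

lemma subspace_Sum_any:
  assumes "cvec.subspace W" "\<And>i. g i \<in> W"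
  shows "Sum_any g \<in> W"
  unfolding Sum_any.expand_set by (rule cvec.subspace_sum) (use assms in auto)

lemma linear_on_Sum_any:
  assumes "linear_on W f" "cvec.subspace W" "\<And>i. g i \<in> W" "finite {i. g i \<noteq> 0}"
  shows "f (Sum_any g) = Sum_any (\<lambda>i. f (g i))"
proof -
  have "Sum_any (\<lambda>i. f (g i)) = (\<Sum>i\<in>{i. g i \<noteq> 0}. f (g i))"
    by (rule Sum_any.expand_superset[OF assms(4)]) (use linear_on_zero[OF assms(1,2)] in auto)
  then show ?thesis
    by (simp add: Sum_any.expand_set linear_on_sum[OF assms(1,2)] assms(3))
qed

lemma linear_on_scaled_Sum_any:
  assumes "linear_on W f" "cvec.subspace W" "\<And>i. g i \<in> W" "finite {i. g i \<noteq> 0}"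
  shows "f (Sum_any (\<lambda>i. c i *\<^sub>C g i)) = Sum_any (\<lambda>i. c i *\<^sub>C f (g i))"
proof -
  have "finite {i. c i *\<^sub>C g i \<noteq> 0}"
    by (rule finite_subset[OF _ assms(4)]) auto
  then show ?thesis
    using linear_on_Sum_any[OF assms(1,2), of "\<lambda>i. c i *\<^sub>C g i"] assms(3)
    by (simp add: cvec.subspace_scale[OF assms(2)] linear_onD(2)[OF assms(1)])
qed

lemma linear_on_diff:
  assumes "linear_on W f" "cvec.subspace W" "x \<in> W" "y \<in> W"
  shows "f (x - y) = f x - f y"
proof -
  have "(-1) *\<^sub>C y \<in> W"
    using assms(2,4) by (rule cvec.subspace_scale)
  from linear_onD(1)[OF assms(1,3) this] show ?thesis
    unfolding linear_onD(2)[OF assms(1,4)] by simp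
qed

lemma linear_on_add_fun: "linear_on W f \<Longrightarrow> linear_on W g \<Longrightarrow> linear_on W (\<lambda>x. f x + g x)"
  by (simp add: linear_on_def scaleC_add_right algebra_simps)

lemma linear_on_diff_fun: "linear_on W f \<Longrightarrow> linear_on W g \<Longrightarrow> linear_on W (\<lambda>x. f x - g x)"
  by (simp add: linear_on_def cvec.scale_right_diff_distrib algebra_simps)

lemma linear_on_scale_fun: "linear_on W f \<Longrightarrow> linear_on W (\<lambda>x. c *\<^sub>C f x)"
  by (simp add: linear_on_def scaleC_add_right scaleC_scaleC mult.commute)

lemma linear_on_zero_fun: "linear_on W (\<lambda>x. 0)"
  by (simp add: linear_on_def)

lemma linear_on_compose:
  "linear_on W f \<Longrightarrow> linear_on W' g \<Longrightarrow> (\<And>x. x \<in> W \<Longrightarrow> f x \<in> W') \<Longrightarrow> linear_on W (\<lambda>x. g (f x))"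
  by (simp add: linear_on_def)

lemma linear_on_subset: "linear_on W f \<Longrightarrow> U \<subseteq> W \<Longrightarrow> linear_on U f"
  unfolding linear_on_def by blast

lemma linear_on_Sum_any_fun:
  assumes "\<And>i. linear_on W (f i)" "\<And>x. x \<in> W \<Longrightarrow> finite {i. f i x \<noteq> 0}"
  shows "linear_on W (\<lambda>x. Sum_any (\<lambda>i. f i x))"
proof (rule linear_onI)
  fix x y assume "x \<in> W" "y \<in> W"
  then show "Sum_any (\<lambda>i. f i (x + y)) = Sum_any (\<lambda>i. f i x) + Sum_any (\<lambda>i. f i y)"
    using Sum_any.distrib[of "\<lambda>i. f i x" "\<lambda>i. f i y"] assms
    by (simp add: linear_onD(1)[OF assms(1)])
next
  fix c x assume "x \<in> W"
  then show "Sum_any (\<lambda>i. f i (c *\<^sub>C x)) = c *\<^sub>C Sum_any (\<lambda>i. f i x)"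
    by (simp add: linear_onD(2)[OF assms(1)] Sum_any_scaleC)
qed

lemma subspace_linear_zero:
  assumes "linear_on UNIV f"
  shows "cvec.subspace {x. f x = 0}"
  using linear_on_zero[OF assms cvec.subspace_UNIV]
  by (auto simp: cvec.subspace_def linear_onD[OF assms])

lemma finite_support_add:
  "finite {i. f i \<noteq> 0} \<Longrightarrow> finite {i. g i \<noteq> 0} \<Longrightarrow> finite {i. f i + g i \<noteq> (0::'a::group_add)}"
  by (rule finite_subset[of _ "{i. f i \<noteq> 0} \<union> {i. g i \<noteq> 0}"]) auto

section \<open>Coefficients of the delta functions\<close>

text \<open>The coefficient of x^(l-i) y^i in (x - y)^l, expanded in nonnegative powers of
  y.\<close>

definition sgn_binom :: "int \<Rightarrow> nat \<Rightarrow> complex" where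
  "sgn_binom l i = (-1) ^ i * (of_int l gchoose i)"

lemma fdelta_support: "fdelta a b c \<noteq> 0 \<Longrightarrow> c \<ge> 0 \<and> a + b + c = -1"
  by (simp add: fdelta_def split: if_splits)

lemma fdelta_neg_support: "fdelta_neg a b c \<noteq> 0 \<Longrightarrow> c \<ge> 0 \<and> a + b + c = -1"
  by (rule fdelta_support) (auto simp: fdelta_neg_def)

lemma fdelta_nat: "a + b + int i = -1 \<Longrightarrow> fdelta a b (int i) = sgn_binom (- a - 1) i"
  by (simp add: fdelta_def sgn_binom_def)

lemma fdelta_neg_nat:
  "a + b + int i = -1 \<Longrightarrow> fdelta_neg a b (int i) = (-1) powi (a + 1) * sgn_binom (- a - 1) i"
  by (simp add: fdelta_neg_def fdelta_nat)

text \<open>Upper negation. Where the power of the binomial varies with \<open>i\<close>, this turns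
  its coefficient into a binomial coefficient with a fixed upper argument.\<close>

lemma sgn_binom_flip: "sgn_binom (int i - m - 1) i = of_int m gchoose i"
  using gbinomial_negated_upper[of "of_int m :: complex" i]
  by (simp add: sgn_binom_def)

text \<open>A delta function is homogeneous and involves only nonnegative powers of the second
  summand, so a convolution with it over pairs of exponents collapses to a sum over
  \<open>nat\<close>. The terms off the curve vanish, so nothing has to be known about the support
  of \<open>G\<close>.\<close>

lemma sum_reparam:
  fixes G :: "int \<Rightarrow> int \<Rightarrow> 'a::complex_vector" and c :: "int \<Rightarrow> int \<Rightarrow> complex"
  assumes "inj (\<lambda>i::nat. (f i, g i))"
    and "\<And>p q. c p q \<noteq> 0 \<Longrightarrow> \<exists>i. p = f i \<and> q = g i"
    and "\<And>i. c (f i) (g i) = d i"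
  shows "Sum_any (\<lambda>(p, q). c p q *\<^sub>C G p q) = Sum_any (\<lambda>i::nat. d i *\<^sub>C G (f i) (g i))"
proof -
  have "{x. (\<lambda>(p, q). c p q *\<^sub>C G p q) x \<noteq> 0} \<subseteq> range (\<lambda>i. (f i, g i))"
    using assms(2) by force
  then show ?thesis
    using Sum_any_reindex[OF assms(1), of "\<lambda>(p, q). c p q *\<^sub>C G p q"] by (simp add: assms(3))
qed

lemma sum_fdelta_pair:
  fixes G :: "int \<Rightarrow> int \<Rightarrow> 'a::complex_vector"
  shows "Sum_any (\<lambda>(p, q). fdelta a (b - p) (c - q) *\<^sub>C G p q)
    = Sum_any (\<lambda>i::nat. sgn_binom (- a - 1) i *\<^sub>C G (a + b + 1 + int i) (c - int i))"
proof (rule sum_reparam)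
  show "\<exists>i::nat. p = a + b + 1 + int i \<and> q = c - int i" if "fdelta a (b - p) (c - q) \<noteq> 0" for p q
    using fdelta_support[OF that] by (intro exI[of _ "nat (c - q)"]) auto
qed (auto simp: inj_def fdelta_nat)

lemma sum_fdelta_neg_pair:
  fixes G :: "int \<Rightarrow> int \<Rightarrow> 'a::complex_vector"
  shows "Sum_any (\<lambda>(p, q). fdelta_neg a (c - q) (b - p) *\<^sub>C G p q)
    = Sum_any (\<lambda>i::nat. ((-1) powi (a + 1) * sgn_binom (- a - 1) i) *\<^sub>C G (b - int i) (a + c + 1 + int i))"
proof (rule sum_reparam)
  show "\<exists>i::nat. p = b - int i \<and> q = a + c + 1 + int i" if "fdelta_neg a (c - q) (b - p) \<noteq> 0" for p q
    using fdelta_neg_support[OF that] by (intro exI[of _ "nat (b - p)"]) auto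
qed (auto simp: inj_def fdelta_neg_nat)

lemma sum_fdelta_iterate:
  fixes G :: "int \<Rightarrow> int \<Rightarrow> 'a::complex_vector"
  shows "Sum_any (\<lambda>(p, q). fdelta (c - q) b (a - p) *\<^sub>C G p q)
    = Sum_any (\<lambda>i::nat. (of_int (- b - 1) gchoose i) *\<^sub>C G (a - int i) (b + c + 1 + int i))"
proof (rule sum_reparam)
  show "\<exists>i::nat. p = a - int i \<and> q = b + c + 1 + int i" if "fdelta (c - q) b (a - p) \<noteq> 0" for p q
    using fdelta_support[OF that] by (intro exI[of _ "nat (a - p)"]) auto
  show "fdelta (c - (b + c + 1 + int i)) b (a - (a - int i)) = of_int (- b - 1) gchoose i" for i
    using sgn_binom_flip[of i "- b - 1"] by (simp add: fdelta_nat algebra_simps)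
qed (auto simp: inj_def)

lemma sum_fdelta_Pz:
  fixes H :: "int \<Rightarrow> 'a::complex_vector"
  shows "Sum_any (\<lambda>(r, p). (fdelta a (b - p) r * z powi r) *\<^sub>C H p)
    = Sum_any (\<lambda>i::nat. (sgn_binom (- a - 1) i * z ^ i) *\<^sub>C H (a + b + 1 + int i))"
proof (rule sum_reparam)
  show "\<exists>i::nat. r = int i \<and> p = a + b + 1 + int i" if "fdelta a (b - p) r * z powi r \<noteq> 0" for r p
    using fdelta_support[of a "b - p" r] that by (intro exI[of _ "nat r"]) auto
qed (auto simp: inj_def fdelta_nat)

lemma sum_fdelta_Pz_inverse:
  fixes H :: "int \<Rightarrow> 'a::complex_vector"
  shows "Sum_any (\<lambda>(r, p). (fdelta a (p - b) r * z powi r) *\<^sub>C H p)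
    = Sum_any (\<lambda>i::nat. (sgn_binom (- a - 1) i * z ^ i) *\<^sub>C H (b - a - 1 - int i))"
proof (rule sum_reparam)
  show "\<exists>i::nat. r = int i \<and> p = b - a - 1 - int i" if "fdelta a (p - b) r * z powi r \<noteq> 0" for r p
    using fdelta_support[of a "p - b" r] that by (intro exI[of _ "nat r"]) auto
qed (auto simp: inj_def fdelta_nat)

lemma sum_fdelta_Pz_first:
  fixes H :: "int \<Rightarrow> 'a::complex_vector"
  shows "Sum_any (\<lambda>(r, p). (fdelta r b (a - p) * z powi r) *\<^sub>C H p)
    = Sum_any (\<lambda>i::nat. ((of_int (- b - 1) gchoose i) * z powi (- b - 1 - int i)) *\<^sub>C H (a - int i))"
proof (rule sum_reparam)
  show "\<exists>i::nat. r = - b - 1 - int i \<and> p = a - int i" if "fdelta r b (a - p) * z powi r \<noteq> 0" for r p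
    using fdelta_support[of r b "a - p"] that by (intro exI[of _ "nat (a - p)"]) auto
  show "fdelta (- b - 1 - int i) b (a - (a - int i)) * z powi (- b - 1 - int i)
      = (of_int (- b - 1) gchoose i) * z powi (- b - 1 - int i)" for i
    using sgn_binom_flip[of i "- b - 1"] by (simp add: fdelta_nat algebra_simps)
qed (auto simp: inj_def)

lemma sum_fdelta_Pz_second:
  fixes H :: "int \<Rightarrow> 'a::complex_vector"
  shows "Sum_any (\<lambda>(r, p). (fdelta_neg a r (b - p) * z powi r) *\<^sub>C H p)
    = Sum_any (\<lambda>i::nat. ((-1) powi (a + 1) * sgn_binom (- a - 1) i * z powi (- a - 1 - int i)) *\<^sub>C H (b - int i))"
proof (rule sum_reparam)
  show "\<exists>i::nat. r = - a - 1 - int i \<and> p = b - int i" if "fdelta_neg a r (b - p) * z powi r \<noteq> 0" for r p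
    using fdelta_neg_support[of a r "b - p"] that by (intro exI[of _ "nat (b - p)"]) auto
qed (auto simp: inj_def fdelta_neg_nat)

section \<open>Borcherds identity and weights\<close>

text \<open>With \<open>product_side\<close> below, the two sides of the Borcherds identity: the
  Jacobi identity at x_0^a x_1^b x_2^c with l = -a-1, m = -b-1, n = -c-1.\<close>

definition iterate_side ::
  "'v voa \<Rightarrow> ('v, 'a::complex_vector) vmod \<Rightarrow> 'v \<Rightarrow> 'v \<Rightarrow> int \<Rightarrow> int \<Rightarrow> int \<Rightarrow> 'a \<Rightarrow> 'a" where
  "iterate_side V M u v m n l w =
     Sum_any (\<lambda>i. (of_int m gchoose i) *\<^sub>C vop M (vertop V u (l + int i) v) (m + n - int i) w)"

definition product_side ::
  "('v, 'a::complex_vector) vmod \<Rightarrow> 'v \<Rightarrow> 'v \<Rightarrow> int \<Rightarrow> int \<Rightarrow> int \<Rightarrow> 'a \<Rightarrow> 'a" where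
  "product_side M u v m n l w =
     Sum_any (\<lambda>i. sgn_binom l i *\<^sub>C vop M u (m + l - int i) (vop M v (n + int i) w))
     - Sum_any (\<lambda>i. ((-1) powi l * sgn_binom l i) *\<^sub>C vop M v (n + l - int i) (vop M u (m + int i) w))"

lemma jacobi_identity_iff:
  "jacobi_identity V M \<longleftrightarrow>
    (\<forall>u v. \<forall>w\<in>vspace M. \<forall>m n l. iterate_side V M u v m n l w = product_side M u v m n l w)"
    (is "?J \<longleftrightarrow> ?B")
proof -
  have 1: "Sum_any (\<lambda>(p, q). fdelta (c - q) b (a - p) *\<^sub>C Ycoeff M (Ycoeff (adjoint V) u p v) q w)
      = iterate_side V M u v (- b - 1) (- c - 1) (- a - 1) w" for u v w a b c
    unfolding sum_fdelta_iterate iterate_side_def Ycoeff_def adjoint_def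
    by (simp add: algebra_simps)
  \<comment> \<open>The exponents are opposite, so the parities agree; the one on the right is
    \<open>l\<close>.\<close>
  have sgn: "(-1 :: complex) powi (a + 1) = (-1) powi (- a - 1)" for a
    using power_int_minus[of "-1 :: complex" "a + 1"]
    by (cases "even (a + 1)") (auto simp: power_int_minus_left)
  have 2: "Sum_any (\<lambda>(p, q). fdelta a (b - p) (c - q) *\<^sub>C Ycoeff M u p (Ycoeff M v q w))
     - Sum_any (\<lambda>(p, q). fdelta_neg a (c - q) (b - p) *\<^sub>C Ycoeff M v q (Ycoeff M u p w))
     = product_side M u v (- b - 1) (- c - 1) (- a - 1) w" for u v w a b c
    unfolding sum_fdelta_pair sum_fdelta_neg_pair[where G = "\<lambda>p q. Ycoeff M v q (Ycoeff M u p w)"]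
    unfolding product_side_def Ycoeff_def sgn
    by (simp add: algebra_simps)
  show ?thesis
  proof
    assume J: ?J
    show ?B
    proof (intro allI ballI)
      fix u v w m n l assume "w \<in> vspace M"
      then have "product_side M u v (- (-m-1) - 1) (- (-n-1) - 1) (- (-l-1) - 1) w
          = iterate_side V M u v (- (-m-1) - 1) (- (-n-1) - 1) (- (-l-1) - 1) w"
        using J unfolding jacobi_identity_def 1 2 by blast
      then show "iterate_side V M u v m n l w = product_side M u v m n l w" by simp
    qed
  next
    assume ?B
    then show ?J
      unfolding jacobi_identity_def 1 2 by simp
  qed
qed

lemma gchoose_nat_eq_0: "n < i \<Longrightarrow> (of_nat n :: complex) gchoose i = 0"
  by (metis binomial_eq_0 binomial_gbinomial of_nat_0)

lemma sgn_binom_0: "sgn_binom 0 i = (if i = 0 then 1 else 0)"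
  using gchoose_nat_eq_0[of 0 i] by (simp add: sgn_binom_def)

context generalized_module
begin

lemma borcherds:
  "w \<in> vspace M \<Longrightarrow> iterate_side V M u v m n l w = product_side M u v m n l w"
  using jacobi by (simp add: jacobi_identity_iff)

lemma vop_linear: "linear_on (vspace M) (vop M v n)"
  using vop_bilinear[of n] by (simp add: bilinear_on_def)

lemma vop_linear_left: "w \<in> vspace M \<Longrightarrow> linear_on UNIV (\<lambda>v. vop M v n w)"
  using vop_bilinear[of n] by (simp add: bilinear_on_def)

lemma vop_zero [simp]: "vop M v n 0 = 0"
  by (rule linear_on_zero[OF vop_linear subspace])

lemma vop_zero_left [simp]: "w \<in> vspace M \<Longrightarrow> vop M 0 n w = 0"
  by (rule linear_on_zero[OF vop_linear_left cvec.subspace_UNIV])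

lemma vop_scale_left: "w \<in> vspace M \<Longrightarrow> vop M (c *\<^sub>C v) n w = c *\<^sub>C vop M v n w"
  by (rule linear_onD(2)[OF vop_linear_left UNIV_I])

lemma wt_in_vspace: "w \<in> wt_space V M n \<Longrightarrow> w \<in> vspace M"
  by (simp add: wt_space_def)

lemma wt_comp_unique:
  assumes "\<And>n. c n \<in> wt_space V M n" "finite {n. c n \<noteq> 0}" "Sum_any c = w"
  shows "wt_comp V M w = c"
proof -
  have "w \<in> vspace M"
    using assms(3) subspace_Sum_any[OF subspace, of c] wt_in_vspace[OF assms(1)] by blast
  from ex1_implies_ex[OF wt_decomposition[OF this]] show ?thesis
    unfolding wt_comp_def using assms wt_decomposition[OF \<open>w \<in> vspace M\<close>]
    by (intro the1_equality) auto
qed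

lemma wt_comp_wt:
  assumes "w \<in> wt_space V M h"
  shows "wt_comp V M w n = (if n = h then w else 0)"
proof -
  have "wt_comp V M w = (\<lambda>n. if n = h then w else 0)"
    by (rule wt_comp_unique) (use assms cvec.subspace_0[OF wt_subspace] in auto)
  then show ?thesis by simp
qed

lemma wt_comp_linear: "linear_on (vspace M) (\<lambda>w. wt_comp V M w n)"
proof (rule linear_onI)
  fix x y assume xy: "x \<in> vspace M" "y \<in> vspace M"
  have "wt_comp V M (x + y) = (\<lambda>n. wt_comp V M x n + wt_comp V M y n)"
    using wt_comp[OF xy(1)] wt_comp[OF xy(2)]
    by (intro wt_comp_unique)
      (auto intro: cvec.subspace_add[OF wt_subspace] finite_support_add simp: Sum_any.distrib)
  then show "wt_comp V M (x + y) n = wt_comp V M x n + wt_comp V M y n" by simp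
next
  fix c x assume x: "x \<in> vspace M"
  have "finite {n. c *\<^sub>C wt_comp V M x n \<noteq> 0}"
    by (rule finite_subset[OF _ wt_comp(2)[OF x]]) auto
  then have "wt_comp V M (c *\<^sub>C x) = (\<lambda>n. c *\<^sub>C wt_comp V M x n)"
    using wt_comp[OF x]
    by (intro wt_comp_unique) (auto intro: cvec.subspace_scale[OF wt_subspace] simp: Sum_any_scaleC)
  then show "wt_comp V M (c *\<^sub>C x) n = c *\<^sub>C wt_comp V M x n" by simp
qed

lemma wt_comp_vspace: "w \<in> vspace M \<Longrightarrow> wt_comp V M w n \<in> vspace M"
  using wt_comp(1) wt_in_vspace by blast

text \<open>The case \<open>l = 0\<close> of the Borcherds identity: only the first term of each
  product survives, and the nonnegative upper argument \<open>m\<close> cuts off the iterate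
  side.\<close>

lemma commutator:
  assumes "w \<in> vspace M"
  shows "vop M u (int m) (vop M v n w) - vop M v n (vop M u (int m) w)
    = (\<Sum>i\<le>m. of_nat (m choose i) *\<^sub>C vop M (vertop V u (int i) v) (int m + n - int i) w)"
proof -
  have "iterate_side V M u v (int m) n 0 w
      = (\<Sum>i\<le>m. (of_nat m gchoose i) *\<^sub>C vop M (vertop V u (int i) v) (int m + n - int i) w)"
    unfolding iterate_side_def
    by (subst Sum_any_lessThan[of "Suc m"]) (auto simp: gchoose_nat_eq_0 lessThan_Suc_atMost)
  moreover have "product_side M u v (int m) n 0 w
      = vop M u (int m) (vop M v n w) - vop M v n (vop M u (int m) w)"
    unfolding product_side_def
    by (subst (1 2) Sum_any_singleton[of 0]) (auto simp: sgn_binom_0)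
  ultimately show ?thesis
    using borcherds[OF assms, of u v "int m" n 0] by (simp add: binomial_gbinomial)
qed

lemma L_minus_one_mode:
  "w \<in> vspace M \<Longrightarrow> vop M (Lop V (adjoint V) (-1) v) n w = (- of_int n) *\<^sub>C vop M v (n - 1) w"
  using derivative by (simp add: L_derivative_def)

text \<open>\<open>L(0)\<close> is the mode 1 of the conformal vector, so the commutator formula has
  two terms: \<open>i = 0\<close> contributes the derivative and \<open>i = 1\<close> the weight of
  \<open>v\<close>.\<close>

lemma L0_commutator:
  assumes "w \<in> vspace M" "v \<in> wt_space V (adjoint V) h"
  shows "Lop V M 0 (vop M v n w) = vop M v n (Lop V M 0 w) + (h - of_int n - 1) *\<^sub>C vop M v n w"
proof -
  have "Lop V (adjoint V) 0 v = h *\<^sub>C v"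
    using assms(2) by (simp add: wt_space_def)
  then have "vertop V (conformal V) 1 v = h *\<^sub>C v"
    "vertop V (conformal V) 0 v = Lop V (adjoint V) (-1) v"
    by (simp_all add: Lop_def adjoint_def)
  then show ?thesis
    using commutator[OF assms(1), of "conformal V" 1 v n] L_minus_one_mode[OF assms(1), of v "n + 1"]
    by (simp add: Lop_def vop_scale_left[OF assms(1)] algebra_simps
        cvec.scale_left_diff_distrib cvec.scale_left_distrib)
qed

text \<open>Mode 2 of the conformal vector gives three terms. The scalar combines -(n + 2) from the
  derivative with 2h from the \<open>i = 1\<close> term; the \<open>i = 2\<close> term is the mode
  of \<open>L(1) v\<close>.\<close>

lemma L1_commutator:
  assumes "w \<in> vspace M" "v \<in> wt_space V (adjoint V) h"
  shows "Lop V M 1 (vop M v n w) = vop M v n (Lop V M 1 w) + vop M (Lop V (adjoint V) 1 v) n w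
    + (2 * h - of_int n - 2) *\<^sub>C vop M v (n + 1) w"
proof -
  have "Lop V (adjoint V) 0 v = h *\<^sub>C v"
    using assms(2) by (simp add: wt_space_def)
  then have "vertop V (conformal V) 1 v = h *\<^sub>C v"
    "vertop V (conformal V) 0 v = Lop V (adjoint V) (-1) v"
    "vertop V (conformal V) 2 v = Lop V (adjoint V) 1 v"
    by (simp_all add: Lop_def adjoint_def)
  then show ?thesis
    using commutator[OF assms(1), of "conformal V" 2 v n] L_minus_one_mode[OF assms(1), of v "n + 2"]
    by (simp add: Lop_def vop_scale_left[OF assms(1)] algebra_simps numeral_2_eq_2
        cvec.scale_left_diff_distrib cvec.scale_left_distrib scaleC_scaleC)
qed

lemma vop_wt:
  assumes "w \<in> wt_space V M \<mu>" "v \<in> wt_space V (adjoint V) h"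
  shows "vop M v n w \<in> wt_space V M (\<mu> + h - of_int n - 1)"
proof -
  have w: "w \<in> vspace M" "Lop V M 0 w = \<mu> *\<^sub>C w"
    using assms(1) by (auto simp: wt_space_def)
  have "Lop V M 0 (vop M v n w) = (\<mu> + h - of_int n - 1) *\<^sub>C vop M v n w"
    using L0_commutator[OF w(1) assms(2), of n] linear_onD(2)[OF vop_linear w(1)] w(2)
    by (simp add: cvec.scale_left_diff_distrib cvec.scale_left_distrib)
  then show ?thesis
    using w by (simp add: wt_space_def vop_closed)
qed

end

section \<open>Divided powers of \<open>L(1)\<close>\<close>

text \<open>Modes acting on \<open>V\<close> itself can then be handled by the same lemmas as modes
  on a module.\<close>

sublocale vertex_operator_algebra \<subseteq> adj: generalized_module V "adjoint V"
proof
  show "vspace (adjoint V) = cvec.span (\<Union>n. wt_space V (adjoint V) n)"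
  proof -
    have "cvec.span (\<Union>n. wt_space V (adjoint V) (of_int n)) \<subseteq> cvec.span (\<Union>n. wt_space V (adjoint V) n)"
      by (rule cvec.span_mono) auto
    then show ?thesis
      using int_graded by (auto simp: adjoint_def)
  qed
qed (use vertop_bilinear lower_truncation vacuum_property jacobi derivative in
    \<open>auto simp: adjoint_def cvec.subspace_UNIV\<close>)

text \<open>The coefficient of x^i in e^(xL(1)) v. With the factorial divided out, the Leibniz rule
  for modes carries a single binomial coefficient.\<close>

definition div_L1 :: "'v::complex_vector voa \<Rightarrow> nat \<Rightarrow> 'v \<Rightarrow> 'v" where
  "div_L1 V i v = (1 / fact i) *\<^sub>C (Lop V (adjoint V) 1 ^^ i) v"

definition simplex :: "nat \<Rightarrow> (nat \<times> nat \<times> nat) set" where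
  "simplex r = {(i, j, s). i + j + s = r}"

lemma finite_simplex: "finite (simplex r)"
  by (rule finite_subset[of _ "{..r} \<times> {..r} \<times> {..r}"]) (auto simp: simplex_def)

lemma sum_simplex_reindex:
  assumes "\<And>y. y \<in> simplex r \<Longrightarrow> up y \<in> simplex (Suc r) \<and> c (up y) \<noteq> (0::nat) \<and> down (up y) = y"
    and "\<And>x. x \<in> simplex (Suc r) \<Longrightarrow> c x \<noteq> 0 \<Longrightarrow> down x \<in> simplex r \<and> up (down x) = x"
    and "\<And>x. c x = 0 \<Longrightarrow> g x = 0"
  shows "(\<Sum>y\<in>simplex r. g (up y)) = sum g (simplex (Suc r))"
proof -
  have "sum g (simplex (Suc r)) = sum g {x \<in> simplex (Suc r). c x \<noteq> 0}"
    using finite_simplex assms(3) by (intro sum.mono_neutral_right) auto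
  also have "\<dots> = (\<Sum>y\<in>simplex r. g (up y))"
    by (rule sum.reindex_bij_witness[of _ up down]) (use assms(1,2) in auto)
  finally show ?thesis ..
qed

lemma sum_simplex_shift:
  fixes H :: "nat \<Rightarrow> nat \<Rightarrow> nat \<Rightarrow> 'a::comm_monoid_add"
  shows "(\<And>j s. H 0 j s = 0) \<Longrightarrow>
      (\<Sum>(i, j, s)\<in>simplex r. H (Suc i) j s) = (\<Sum>(i, j, s)\<in>simplex (Suc r). H i j s)"
    and "(\<And>i s. H i 0 s = 0) \<Longrightarrow>
      (\<Sum>(i, j, s)\<in>simplex r. H i (Suc j) s) = (\<Sum>(i, j, s)\<in>simplex (Suc r). H i j s)"
    and "(\<And>i j. H i j 0 = 0) \<Longrightarrow>
      (\<Sum>(i, j, s)\<in>simplex r. H i j (Suc s)) = (\<Sum>(i, j, s)\<in>simplex (Suc r). H i j s)"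
  using sum_simplex_reindex[of r "\<lambda>(i, j, s). (Suc i, j, s)" fst "\<lambda>(i, j, s). (i - 1, j, s)" "\<lambda>(i, j, s). H i j s"]
    sum_simplex_reindex[of r "\<lambda>(i, j, s). (i, Suc j, s)" "fst \<circ> snd" "\<lambda>(i, j, s). (i, j - 1, s)" "\<lambda>(i, j, s). H i j s"]
    sum_simplex_reindex[of r "\<lambda>(i, j, s). (i, j, Suc s)" "snd \<circ> snd" "\<lambda>(i, j, s). (i, j, s - 1)" "\<lambda>(i, j, s). H i j s"]
  by (auto simp: simplex_def case_prod_beta)

context vertex_operator_algebra
begin

lemma vspace_adjoint [simp]: "vspace (adjoint V) = UNIV"
  by (simp add: adjoint_def)

lemma vop_adjoint [simp]: "vop (adjoint V) = vertop V"
  by (simp add: adjoint_def)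

text \<open>Reduces any condition that is closed under linear combinations to homogeneous
  \<open>v\<close>, for which \<open>opp\<close> is explicit.\<close>

lemma homogeneous_induct:
  assumes "cvec.subspace {v. P v}" "\<And>h v. v \<in> wt_space V (adjoint V) (of_int h) \<Longrightarrow> P v"
  shows "P v"
proof -
  have "cvec.span (\<Union>n. wt_space V (adjoint V) (of_int n)) \<subseteq> {v. P v}"
    by (rule cvec.span_minimal) (use assms in auto)
  then show ?thesis
    using int_graded by auto
qed

lemma linear_eq_homogeneous:
  assumes "linear_on UNIV f" "linear_on UNIV g"
    "\<And>h v. v \<in> wt_space V (adjoint V) (of_int h) \<Longrightarrow> f v = g v"
  shows "f v = g v"
  using homogeneous_induct[of "\<lambda>v. f v - g v = 0" v]
    subspace_linear_zero[OF linear_on_diff_fun[OF assms(1,2)]] assms(3) by auto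

lemma linear_L1: "linear_on UNIV (Lop V (adjoint V) n)"
  using adj.linear_Lop[of n] by simp

lemma linear_L1_pow: "linear_on UNIV (Lop V (adjoint V) 1 ^^ i)"
proof (induction i)
  case (Suc i)
  show ?case
    using linear_on_compose[OF Suc linear_L1] by (simp add: o_def)
qed (simp add: linear_on_def id_def)

lemma linear_div_L1: "linear_on UNIV (div_L1 V i)"
  unfolding div_L1_def by (intro linear_on_scale_fun linear_L1_pow)

lemma div_L1_0 [simp]: "div_L1 V 0 v = v"
  by (simp add: div_L1_def scaleC_one)

lemma L1_div_L1: "Lop V (adjoint V) 1 (div_L1 V i v) = of_nat (Suc i) *\<^sub>C div_L1 V (Suc i) v"
  unfolding div_L1_def linear_onD(2)[OF linear_L1 UNIV_I]
  by (simp add: scaleC_scaleC field_simps del: of_nat_Suc)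

lemma div_L1_div_L1: "div_L1 V j (div_L1 V i v) = of_nat ((i + j) choose i) *\<^sub>C div_L1 V (i + j) v"
proof -
  have "(Lop V (adjoint V) 1 ^^ j) ((Lop V (adjoint V) 1 ^^ i) v) = (Lop V (adjoint V) 1 ^^ (i + j)) v"
    by (simp add: funpow_add add.commute[of i j])
  moreover have "(1 / fact j * (1 / fact i) :: complex) = of_nat ((i + j) choose i) * (1 / fact (i + j))"
    using binomial_fact[of i "i + j", where ?'a = complex] by simp
  ultimately show ?thesis
    unfolding div_L1_def linear_onD(2)[OF linear_L1_pow UNIV_I] scaleC_scaleC by metis
qed

lemma L1_wt:
  assumes "v \<in> wt_space V (adjoint V) h"
  shows "Lop V (adjoint V) 1 v \<in> wt_space V (adjoint V) (h - 1)"
  using adj.vop_wt[OF assms conformal_wt, of 2] by (simp add: Lop_def)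

lemma div_L1_wt:
  assumes "v \<in> wt_space V (adjoint V) (of_int h)"
  shows "div_L1 V i v \<in> wt_space V (adjoint V) (of_int (h - int i))"
proof -
  have "(Lop V (adjoint V) 1 ^^ i) v \<in> wt_space V (adjoint V) (of_int h - of_nat i)"
  proof (induction i)
    case (Suc i)
    from L1_wt[OF Suc] show ?case by (simp add: algebra_simps)
  qed (use assms in simp)
  then show ?thesis
    unfolding div_L1_def by (auto intro: cvec.subspace_scale[OF adj.wt_subspace])
qed

text \<open>Each \<open>L(1)\<close> lowers the weight by one, and the weights of \<open>V\<close>
  are bounded below.\<close>

lemma div_L1_vanish:
  assumes "v \<in> wt_space V (adjoint V) (of_int h)"
  shows "\<exists>N. \<forall>i\<ge>N. div_L1 V i v = 0"
proof -
  obtain N where N: "\<And>n. n < N \<Longrightarrow> wt_space V (adjoint V) (of_int n) = {0}"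
    using bounded_below by blast
  have "div_L1 V i v = 0" if "i \<ge> nat (h - N + 1)" for i
    using div_L1_wt[OF assms, of i] N[of "h - int i"] that by auto
  then show ?thesis by blast
qed

text \<open>The coefficient form of e^(yL(1)) Y(u,x) e^(-yL(1)) = Y(e^(y(1-yx)L(1)) (1-yx)^(-2L(0))
  u, x/(1-yx)). Here \<open>i\<close> and \<open>j\<close> count the factors \<open>L(1)\<close>
  absorbed by \<open>u\<close> and \<open>v\<close>, and \<open>s\<close> those spent on raising the
  mode. The proof is an induction on \<open>r\<close> that applies the commutator of
  \<open>L(1)\<close> with a mode.\<close>

lemma div_L1_mode:
  assumes u: "u \<in> wt_space V (adjoint V) (of_int h)"
  shows "div_L1 V r (vertop V u n v) = (\<Sum>(i, j, s)\<in>simplex r.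
    (of_int (2 * h - n - 2 - int i) gchoose s) *\<^sub>C
      vertop V (div_L1 V i u) (n + int s) (div_L1 V j v))"
proof (induction r)
  case 0
  have "simplex 0 = {(0, 0, 0)}"
    by (auto simp: simplex_def)
  then show ?case by (simp add: scaleC_one)
next
  case (Suc r)
  define N where "N = 2 * h - n - 2"
  define b where "b i s = (of_int (N - int i) gchoose s :: complex)" for i s
  define G where "G i j s = vertop V (div_L1 V i u) (n + int s) (div_L1 V j v)" for i j s
  \<comment> \<open>The contributions to the \<open>(i, j, s)\<close> term in degree
    \<open>Suc r\<close> that arise by raising \<open>i\<close>, \<open>j\<close> or
    \<open>s\<close> from degree \<open>r\<close>. The binomial coefficient still carries the old
    indices, hence \<open>N - int i + 1\<close> in \<open>H1\<close> and \<open>s - 1\<close> in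
    \<open>H3\<close>. Each one vanishes when its own index is 0, as the shift lemmas
    require.\<close>
  define H1 where "H1 i j s = (of_nat i * (of_int (N - int i + 1) gchoose s)) *\<^sub>C G i j s" for i j s
  define H2 where "H2 i j s = of_nat j *\<^sub>C b i s *\<^sub>C G i j s" for i j s
  define H3 where "H3 i j s = (if s = 0 then 0
    else (of_int (N - 2 * int i - int s + 1) * b i (s - 1)) *\<^sub>C G i j s)" for i j s
  have L1G: "Lop V (adjoint V) 1 (G i j s) = of_nat (Suc i) *\<^sub>C G (Suc i) j s
      + of_int (N - 2 * int i - int s) *\<^sub>C G i j (Suc s) + of_nat (Suc j) *\<^sub>C G i (Suc j) s" for i j s
  proof -
    have e: "n + int (Suc s) = n + int s + 1" by simp
    have c: "of_int (N - 2 * int i - int s) = 2 * of_int (h - int i) - of_int (n + int s) - (2::complex)"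
      by (simp add: N_def)
    show ?thesis
      using adj.L1_commutator[OF _ div_L1_wt[OF u, of i], where n = "n + int s" and w = "div_L1 V j v"]
      unfolding G_def c e vop_adjoint L1_div_L1
      by (simp add: adj.vop_scale_left[simplified] linear_onD(2)[OF adj.vop_linear, simplified]
          ac_simps del: of_nat_Suc of_int_diff of_int_add)
  qed
  have IH: "div_L1 V r (vertop V u n v) = (\<Sum>(i, j, s)\<in>simplex r. b i s *\<^sub>C G i j s)"
    unfolding b_def G_def N_def by (simp add: Suc)
  \<comment> \<open>Pascal's rule \<open>A\<close> and the recursion \<open>B\<close> from
    \<open>s'\<close> to \<open>s\<close> collapse the three coefficients to
    \<open>i + j + s\<close>. On the simplex this is \<open>Suc r\<close>, which cancels against the
    factor from \<open>L1_div_L1\<close>.\<close>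
  have coeff: "H1 i j s + H2 i j s + H3 i j s = of_nat (i + j + s) *\<^sub>C b i s *\<^sub>C G i j s" for i j s
  proof (cases s)
    case 0
    then show ?thesis
      by (simp add: H1_def H2_def H3_def b_def cvec.scale_left_distrib)
  next
    case s: (Suc s')
    define a :: complex where "a = of_int (N - int i)"
    have A: "(of_int (N - int i + 1) gchoose s :: complex) = b i s' + b i s"
      using gbinomial_Suc_Suc[of a s'] by (simp add: s b_def a_def add.commute)
    have B: "of_nat s * b i s = (a - of_nat s') * b i s'"
      using gbinomial_mult_1[of a s'] by (simp add: s b_def a_def algebra_simps)
    have "of_nat i * (b i s' + b i s) + of_nat j * b i s + of_int (N - 2 * int i - int s + 1) * b i s'
        = of_nat i * b i s + of_nat j * b i s + (a - of_nat s') * b i s'"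
      by (simp add: a_def s algebra_simps)
    also have "\<dots> = of_nat (i + j + s) * b i s"
      unfolding B[symmetric] by (simp add: algebra_simps)
    finally show ?thesis
      unfolding H1_def H2_def H3_def A using s
      by (simp add: scaleC_scaleC del: of_nat_add of_int_add of_int_diff of_nat_Suc flip: cvec.scale_left_distrib)
  qed
  have "of_nat (Suc r) *\<^sub>C div_L1 V (Suc r) (vertop V u n v)
      = Lop V (adjoint V) 1 (\<Sum>(i, j, s)\<in>simplex r. b i s *\<^sub>C G i j s)"
    unfolding IH[symmetric] L1_div_L1 ..
  also have "\<dots> = (\<Sum>(i, j, s)\<in>simplex r. b i s *\<^sub>C Lop V (adjoint V) 1 (G i j s))"
    by (subst linear_on_sum[OF linear_L1 cvec.subspace_UNIV])
      (auto simp: case_prod_beta linear_onD(2)[OF linear_L1 UNIV_I])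
  also have "\<dots> = (\<Sum>(i, j, s)\<in>simplex r. H1 (Suc i) j s + H2 i (Suc j) s + H3 i j (Suc s))"
  proof (rule sum.cong[OF refl], clarify)
    fix i j s
    have "H1 (Suc i) j s = (of_nat (Suc i) * b i s) *\<^sub>C G (Suc i) j s"
      by (simp add: H1_def b_def algebra_simps)
    moreover have "H3 i j (Suc s) = (of_int (N - 2 * int i - int s) * b i s) *\<^sub>C G i j (Suc s)"
      by (simp add: H3_def)
    ultimately show "b i s *\<^sub>C Lop V (adjoint V) 1 (G i j s)
        = H1 (Suc i) j s + H2 i (Suc j) s + H3 i j (Suc s)"
      unfolding L1G H2_def by (simp add: scaleC_add_right scaleC_scaleC algebra_simps del: of_nat_Suc of_int_diff)
  qed
  also have "\<dots> = (\<Sum>(i, j, s)\<in>simplex r. H1 (Suc i) j s) + (\<Sum>(i, j, s)\<in>simplex r. H2 i (Suc j) s)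
      + (\<Sum>(i, j, s)\<in>simplex r. H3 i j (Suc s))"
    by (simp add: case_prod_beta sum.distrib)
  also have "\<dots> = (\<Sum>(i, j, s)\<in>simplex (Suc r). H1 i j s) + (\<Sum>(i, j, s)\<in>simplex (Suc r). H2 i j s)
      + (\<Sum>(i, j, s)\<in>simplex (Suc r). H3 i j s)"
    by (subst (1) sum_simplex_shift(1), simp add: H1_def, subst (1) sum_simplex_shift(2), simp add: H2_def,
        subst (1) sum_simplex_shift(3), simp_all add: H3_def)
  also have "\<dots> = (\<Sum>(i, j, s)\<in>simplex (Suc r). H1 i j s + H2 i j s + H3 i j s)"
    by (simp add: case_prod_beta sum.distrib)
  also have "\<dots> = (\<Sum>(i, j, s)\<in>simplex (Suc r). of_nat (Suc r) *\<^sub>C b i s *\<^sub>C G i j s)"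
    by (rule sum.cong) (auto simp: coeff simplex_def simp del: of_nat_Suc of_nat_add)
  also have "\<dots> = of_nat (Suc r) *\<^sub>C (\<Sum>(i, j, s)\<in>simplex (Suc r). b i s *\<^sub>C G i j s)"
    by (simp add: cvec.scale_sum_right case_prod_beta del: of_nat_Suc)
  finally show ?case
    unfolding b_def G_def N_def by (simp del: of_nat_Suc)
qed

end

section \<open>Opposite vertex operators\<close>

lemma neg_one_powi: "(-1 :: complex) powi a = (if even a then 1 else -1)"
  by (auto simp: power_int_minus_left)

lemma triangle_sum:
  fixes T :: nat
  shows "(\<Sum>t<T. \<Sum>s<T - t. f t s) = (\<Sum>r<T. \<Sum>t\<le>r. f t (r - t))"
proof -
  have "(\<Sum>t<T. \<Sum>s<T - t. f t s) = (\<Sum>(t, s)\<in>Sigma {..<T} (\<lambda>t. {..<T - t}). f t s)"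
    by (rule sum.Sigma) auto
  also have "Sigma {..<T} (\<lambda>t. {..<T - t}) = {(t, s). t + s < T}"
    by auto
  finally show ?thesis
    by (simp add: sum.triangle_reindex)
qed

lemma eventually_uniform:
  assumes "finite A" "\<And>x. x \<in> A \<Longrightarrow> \<exists>T::nat. \<forall>t\<ge>T. P x t"
  shows "\<exists>T. \<forall>t\<ge>T. \<forall>x\<in>A. P x t"
  using eventually_ball_finite[OF assms(1), of "\<lambda>t x. P x t" sequentially] assms(2)
  by (simp add: eventually_sequentially)

text \<open>Upper negation absorbs the sign and makes the upper argument of the second factor, r - Q
  - 1, independent of \<open>t\<close>. What remains is the ordinary Vandermonde convolution, and
  negating once more gives the right-hand side.\<close>

lemma gbinomial_alternating_Vandermonde:
  fixes Q m :: complex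
  shows "(\<Sum>t\<le>r. (m gchoose t) * (-1) ^ t * ((Q - of_nat t) gchoose (r - t))) = (Q - m) gchoose r"
proof -
  have summand: "(m gchoose t) * (-1) ^ t * ((Q - of_nat t) gchoose (r - t))
      = (-1) ^ r * ((m gchoose t) * ((of_nat r - Q - 1) gchoose (r - t)))" if "t \<le> r" for t
  proof -
    have "(-1 :: complex) ^ t * (-1) ^ (r - t) = (-1) ^ r"
      using that by (simp flip: power_add)
    moreover have "(Q - of_nat t) gchoose (r - t) = (-1) ^ (r - t) * ((of_nat r - Q - 1) gchoose (r - t))"
      by (subst gbinomial_negated_upper) (use that in \<open>simp add: of_nat_diff\<close>)
    ultimately show ?thesis by simp
  qed
  have "(\<Sum>t\<le>r. (m gchoose t) * (-1) ^ t * ((Q - of_nat t) gchoose (r - t)))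
      = (-1) ^ r * (\<Sum>t\<le>r. (m gchoose t) * ((of_nat r - Q - 1) gchoose (r - t)))"
    unfolding sum_distrib_left by (rule sum.cong[OF refl]) (simp only: summand atMost_iff)
  also have "(\<Sum>t\<le>r. (m gchoose t) * ((of_nat r - Q - 1) gchoose (r - t))) = (m + (of_nat r - Q - 1)) gchoose r"
    using gbinomial_Vandermonde[of m "of_nat r - Q - 1" r] by (simp add: atLeast0AtMost)
  also have "(-1) ^ r * ((m + (of_nat r - Q - 1)) gchoose r) = (Q - m) gchoose r"
  proof -
    have "of_nat r - (Q - m) - 1 = m + (of_nat r - Q - 1)" by simp
    then show ?thesis
      using gbinomial_negated_upper[of "Q - m" r] by (simp only:)
  qed
  finally show ?thesis .
qed

lemma sum_over_simplices:
  fixes E :: "nat \<times> nat \<times> nat \<Rightarrow> 'a::comm_monoid_add"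
  assumes "finite A" "\<And>x. x \<notin> A \<Longrightarrow> E x = 0"
  shows "Sum_any (\<lambda>r. sum E (simplex r)) = sum E A"
proof -
  define deg where "deg = (\<lambda>(i, j, s). i + j + s :: nat)"
  have supp: "x \<in> A" if "E x \<noteq> 0" for x
    using assms(2) that by blast
  have simplex: "sum E (simplex r) = sum E {x \<in> A. deg x = r}" for r
    by (rule sum.mono_neutral_right[OF finite_simplex]) (auto simp: simplex_def deg_def dest: supp)
  have "Sum_any (\<lambda>r. sum E (simplex r)) = (\<Sum>r\<in>deg ` A. sum E (simplex r))"
  proof (rule Sum_any.expand_superset)
    have "sum E (simplex r) = 0" if "r \<notin> deg ` A" for r
      unfolding simplex using that by (intro sum.neutral) auto
    then show "{r. sum E (simplex r) \<noteq> 0} \<subseteq> deg ` A" by blast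
  qed (use assms(1) in simp)
  also have "\<dots> = sum E A"
    unfolding simplex by (rule sum.group) (use assms(1) in auto)
  finally show ?thesis .
qed

text \<open>The transpose of the mode \<open>v\<^sub>n\<close> of the contragredient module.\<close>

definition adj_op ::
  "'v::complex_vector voa \<Rightarrow> ('v, 'a::complex_vector) vmod \<Rightarrow> 'v \<Rightarrow> int \<Rightarrow> 'a \<Rightarrow> 'a" where
  "adj_op V M v n = Ystar V M v (- n - 1)"

lemma adj_op_eq: "adj_op V M v n w = Sum_any (\<lambda>k. vop M (opp V v k) (- k - n - 2) w)"
  by (simp add: adj_op_def Ystar_def Ycoeff_def algebra_simps)

section \<open>The Laurent polynomial e^(xL(1)) (-x^(-2))^(L(0)) v and its involution
  property\<close>

context vertex_operator_algebra
begin

lemma linear_opp: "linear_on UNIV (\<lambda>v. opp V v k)"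
  unfolding opp_def
proof (rule linear_on_Sum_any_fun)
  fix n :: int
  have "linear_on UNIV (\<lambda>v. (Lop V (adjoint V) 1 ^^ j) (wt_comp V (adjoint V) v (of_int n)))" for j
    using linear_on_compose[OF _ linear_L1_pow] adj.wt_comp_linear[of "of_int n"] by simp
  then show "linear_on UNIV (\<lambda>v. if k + 2 * n < 0 then 0 else ((-1) powi n / fact (nat (k + 2 * n))) *\<^sub>C
       (Lop V (adjoint V) 1 ^^ nat (k + 2 * n)) (wt_comp V (adjoint V) v (of_int n)))"
    by (cases "k + 2 * n < 0") (auto intro: linear_on_zero_fun linear_on_scale_fun)
next
  fix v :: 'v
  have "finite ((of_int :: int \<Rightarrow> complex) -` {n. wt_comp V (adjoint V) v n \<noteq> 0})"
    using adj.wt_comp(2)[of v] by (intro finite_vimageI) (auto simp: inj_def)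
  then show "finite {n. (if k + 2 * n < 0 then 0 else ((-1) powi n / fact (nat (k + 2 * n))) *\<^sub>C
       (Lop V (adjoint V) 1 ^^ nat (k + 2 * n)) (wt_comp V (adjoint V) v (of_int n))) \<noteq> 0}"
    by (rule rev_finite_subset) (auto simp: linear_on_zero[OF linear_L1_pow cvec.subspace_UNIV])
qed

lemma opp_zero [simp]: "opp V 0 k = 0"
  by (rule linear_on_zero[OF linear_opp cvec.subspace_UNIV])

lemma opp_homogeneous:
  assumes "v \<in> wt_space V (adjoint V) (of_int h)"
  shows "opp V v k = (if k + 2 * h < 0 then 0 else (-1) powi h *\<^sub>C div_L1 V (nat (k + 2 * h)) v)"
  unfolding opp_def
  by (subst Sum_any_singleton[of h])
    (auto simp: adj.wt_comp_wt[OF assms] linear_on_zero[OF linear_L1_pow cvec.subspace_UNIV]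
      div_L1_def scaleC_scaleC)

text \<open>On homogeneous \<open>v\<close> only the nonzero divided powers of \<open>L(1)\<close>
  contribute, and these are finite in number. Most of the finite supports below come from
  here.\<close>

lemma finite_opp: "finite {k. opp V v k \<noteq> 0}"
proof (rule homogeneous_induct[where P = "\<lambda>v. finite {k. opp V v k \<noteq> 0}"])
  show "cvec.subspace {v. finite {k. opp V v k \<noteq> 0}}"
  proof -
    have "finite {k. c *\<^sub>C opp V v k \<noteq> 0}" if "finite {k. opp V v k \<noteq> 0}" for c v
      by (rule finite_subset[OF _ that]) auto
    then show ?thesis
      by (auto simp: cvec.subspace_def linear_onD[OF linear_opp] intro: finite_support_add)
  qed
  fix h v assume v: "v \<in> wt_space V (adjoint V) (of_int h)"
  obtain N where N: "\<And>i. i \<ge> N \<Longrightarrow> div_L1 V i v = 0"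
    using div_L1_vanish[OF v] by blast
  have "{k. opp V v k \<noteq> 0} \<subseteq> (\<lambda>i. int i - 2 * h) ` {..<N}"
  proof
    fix k assume "k \<in> {k. opp V v k \<noteq> 0}"
    then have "k + 2 * h \<ge> 0" "div_L1 V (nat (k + 2 * h)) v \<noteq> 0"
      by (auto simp: opp_homogeneous[OF v] split: if_splits)
    moreover from this(2) have "nat (k + 2 * h) < N"
      using N not_le by blast
    ultimately show "k \<in> (\<lambda>i. int i - 2 * h) ` {..<N}"
      by (intro image_eqI[of _ _ "nat (k + 2 * h)"]) auto
  qed
  then show "finite {k. opp V v k \<noteq> 0}"
    by (rule finite_subset) auto
qed

lemma Sum_any_opp:
  assumes "v \<in> wt_space V (adjoint V) (of_int h)" "\<And>k. f k 0 = 0"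
  shows "Sum_any (\<lambda>k. f k (opp V v k)) = Sum_any (\<lambda>i::nat. f (int i - 2 * h) ((-1) powi h *\<^sub>C div_L1 V i v))"
proof -
  have "{k. f k (opp V v k) \<noteq> 0} \<subseteq> range (\<lambda>i. int i - 2 * h)"
  proof
    fix k assume "k \<in> {k. f k (opp V v k) \<noteq> 0}"
    then have "k + 2 * h \<ge> 0"
      by (auto simp: opp_homogeneous[OF assms(1)] assms(2) split: if_splits)
    then show "k \<in> range (\<lambda>i. int i - 2 * h)"
      by (intro image_eqI[of _ _ "nat (k + 2 * h)"]) auto
  qed
  then have "Sum_any (\<lambda>k. f k (opp V v k)) = Sum_any (\<lambda>i::nat. f (int i - 2 * h) (opp V v (int i - 2 * h)))"
    by (intro Sum_any_reindex) (auto simp: inj_def)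
  then show ?thesis
    by (simp add: opp_homogeneous[OF assms(1)])
qed

text \<open>The coefficient form of \<open>e\<^sup>y\<^sup>L\<^sup>(\<^sup>1\<^sup>) (-y\<^sup>-\<^sup>2)\<^sup>L\<^sup>(\<^sup>0\<^sup>) e\<^sup>x\<^sup>L\<^sup>(\<^sup>1\<^sup>) (-x\<^sup>-\<^sup>2)\<^sup>L\<^sup>(\<^sup>0\<^sup>) v = v\<close> for \<open>y = x\<^sup>-\<^sup>1\<close>.\<close>

lemma opp_opp:
  assumes "\<And>d. linear_on UNIV (\<lambda>v. H v d)"
  shows "Sum_any (\<lambda>k. Sum_any (\<lambda>k'. H (opp V (opp V v k) k') (k' - k))) = H v 0"
proof (rule linear_eq_homogeneous[where f = "\<lambda>v. Sum_any (\<lambda>k. Sum_any (\<lambda>k'. H (opp V (opp V v k) k') (k' - k)))"])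
  have H0: "H 0 d = 0" for d
    by (rule linear_on_zero[OF assms cvec.subspace_UNIV])
  have fin: "finite {k'. H (opp V v k') (k' - k) \<noteq> 0}" for v k
    by (rule finite_subset[OF _ finite_opp[of v]]) (auto simp: H0)
  have "linear_on UNIV (\<lambda>v. Sum_any (\<lambda>k'. H (opp V v k') (k' - k)))" for k
    by (rule linear_on_Sum_any_fun[OF linear_on_compose[OF linear_opp assms] fin]) auto
  from linear_on_compose[OF linear_opp this]
  show "linear_on UNIV (\<lambda>v. Sum_any (\<lambda>k. Sum_any (\<lambda>k'. H (opp V (opp V v k) k') (k' - k))))"
  proof (rule linear_on_Sum_any_fun)
    fix v
    show "finite {k. Sum_any (\<lambda>k'. H (opp V (opp V v k) k') (k' - k)) \<noteq> 0}"
      by (rule finite_subset[OF _ finite_opp[of v]]) (auto simp: H0)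
  qed auto
  show "linear_on UNIV (\<lambda>v. H v 0)" by (rule assms)
  fix h v assume v: "v \<in> wt_space V (adjoint V) (of_int h)"
  obtain N0 where N0: "\<And>i. i \<ge> N0 \<Longrightarrow> div_L1 V i v = 0"
    using div_L1_vanish[OF v] by blast
  \<comment> \<open>\<open>Suc\<close> keeps the range nonempty, so that it contains the
    antidiagonal \<open>r = 0\<close>.\<close>
  define N where "N = Suc N0"
  \<comment> \<open>Composing two divided powers produces the binomial coefficient. The second
    application sees weight h - i, so the signs (-1)^(h-i) and (-1)^h leave (-1)^i.\<close>
  define g where "g i j = ((-1) ^ i * of_nat ((i + j) choose i)) *\<^sub>C H (div_L1 V (i + j) v) (int (i + j))" for i j
  have g0: "g i j = 0" if "i + j \<ge> N" for i j
    using that by (simp add: g_def N0 N_def H0)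
  have inner: "Sum_any (\<lambda>k'. H (opp V ((-1) powi h *\<^sub>C div_L1 V i v) k') (k' - (int i - 2 * h))) = Sum_any (g i)" for i
  proof -
    have wt: "(-1) powi h *\<^sub>C div_L1 V i v \<in> wt_space V (adjoint V) (of_int (h - int i))"
      using div_L1_wt[OF v] by (rule cvec.subspace_scale[OF adj.wt_subspace])
    have "H ((-1) powi (h - int i) *\<^sub>C div_L1 V j ((-1) powi h *\<^sub>C div_L1 V i v))
        (int j - 2 * (h - int i) - (int i - 2 * h)) = g i j" for j
    proof -
      have e: "int j - 2 * (h - int i) - (int i - 2 * h) = int (i + j)" by simp
      have "(-1) powi (h - int i) * (-1) powi h = ((-1) ^ i :: complex)"
        by (auto simp: neg_one_powi minus_one_power_iff)
      then have "((-1) powi (h - int i) * (-1) powi h) *\<^sub>C div_L1 V j (div_L1 V i v)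
          = ((-1) ^ i * of_nat ((i + j) choose i)) *\<^sub>C div_L1 V (i + j) v"
        by (simp only: div_L1_div_L1 scaleC_scaleC)
      then show ?thesis
        unfolding linear_onD(2)[OF linear_div_L1 UNIV_I] scaleC_scaleC e g_def
        by (simp only: linear_onD(2)[OF assms UNIV_I])
    qed
    then show ?thesis
      using Sum_any_opp[OF wt, of "\<lambda>k' u. H u (k' - (int i - 2 * h))"] by (simp add: H0)
  qed
  have "Sum_any (\<lambda>k. Sum_any (\<lambda>k'. H (opp V (opp V v k) k') (k' - k))) = Sum_any (\<lambda>i. Sum_any (g i))"
    using Sum_any_opp[OF v, of "\<lambda>k u. Sum_any (\<lambda>k'. H (opp V u k') (k' - k))"] by (simp add: H0 inner)
  also have "\<dots> = (\<Sum>i<N. \<Sum>j<N - i. g i j)"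
  proof (subst Sum_any_lessThan[of N])
    show "Sum_any (g i) = 0" if "i \<ge> N" for i
      using g0 that by simp
    show "(\<Sum>i<N. Sum_any (g i)) = (\<Sum>i<N. \<Sum>j<N - i. g i j)"
      by (intro sum.cong refl Sum_any_lessThan g0) auto
  qed
  also have "\<dots> = (\<Sum>r<N. \<Sum>i\<le>r. g i (r - i))"
    by (rule triangle_sum)
  \<comment> \<open>The antidiagonal \<open>r\<close> is (1 - 1)^r times a fixed vector.\<close>
  also have "\<dots> = (\<Sum>r<N. if r = 0 then H v 0 else 0)"
  proof (rule sum.cong[OF refl])
    fix r
    have "(\<Sum>i\<le>r. g i (r - i)) = (\<Sum>i\<le>r. (-1) ^ i * of_nat (r choose i)) *\<^sub>C H (div_L1 V r v) (int r)"
      unfolding cvec.scale_sum_left by (rule sum.cong) (auto simp: g_def)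
    then show "(\<Sum>i\<le>r. g i (r - i)) = (if r = 0 then H v 0 else 0)"
      using choose_alternating_sum[of r, where ?'a = complex] by (auto simp: scaleC_one)
  qed
  also have "\<dots> = H v 0"
    by (simp add: N_def)
  finally show "Sum_any (\<lambda>k. Sum_any (\<lambda>k'. H (opp V (opp V v k) k') (k' - k))) = H v 0" .
qed

end

context generalized_module
begin

lemma vop_truncation_nat:
  assumes "w \<in> vspace M"
  shows "\<exists>T::nat. \<forall>t\<ge>T. vop M v (n + int t) w = 0"
proof -
  obtain N where "\<And>n. n \<ge> N \<Longrightarrow> vop M v n w = 0"
    using lower_truncation[OF assms] by blast
  then show ?thesis
    by (intro exI[of _ "nat (N - n)"]) auto
qed

end

section \<open>Transposed modes on a module\<close>

locale voa_gmodule = voa: vertex_operator_algebra V + generalized_module V M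
  for V :: "'v::complex_vector voa" and M :: "('v, 'a::complex_vector) vmod"
begin

lemma finite_adj_op_support:
  assumes "w \<in> vspace M"
  shows "finite {k. vop M (opp V v k) (q k) w \<noteq> 0}"
  by (rule finite_subset[OF _ voa.finite_opp[of v]]) (use assms in auto)

lemma adj_op_closed: "w \<in> vspace M \<Longrightarrow> adj_op V M v n w \<in> vspace M"
  unfolding adj_op_eq by (intro subspace_Sum_any[OF subspace] vop_closed)

lemma linear_adj_op: "linear_on (vspace M) (adj_op V M v n)"
  unfolding adj_op_eq[abs_def]
  by (rule linear_on_Sum_any_fun[OF vop_linear]) (rule finite_adj_op_support)

lemma linear_adj_op_left:
  assumes "w \<in> vspace M"
  shows "linear_on UNIV (\<lambda>v. adj_op V M v n w)"
  unfolding adj_op_eq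
  by (rule linear_on_Sum_any_fun)
    (use assms in \<open>auto intro: linear_on_compose[OF voa.linear_opp vop_linear_left] finite_adj_op_support\<close>)

lemma adj_op_zero [simp]: "adj_op V M v n 0 = 0"
  by (rule linear_on_zero[OF linear_adj_op subspace])

lemma adj_op_zero_left [simp]: "w \<in> vspace M \<Longrightarrow> adj_op V M 0 n w = 0"
  by (rule linear_on_zero[OF linear_adj_op_left cvec.subspace_UNIV])

lemma adj_op_homogeneous:
  assumes "v \<in> wt_space V (adjoint V) (of_int h)" "w \<in> vspace M"
  shows "adj_op V M v n w
    = Sum_any (\<lambda>i. (-1) powi h *\<^sub>C vop M (div_L1 V i v) (2 * h - n - 2 - int i) w)"
proof -
  have "adj_op V M v n w = Sum_any (\<lambda>i. vop M ((-1) powi h *\<^sub>C div_L1 V i v) (- (int i - 2 * h) - n - 2) w)"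
    unfolding adj_op_eq
    by (rule voa.Sum_any_opp[OF assms(1), where f = "\<lambda>k u. vop M u (- k - n - 2) w"]) (use assms(2) in simp)
  then show ?thesis
    by (simp add: vop_scale_left[OF assms(2)] algebra_simps)
qed

lemma adj_op_lessThan:
  assumes "v \<in> wt_space V (adjoint V) (of_int h)" "w \<in> vspace M" "\<And>i. i \<ge> N \<Longrightarrow> div_L1 V i v = 0"
  shows "adj_op V M v n w
    = (\<Sum>i<N. (-1) powi h *\<^sub>C vop M (div_L1 V i v) (2 * h - n - 2 - int i) w)"
  unfolding adj_op_homogeneous[OF assms(1,2)] by (rule Sum_any_lessThan) (use assms in simp)

text \<open>Passing from \<open>v\<close> to \<open>L(1)^i v\<close> lowers both the weight and the
  mode index by \<open>i\<close>, so all terms of the transposed mode shift weights by the same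
  amount, opposite to that of the mode itself.\<close>

lemma adj_op_wt:
  assumes "v \<in> wt_space V (adjoint V) (of_int h)" "w \<in> wt_space V M \<mu>"
  shows "adj_op V M v n w \<in> wt_space V M (\<mu> - of_int h + of_int n + 1)"
  unfolding adj_op_homogeneous[OF assms(1) wt_in_vspace[OF assms(2)]]
proof (intro subspace_Sum_any[OF wt_subspace] cvec.subspace_scale[OF wt_subspace])
  fix i
  show "vop M (div_L1 V i v) (2 * h - n - 2 - int i) w \<in> wt_space V M (\<mu> - of_int h + of_int n + 1)"
    using vop_wt[OF assms(2) voa.div_L1_wt[OF assms(1), of i], of "2 * h - n - 2 - int i"]
    by (simp add: algebra_simps)
qed

text \<open>Transposition reverses the direction of truncation. Only finitely many
  \<open>opp V v k\<close> are nonzero, so one bound serves for all of them.\<close>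

lemma adj_op_truncation:
  assumes "w \<in> vspace M"
  shows "\<exists>N. \<forall>n\<le>N. adj_op V M v n w = 0"
proof -
  have "\<exists>T. \<forall>t\<ge>T. \<forall>k\<in>{k. opp V v k \<noteq> 0}. vop M (opp V v k) (- k - (- int t) - 2) w = 0"
  proof (rule eventually_uniform[OF voa.finite_opp])
    fix k
    obtain N where N: "\<And>n. n \<ge> N \<Longrightarrow> vop M (opp V v k) n w = 0"
      using lower_truncation[OF assms] by blast
    show "\<exists>T. \<forall>t\<ge>T. vop M (opp V v k) (- k - (- int t) - 2) w = 0"
      by (rule exI[of _ "nat (N + k + 2)"]) (auto intro!: N)
  qed
  then obtain T where T: "\<And>t k. t \<ge> T \<Longrightarrow> opp V v k \<noteq> 0 \<Longrightarrow> vop M (opp V v k) (- k - (- int t) - 2) w = 0"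
    by blast
  have "vop M (opp V v k) (- k - n - 2) w = 0" if "n \<le> - int T" for n k
    using T[of "nat (- n)" k] that assms by (cases "opp V v k = 0") auto
  then show ?thesis
    unfolding adj_op_eq by (intro exI[of _ "- int T"]) simp
qed

lemma adj_op_truncation_nat:
  assumes "w \<in> vspace M"
  shows "\<exists>T::nat. \<forall>t\<ge>T. adj_op V M v (n - int t) w = 0"
proof -
  obtain N where "\<And>n. n \<le> N \<Longrightarrow> adj_op V M v n w = 0"
    using adj_op_truncation[OF assms] by blast
  then show ?thesis
    by (intro exI[of _ "nat (n - N)"]) auto
qed

text \<open>The relation Y** = Y, obtained by inserting modes into \<open>opp_opp\<close>.\<close>

lemma adj_op_involution:
  assumes "w \<in> vspace M"
  shows "Sum_any (\<lambda>k. adj_op V M (opp V v k) (- k - n - 2) w) = vop M v n w"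
proof -
  have "adj_op V M (opp V v k) (- k - n - 2) w = Sum_any (\<lambda>k'. vop M (opp V (opp V v k) k') (n - (k' - k)) w)" for k
    unfolding adj_op_eq by (simp add: algebra_simps)
  then show ?thesis
    using voa.opp_opp[of "\<lambda>v d. vop M v (n - d) w" v] vop_linear_left[OF assms] by simp
qed

text \<open>\<open>div_L1_mode\<close> summed over all \<open>r\<close>, with the simplices
  reassembled into a box. The cutoffs \<open>N\<close> and \<open>S\<close> are hypotheses so that
  the caller can impose the same box on all terms of the Borcherds identity.\<close>

lemma adj_op_mode:
  assumes u: "u \<in> wt_space V (adjoint V) (of_int h)" and v: "v \<in> wt_space V (adjoint V) (of_int k)"
    and w: "w \<in> vspace M"
    and N: "\<And>i. i \<ge> N \<Longrightarrow> div_L1 V i u = 0" "\<And>j. j \<ge> N \<Longrightarrow> div_L1 V j v = 0"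
    and S: "\<And>i j s. i < N \<Longrightarrow> j < N \<Longrightarrow> s \<ge> S \<Longrightarrow> vertop V (div_L1 V i u) (q + int s) (div_L1 V j v) = 0"
  shows "adj_op V M (vertop V u q v) y w = (\<Sum>i<N. \<Sum>j<N. \<Sum>s<S.
    ((-1) powi (h + k - q - 1) * (of_int (2 * h - q - 2 - int i) gchoose s)) *\<^sub>C
      vop M (vertop V (div_L1 V i u) (q + int s) (div_L1 V j v))
        (2 * (h + k - q - 1) - y - 2 - int (i + j + s)) w)"
proof -
  define p where "p = h + k - q - 1"
  define E where "E = (\<lambda>(i, j, s). ((-1) powi p * (of_int (2 * h - q - 2 - int i) gchoose s)) *\<^sub>C
      vop M (vertop V (div_L1 V i u) (q + int s) (div_L1 V j v)) (2 * p - y - 2 - int (i + j + s)) w)"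
  let ?A = "{..<N} \<times> {..<N} \<times> {..<S}"
  have p: "vertop V u q v \<in> wt_space V (adjoint V) (of_int p)"
    using voa.adj.vop_wt[OF v u, of q] by (simp add: p_def algebra_simps)
  have E0: "E x = 0" if "x \<notin> ?A" for x
  proof -
    obtain i j s where x: "x = (i, j, s)" by (cases x)
    have "vertop V (div_L1 V i u) (q + int s) (div_L1 V j v) = 0"
      using that N S[of i j s] voa.adj.vop_zero[of _ "q + int s"] voa.adj.vop_zero_left[of _ "q + int s"]
      by (cases "i < N"; cases "j < N") (auto simp: x)
    then show ?thesis
      using w by (simp add: E_def x)
  qed
  have "(-1) powi p *\<^sub>C vop M (div_L1 V r (vertop V u q v)) (2 * p - y - 2 - int r) w = sum E (simplex r)" for r
  proof -
    have "vop M (div_L1 V r (vertop V u q v)) (2 * p - y - 2 - int r) w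
        = (\<Sum>x\<in>simplex r. vop M ((\<lambda>(i, j, s). (of_int (2 * h - q - 2 - int i) gchoose s) *\<^sub>C
      vertop V (div_L1 V i u) (q + int s) (div_L1 V j v)) x) (2 * p - y - 2 - int r) w)"
      unfolding voa.div_L1_mode[OF u] by (rule linear_on_sum[OF vop_linear_left[OF w] cvec.subspace_UNIV]) simp
    then show ?thesis
      unfolding cvec.scale_sum_right
      by (simp add: cvec.scale_sum_right)
        (rule sum.cong, auto simp: E_def simplex_def vop_scale_left[OF w] scaleC_scaleC)
  qed
  then have "adj_op V M (vertop V u q v) y w = Sum_any (\<lambda>r. sum E (simplex r))"
    unfolding adj_op_homogeneous[OF p w] by simp
  also have "\<dots> = sum E ?A"
    by (rule sum_over_simplices[OF _ E0]) auto
  also have "\<dots> = (\<Sum>i<N. \<Sum>j<N. \<Sum>s<S. E (i, j, s))"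
    by (simp add: sum.cartesian_product)
  finally show ?thesis
    unfolding E_def p_def by simp
qed

text \<open>Expanding the transposed modes splits the products on the right into contributions of
  pairs \<open>L(1)^i u\<close>, \<open>L(1)^j v\<close>, which are the products of the Borcherds
  identity for that pair, with the order of composition reversed. On the left the binomial
  coefficients of \<open>adj_op_mode\<close> do not match those of the iterate side directly;
  Vandermonde's identity brings them into line.\<close>

lemma adj_op_borcherds_homogeneous:
  assumes u: "u \<in> wt_space V (adjoint V) (of_int h)" and v: "v \<in> wt_space V (adjoint V) (of_int k)"
    and w: "w \<in> vspace M"
  shows "Sum_any (\<lambda>t. (of_int m gchoose t) *\<^sub>C adj_op V M (vertop V u (l + int t) v) (m + n - int t) w)
    = Sum_any (\<lambda>t. sgn_binom l t *\<^sub>C adj_op V M v (n + int t) (adj_op V M u (m + l - int t) w))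
      - Sum_any (\<lambda>t. ((-1) powi l * sgn_binom l t) *\<^sub>C adj_op V M u (m + int t) (adj_op V M v (n + l - int t) w))"
proof -
  obtain N1 N2 where N12: "\<And>i. i \<ge> N1 \<Longrightarrow> div_L1 V i u = 0" "\<And>j. j \<ge> N2 \<Longrightarrow> div_L1 V j v = 0"
    using voa.div_L1_vanish[OF u] voa.div_L1_vanish[OF v] by blast
  define N where "N = max N1 N2"
  have N: "\<And>i. i \<ge> N \<Longrightarrow> div_L1 V i u = 0" "\<And>j. j \<ge> N \<Longrightarrow> div_L1 V j v = 0"
    using N12 by (auto simp: N_def)
  define U where "U i = div_L1 V i u" for i
  define X where "X j = div_L1 V j v" for j
  \<comment> \<open>With this index \<open>adj_op V M u (m + l - int t)\<close> is built from the
    modes \<open>m' i + int t\<close> of \<open>U i\<close>, and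
    \<open>adj_op V M u (m + int t)\<close> from the modes \<open>m' i + l - int t\<close>. The same
    holds for \<open>v\<close> and \<open>n'\<close>, so \<open>l\<close> stays fixed while the
    roles of the two products are exchanged.\<close>
  define m' where "m' i = 2 * h - m - l - 2 - int i" for i
  define n' where "n' j = 2 * k - n - l - 2 - int j" for j
  let ?e = "(-1 :: complex) powi (h + k)"
  let ?s = "(-1 :: complex) powi l"
  \<comment> \<open>A truncation bound common to all pairs turns every sum into a finite one over a
    fixed range, after which the order of summation is free.\<close>
  have "\<exists>T. \<forall>t\<ge>T. \<forall>x\<in>{..<N} \<times> {..<N}. vertop V (U (fst x)) (l + int t) (X (snd x)) = 0
      \<and> vop M (U (fst x)) (m' (fst x) + int t) w = 0 \<and> vop M (X (snd x)) (n' (snd x) + int t) w = 0"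
  proof (rule eventually_uniform)
    fix x
    obtain T1 T2 T3 where "\<forall>t\<ge>T1. vertop V (U (fst x)) (l + int t) (X (snd x)) = 0"
      "\<forall>t\<ge>T2. vop M (U (fst x)) (m' (fst x) + int t) w = 0"
      "\<forall>t\<ge>T3. vop M (X (snd x)) (n' (snd x) + int t) w = 0"
      using vop_truncation_nat[OF w] voa.adj.vop_truncation_nat by (metis UNIV_I voa.vspace_adjoint voa.vop_adjoint)
    then show "\<exists>T. \<forall>t\<ge>T. vertop V (U (fst x)) (l + int t) (X (snd x)) = 0
      \<and> vop M (U (fst x)) (m' (fst x) + int t) w = 0 \<and> vop M (X (snd x)) (n' (snd x) + int t) w = 0"
      by (intro exI[of _ "T1 + T2 + T3"]) simp
  qed auto
  then obtain T0 where T0: "\<And>t i j. t \<ge> T0 \<Longrightarrow> i < N \<Longrightarrow> j < N \<Longrightarrow> vertop V (U i) (l + int t) (X j) = 0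
      \<and> vop M (U i) (m' i + int t) w = 0 \<and> vop M (X j) (n' j + int t) w = 0"
    by fastforce
  obtain T4 T5 T6 where T456: "\<forall>t\<ge>T4. adj_op V M u (m + l - int t) w = 0" "\<forall>t\<ge>T5. adj_op V M v (n + l - int t) w = 0"
    "\<forall>t\<ge>T6. vertop V u (l + int t) v = 0"
    using adj_op_truncation_nat[OF w] voa.adj.vop_truncation_nat by (metis UNIV_I voa.vspace_adjoint voa.vop_adjoint)
  define T where "T = T0 + T4 + T5 + T6"
  have T: "vertop V (U i) (l + int t) (X j) = 0" "vop M (U i) (m' i + int t) w = 0"
    "vop M (X j) (n' j + int t) w = 0" if "t \<ge> T" "i < N" "j < N" for t i j
    using T0[of t i j] that by (auto simp: T_def)
  have T': "adj_op V M u (m + l - int t) w = 0" "adj_op V M v (n + l - int t) w = 0"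
    "vertop V u (l + int t) v = 0" if "t \<ge> T" for t
    using T456 that by (auto simp: T_def)
  have wt_U: "U i \<in> wt_space V (adjoint V) (of_int (h - int i))"
    and wt_X: "X j \<in> wt_space V (adjoint V) (of_int (k - int j))" for i j
    using voa.div_L1_wt u v by (auto simp: U_def X_def)
  define I where "I i j r = vop M (vertop V (U i) (l + int r) (X j)) (m' i + n' j - int r) w" for i j r
  let ?P = "\<lambda>i j t. vop M (X j) (n' j + l - int t) (vop M (U i) (m' i + int t) w)"
  let ?Q = "\<lambda>i j t. vop M (U i) (m' i + l - int t) (vop M (X j) (n' j + int t) w)"
  let ?p = "\<lambda>t. sgn_binom l t *\<^sub>C adj_op V M v (n + int t) (adj_op V M u (m + l - int t) w)"
  let ?q = "\<lambda>t. (?s * sgn_binom l t) *\<^sub>C adj_op V M u (m + int t) (adj_op V M v (n + l - int t) w)"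
  let ?C = "\<lambda>i j t s. ((of_int m gchoose t) * (- (?e * ?s) * (-1) ^ t) *
            (of_int (2 * h - l - 2 - int i - int t) gchoose s)) *\<^sub>C I i j (t + s)"
  have "Sum_any (\<lambda>t. (of_int m gchoose t) *\<^sub>C adj_op V M (vertop V u (l + int t) v) (m + n - int t) w)
      = (\<Sum>i<N. \<Sum>j<N. \<Sum>r<T. (- (?e * ?s) * (of_int (m' i) gchoose r)) *\<^sub>C I i j r)"
  proof -
    have vanish: "(of_int m gchoose t) *\<^sub>C adj_op V M (vertop V u (l + int t) v) (m + n - int t) w = 0"
      if "t \<ge> T" for t
      using T'(3)[OF that] w by simp
    have step: "(of_int m gchoose t) *\<^sub>C adj_op V M (vertop V u (l + int t) v) (m + n - int t) w
        = (\<Sum>i<N. \<Sum>j<N. \<Sum>s<T - t. ?C i j t s)" if "t < T" for t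
    proof -
      \<comment> \<open>The exponent is the weight of the mode \<open>l + int t\<close> of
        \<open>u\<close> applied to \<open>v\<close>. Its dependence on \<open>t\<close> supplies
        the alternating sign for Vandermonde's identity.\<close>
      have sgn: "(-1) powi (h + k - (l + int t) - 1) = - (?e * ?s) * (-1) ^ t"
        by (simp add: neg_one_powi minus_one_power_iff)
      have idx: "2 * (h + k - (l + int t) - 1) - (m + n - int t) - 2 - int (i + j + s)
          = m' i + n' j - int (t + s)" for i j s
        by (simp add: m'_def n'_def)
      have idx2: "l + int t + int s = l + int (t + s)" "2 * h - (l + int t) - 2 - int i = 2 * h - l - 2 - int i - int t" for s i
        by simp_all
      \<comment> \<open>The cutoff \<open>T - t\<close> for \<open>s\<close> makes the range of
        \<open>(t, s)\<close> a triangle, as \<open>triangle_sum\<close> needs.\<close>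
      have van: "vertop V (div_L1 V i u) (l + int t + int s) (div_L1 V j v) = 0" if "i < N" "j < N" "s \<ge> T - t" for i j s
        using T(1)[of "t + s" i j] that \<open>t < T\<close> by (simp add: U_def X_def add.assoc)
      note mode = adj_op_mode[of u h v k w N "T - t" "l + int t" "m + n - int t", OF u v w N van]
      show ?thesis
        by (subst mode)
          (simp_all only: sgn idx idx2 I_def U_def X_def cvec.scale_sum_right scaleC_scaleC mult.assoc)
    qed
    have "Sum_any (\<lambda>t. (of_int m gchoose t) *\<^sub>C adj_op V M (vertop V u (l + int t) v) (m + n - int t) w)
      = (\<Sum>t<T. \<Sum>i<N. \<Sum>j<N. \<Sum>s<T - t. ?C i j t s)"
      by (rule trans[OF Sum_any_lessThan[of T] sum.cong[OF refl]], erule vanish, rule step) simp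
    also have "\<dots> = (\<Sum>i<N. \<Sum>j<N. \<Sum>t<T. \<Sum>s<T - t. ?C i j t s)"
      by (subst sum.swap) (rule sum.cong[OF refl], rule sum.swap)
    also have "\<dots> = (\<Sum>i<N. \<Sum>j<N. \<Sum>r<T. (- (?e * ?s) * (of_int (m' i) gchoose r)) *\<^sub>C I i j r)"
    proof (rule sum.cong[OF refl], rule sum.cong[OF refl])
      fix i j
      \<comment> \<open>\<open>I\<close> depends on \<open>t\<close> and \<open>s\<close> only
        through \<open>t + s = r\<close>, so each antidiagonal is a single scalar multiple of it.
        The upper argument left by Vandermonde is (2h - l - 2 - i) - m, which is
        \<open>m' i\<close>.\<close>
      have "(\<Sum>t\<le>r. ?C i j t (r - t))
          = (- (?e * ?s) * (of_int (m' i) gchoose r)) *\<^sub>C I i j r" for r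
      proof -
        have "(\<Sum>t\<le>r. ?C i j t (r - t))
          = (\<Sum>t\<le>r. - (?e * ?s) * ((of_int m gchoose t) * (-1) ^ t *
            ((of_int (2 * h - l - 2 - int i) - of_nat t) gchoose (r - t)))) *\<^sub>C I i j r"
          unfolding cvec.scale_sum_left by (intro sum.cong refl) (simp add: mult_ac)
        also have "(\<Sum>t\<le>r. - (?e * ?s) * ((of_int m gchoose t) * (-1) ^ t *
            ((of_int (2 * h - l - 2 - int i) - of_nat t) gchoose (r - t))))
            = - (?e * ?s) * (of_int (m' i) gchoose r)"
          unfolding sum_distrib_left[symmetric] gbinomial_alternating_Vandermonde
          by (simp add: m'_def algebra_simps)
        finally show ?thesis .
      qed
      then show "(\<Sum>t<T. \<Sum>s<T - t. ?C i j t s)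
          = (\<Sum>r<T. (- (?e * ?s) * (of_int (m' i) gchoose r)) *\<^sub>C I i j r)"
        unfolding triangle_sum by simp
    qed
    finally show ?thesis .
  qed
  also have "\<dots> = (\<Sum>i<N. \<Sum>j<N. - (?e * ?s) *\<^sub>C iterate_side V M (U i) (X j) (m' i) (n' j) l w)"
  proof (intro sum.cong refl)
    fix i j assume ij: "i \<in> {..<N}" "j \<in> {..<N}"
    have "iterate_side V M (U i) (X j) (m' i) (n' j) l w = (\<Sum>r<T. (of_int (m' i) gchoose r) *\<^sub>C I i j r)"
      unfolding iterate_side_def I_def
      by (rule Sum_any_lessThan) (use T(1) ij w in simp)
    then show "(\<Sum>r<T. (- (?e * ?s) * (of_int (m' i) gchoose r)) *\<^sub>C I i j r)
        = - (?e * ?s) *\<^sub>C iterate_side V M (U i) (X j) (m' i) (n' j) l w"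
      by (simp only: cvec.scale_sum_right scaleC_scaleC)
  qed
  also have "\<dots> = (\<Sum>i<N. \<Sum>j<N. - (?e * ?s) *\<^sub>C product_side M (U i) (X j) (m' i) (n' j) l w)"
    by (simp only: borcherds[OF w])
  \<comment> \<open>Since the square of \<open>?s\<close> is 1, the overall factor
    \<open>- (?e * ?s)\<close> gives the second product the coefficient \<open>?e\<close> and the
    first one \<open>- (?e * ?s)\<close>: the products trade places, as transposition
    demands.\<close>
  also have "\<dots> = (\<Sum>i<N. \<Sum>j<N. \<Sum>t<T. (?e * sgn_binom l t) *\<^sub>C ?P i j t)
      - (\<Sum>i<N. \<Sum>j<N. \<Sum>t<T. (?e * ?s * sgn_binom l t) *\<^sub>C ?Q i j t)"
    unfolding sum_subtractf[symmetric]
  proof (intro sum.cong refl)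
    fix i j assume ij: "i \<in> {..<N}" "j \<in> {..<N}"
    have "product_side M (U i) (X j) (m' i) (n' j) l w =
        (\<Sum>t<T. sgn_binom l t *\<^sub>C ?Q i j t)
        - (\<Sum>t<T. (?s * sgn_binom l t) *\<^sub>C ?P i j t)"
      unfolding product_side_def
      by (intro arg_cong2[where f = minus] Sum_any_lessThan) (use T ij in auto)
    moreover have "- (?e * ?s) * (?s * x) = - (?e * x)" for x
      by (simp add: neg_one_powi)
    ultimately show "- (?e * ?s) *\<^sub>C product_side M (U i) (X j) (m' i) (n' j) l w =
        (\<Sum>t<T. (?e * sgn_binom l t) *\<^sub>C ?P i j t
        - (?e * ?s * sgn_binom l t) *\<^sub>C ?Q i j t)"
      by (simp only: cvec.scale_right_diff_distrib cvec.scale_sum_right scaleC_scaleC sum_subtractf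
          cvec.scale_minus_left mult_minus_left sum_negf) (simp add: mult_ac)
  qed
  also have "(\<Sum>i<N. \<Sum>j<N. \<Sum>t<T. (?e * sgn_binom l t) *\<^sub>C ?P i j t)
      = Sum_any (\<lambda>t. ?p t)"
  proof -
    have step: "?p t
        = (\<Sum>i<N. \<Sum>j<N. (?e * sgn_binom l t) *\<^sub>C ?P i j t)" for t
    proof -
      have A: "adj_op V M u (m + l - int t) w = (\<Sum>i<N. (-1) powi h *\<^sub>C vop M (U i) (m' i + int t) w)"
        by (subst adj_op_lessThan[OF u w, of N]) (simp_all add: N(1) U_def m'_def algebra_simps)
      have B: "adj_op V M v (n + int t) x = (\<Sum>j<N. (-1) powi k *\<^sub>C vop M (X j) (n' j + l - int t) x)" if "x \<in> vspace M" for x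
        by (subst adj_op_lessThan[OF v that, of N]) (simp_all add: N(2) X_def n'_def algebra_simps)
      have sgn: "sgn_binom l t * ((-1) powi h * (-1) powi k) = ?e * sgn_binom l t"
        by (simp add: neg_one_powi)
      have "adj_op V M v (n + int t) (adj_op V M u (m + l - int t) w)
          = (\<Sum>i<N. (-1) powi h *\<^sub>C adj_op V M v (n + int t) (vop M (U i) (m' i + int t) w))"
        unfolding A
        by (subst linear_on_sum[OF linear_adj_op subspace])
          (auto intro!: cvec.subspace_scale[OF subspace] vop_closed w simp: linear_onD(2)[OF linear_adj_op] vop_closed w)
      also have "\<dots> = (\<Sum>i<N. \<Sum>j<N. ((-1) powi h * (-1) powi k) *\<^sub>C ?P i j t)"
        by (simp only: B[OF vop_closed[OF w]] cvec.scale_sum_right scaleC_scaleC)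
      finally show ?thesis
        by (simp only: cvec.scale_sum_right scaleC_scaleC sgn)
    qed
    have "Sum_any (\<lambda>t. ?p t)
        = (\<Sum>t<T. ?p t)"
      by (rule Sum_any_lessThan) (simp add: T')
    also have "\<dots> = (\<Sum>i<N. \<Sum>j<N. \<Sum>t<T. (?e * sgn_binom l t) *\<^sub>C ?P i j t)"
      unfolding step by (subst sum.swap) (rule sum.cong[OF refl], rule sum.swap)
    finally show ?thesis by simp
  qed
  also have "(\<Sum>i<N. \<Sum>j<N. \<Sum>t<T. (?e * ?s * sgn_binom l t) *\<^sub>C ?Q i j t)
      = Sum_any (\<lambda>t. ?q t)"
  proof -
    have step: "?q t
        = (\<Sum>j<N. \<Sum>i<N. (?e * ?s * sgn_binom l t) *\<^sub>C ?Q i j t)" for t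
    proof -
      have A: "adj_op V M v (n + l - int t) w = (\<Sum>j<N. (-1) powi k *\<^sub>C vop M (X j) (n' j + int t) w)"
        by (subst adj_op_lessThan[OF v w, of N]) (simp_all add: N(2) X_def n'_def algebra_simps)
      have B: "adj_op V M u (m + int t) x = (\<Sum>i<N. (-1) powi h *\<^sub>C vop M (U i) (m' i + l - int t) x)" if "x \<in> vspace M" for x
        by (subst adj_op_lessThan[OF u that, of N]) (simp_all add: N(1) U_def m'_def algebra_simps)
      have sgn: "?s * sgn_binom l t * ((-1) powi k * (-1) powi h) = ?e * ?s * sgn_binom l t"
        by (simp add: neg_one_powi)
      have "adj_op V M u (m + int t) (adj_op V M v (n + l - int t) w)
          = (\<Sum>j<N. (-1) powi k *\<^sub>C adj_op V M u (m + int t) (vop M (X j) (n' j + int t) w))"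
        unfolding A
        by (subst linear_on_sum[OF linear_adj_op subspace])
          (auto intro!: cvec.subspace_scale[OF subspace] vop_closed w simp: linear_onD(2)[OF linear_adj_op] vop_closed w)
      also have "\<dots> = (\<Sum>j<N. \<Sum>i<N. ((-1) powi k * (-1) powi h) *\<^sub>C ?Q i j t)"
        by (simp only: B[OF vop_closed[OF w]] cvec.scale_sum_right scaleC_scaleC)
      finally show ?thesis
        by (simp only: cvec.scale_sum_right scaleC_scaleC sgn)
    qed
    have "Sum_any (\<lambda>t. ?q t)
        = (\<Sum>t<T. ?q t)"
      by (rule Sum_any_lessThan) (simp add: T')
    also have "\<dots> = (\<Sum>j<N. \<Sum>i<N. \<Sum>t<T. (?e * ?s * sgn_binom l t) *\<^sub>C ?Q i j t)"
      unfolding step by (subst sum.swap) (rule sum.cong[OF refl], rule sum.swap)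
    also have "\<dots> = (\<Sum>i<N. \<Sum>j<N. \<Sum>t<T. (?e * ?s * sgn_binom l t) *\<^sub>C ?Q i j t)"
      by (rule sum.swap)
    finally show ?thesis by simp
  qed
  finally show ?thesis .
qed


lemma adj_op_borcherds:
  assumes w: "w \<in> vspace M"
  shows "Sum_any (\<lambda>t. (of_int m gchoose t) *\<^sub>C adj_op V M (vertop V u (l + int t) v) (m + n - int t) w)
    = Sum_any (\<lambda>t. sgn_binom l t *\<^sub>C adj_op V M v (n + int t) (adj_op V M u (m + l - int t) w))
      - Sum_any (\<lambda>t. ((-1) powi l * sgn_binom l t) *\<^sub>C adj_op V M u (m + int t) (adj_op V M v (n + l - int t) w))"
    (is "?L u v = ?P u v - ?Q u v")
proof -
  note lin = linear_on_scale_fun[OF linear_on_compose[OF _ linear_adj_op_left[OF w] UNIV_I]]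
    linear_on_scale_fun[OF linear_on_compose[OF linear_adj_op_left[OF w] linear_adj_op adj_op_closed[OF w]]]
    linear_on_scale_fun[OF linear_adj_op_left[OF adj_op_closed[OF w]]]
    voa.adj.vop_linear_left[simplified] voa.adj.vop_linear[simplified]
  have fin: "finite {t. c t *\<^sub>C adj_op V M (vertop V u (l + int t) v) (q t) w \<noteq> 0}"
    "finite {t. c t *\<^sub>C adj_op V M v (q t) (adj_op V M u (q' - int t) w) \<noteq> 0}" for c q q' u v
  proof -
    obtain T where T: "\<forall>t\<ge>T. vertop V u (l + int t) v = 0"
      using voa.adj.vop_truncation_nat[of v u l] by auto
    show "finite {t. c t *\<^sub>C adj_op V M (vertop V u (l + int t) v) (q t) w \<noteq> 0}"
      by (rule finite_support_lessThan[of T]) (use T w in simp)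
    obtain T where T: "\<forall>t\<ge>T. adj_op V M u (q' - int t) w = 0"
      using adj_op_truncation_nat[OF w] by blast
    show "finite {t. c t *\<^sub>C adj_op V M v (q t) (adj_op V M u (q' - int t) w) \<noteq> 0}"
      by (rule finite_support_lessThan[of T]) (use T in simp)
  qed
  have left: "linear_on UNIV (\<lambda>u. ?L u v)" "linear_on UNIV (\<lambda>u. ?P u v - ?Q u v)" for v
    by (intro linear_on_diff_fun linear_on_Sum_any_fun lin fin)+
  have right: "linear_on UNIV (\<lambda>v. ?L u v)" "linear_on UNIV (\<lambda>v. ?P u v - ?Q u v)" for u
    by (intro linear_on_diff_fun linear_on_Sum_any_fun lin fin)+
  show ?thesis
    by (rule voa.linear_eq_homogeneous[OF left], rule voa.linear_eq_homogeneous[OF right])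
      (rule adj_op_borcherds_homogeneous[OF _ _ w])
qed

text \<open>All divided powers of \<open>L(1)\<close> beyond the zeroth vanish on \<open>v\<close>.
  The vacuum and the conformal vector are the two cases needed.\<close>

lemma adj_op_primary:
  assumes "v \<in> wt_space V (adjoint V) (of_int h)" "Lop V (adjoint V) 1 v = 0" "w \<in> vspace M"
  shows "adj_op V M v n w = (-1) powi h *\<^sub>C vop M v (2 * h - n - 2) w"
proof -
  have "div_L1 V (Suc i) v = 0" for i
    using linear_on_zero[OF voa.linear_L1_pow cvec.subspace_UNIV]
    by (simp add: div_L1_def assms(2) funpow_swap1)
  then have "div_L1 V i v = 0" if "i \<noteq> 0" for i
    using that by (cases i) auto
  then show ?thesis
    unfolding adj_op_homogeneous[OF assms(1,3)]
    by (subst Sum_any_singleton[of 0]) (use assms(3) in auto)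
qed

lemma adj_op_vacuum:
  assumes "w \<in> vspace M"
  shows "adj_op V M (vacuum V) n w = (if n = -1 then w else 0)"
proof -
  have "vacuum V \<in> wt_space V (adjoint V) (of_int 0)" "Lop V (adjoint V) 1 (vacuum V) = 0"
    using voa.vacuum_wt voa.creation(1)[of 2] by (simp_all add: Lop_def)
  from adj_op_primary[OF this assms] show ?thesis
    by (simp add: vacuum_property[OF assms] scaleC_one)
qed

text \<open>\<open>L(n)\<close> transposes to \<open>L(-n)\<close>. The conformal vector is killed
  by \<open>L(1)\<close>: it equals \<open>L(-2)\<close> applied to the vacuum, [L(1), L(-2)] = 3
  L(-1) without central term, and both \<open>L(1)\<close> and \<open>L(-1)\<close> kill the
  vacuum.\<close>

lemma adj_op_conformal:
  assumes "w \<in> vspace M"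
  shows "adj_op V M (conformal V) n w = vop M (conformal V) (2 - n) w"
proof -
  have "Lop V (adjoint V) (-2) (vacuum V) = conformal V" "Lop V (adjoint V) 1 (vacuum V) = 0"
    using voa.creation(1)[of 2] voa.creation(2)[of "conformal V"] by (simp_all add: Lop_def)
  \<comment> \<open>By creation and the derivative property this vector is the mode -2 of the vacuum
    applied to the vacuum.\<close>
  moreover have "Lop V (adjoint V) (-1) (vacuum V) = 0"
    using voa.creation(2)[of "Lop V (adjoint V) (-1) (vacuum V)"]
      voa.adj.L_minus_one_mode[of "vacuum V" "vacuum V" "-1"] voa.vacuum_property[of "-2" "vacuum V"]
    by simp
  moreover have "Lop V (adjoint V) (-2) 0 = 0"
    by (rule linear_on_zero[OF voa.linear_L1 cvec.subspace_UNIV])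
  moreover obtain c :: complex where "\<And>m n v.
      Lop V (adjoint V) m (Lop V (adjoint V) n v) - Lop V (adjoint V) n (Lop V (adjoint V) m v)
      = of_int (m - n) *\<^sub>C Lop V (adjoint V) (m + n) v
        + (if m + n = 0 then (of_int (m ^ 3 - m) / 12 * c) *\<^sub>C v else 0)"
    using voa.virasoro by blast
  from this[of 1 "-2" "vacuum V"] calculation have "Lop V (adjoint V) 1 (conformal V) = 0"
    by simp
  moreover have "conformal V \<in> wt_space V (adjoint V) (of_int 2)"
    using voa.conformal_wt by simp
  ultimately show ?thesis
    using adj_op_primary[of "conformal V" 2 w n] assms by (simp add: scaleC_one)
qed

text \<open>By creation \<open>L(-1) u\<close> is the mode -2 of \<open>u\<close> on the vacuum. In
  the Borcherds identity for \<open>u\<close> and the vacuum with \<open>l = -2\<close>, both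
  products vanish because the vacuum acts only through its mode -1, which never occurs; on the left
  creation leaves the terms \<open>t = 0\<close> and \<open>t = 1\<close>.\<close>

lemma adj_op_L_minus_one:
  assumes "w \<in> vspace M"
  shows "adj_op V M (Lop V (adjoint V) (-1) u) n w = (- of_int n) *\<^sub>C adj_op V M u (n - 1) w"
proof -
  let ?v = "vacuum V"
  have L: "Lop V (adjoint V) (-1) u = vertop V u (-2) ?v"
    using voa.creation(2)[of "Lop V (adjoint V) (-1) u"] voa.adj.L_minus_one_mode[of ?v u "-1"]
    by (simp add: scaleC_one)
  have "Sum_any (\<lambda>t. (of_int n gchoose t) *\<^sub>C adj_op V M (vertop V u (- 2 + int t) ?v) (n + 0 - int t) w) = 0"
    unfolding adj_op_borcherds[OF assms] using adj_op_closed[OF assms] assms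
    by (simp add: adj_op_vacuum)
  moreover have "Sum_any (\<lambda>t. (of_int n gchoose t) *\<^sub>C adj_op V M (vertop V u (- 2 + int t) ?v) (n + 0 - int t) w)
      = adj_op V M (vertop V u (-2) ?v) n w + of_int n *\<^sub>C adj_op V M u (n - 1) w"
    by (subst Sum_any_lessThan[of 2])
      (use assms in \<open>auto simp: voa.creation numeral_2_eq_2 scaleC_one\<close>)
  ultimately show ?thesis
    unfolding L by (simp add: eq_neg_iff_add_eq_0)
qed

end

section \<open>Duality for finite-dimensional spaces\<close>

lemma linear_on_eq_span:
  assumes "linear_on (cvec.span B) f" "linear_on (cvec.span B) g" "\<And>b. b \<in> B \<Longrightarrow> f b = g b"
    "x \<in> cvec.span B"
  shows "f x = g x"
proof -
  have "x \<in> cvec.span B \<and> f x = g x"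
    using assms(4)
  proof (induction rule: cvec.span_induct_alt)
    case base
    show ?case
      using linear_on_zero[OF assms(1) cvec.subspace_span] linear_on_zero[OF assms(2) cvec.subspace_span]
      by (simp add: cvec.span_zero)
  next
    case (step c x y)
    then have "x \<in> cvec.span B" "c *\<^sub>C x \<in> cvec.span B"
      by (auto intro: cvec.span_base cvec.span_scale)
    then show ?case
      using step by (simp add: linear_onD[OF assms(1)] linear_onD[OF assms(2)] assms(3) cvec.span_add)
  qed
  then show ?thesis ..
qed

lemma linear_on_span_image:
  assumes "linear_on (cvec.span B) f"
  shows "f ` cvec.span B = cvec.span (f ` B)"
proof
  show "f ` cvec.span B \<subseteq> cvec.span (f ` B)"
  proof clarify
    fix x assume "x \<in> cvec.span B"
    then have "x \<in> cvec.span B \<and> f x \<in> cvec.span (f ` B)"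
    proof (induction rule: cvec.span_induct_alt)
      case base
      show ?case
        using linear_on_zero[OF assms cvec.subspace_span] by (simp add: cvec.span_zero)
    next
      case (step c x y)
      then have "x \<in> cvec.span B" "c *\<^sub>C x \<in> cvec.span B" "y \<in> cvec.span B"
        by (auto intro: cvec.span_base cvec.span_scale)
      then have "f (c *\<^sub>C x + y) = c *\<^sub>C f x + f y"
        by (simp add: linear_onD[OF assms])
      then show ?case
        using step \<open>c *\<^sub>C x \<in> cvec.span B\<close> by (simp add: cvec.span_add cvec.span_scale cvec.span_base)
    qed
    then show "f x \<in> cvec.span (f ` B)" ..
  qed
  have "cvec.subspace (f ` cvec.span B)"
    unfolding cvec.subspace_def
  proof (intro conjI ballI allI)
    show "0 \<in> f ` cvec.span B"
      using linear_on_zero[OF assms cvec.subspace_span] cvec.span_zero[of B] by (metis image_eqI)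
  next
    fix x y assume "x \<in> f ` cvec.span B" "y \<in> f ` cvec.span B"
    then show "x + y \<in> f ` cvec.span B"
      using linear_onD(1)[OF assms] cvec.span_add[of _ B] by (metis (no_types, lifting) image_iff)
  next
    fix c x assume "x \<in> f ` cvec.span B"
    then show "c *\<^sub>C x \<in> f ` cvec.span B"
      using linear_onD(2)[OF assms] cvec.span_scale[of _ B] by (metis (no_types, lifting) image_iff)
  qed
  then show "cvec.span (f ` B) \<subseteq> f ` cvec.span B"
    by (rule cvec.span_minimal[rotated]) (auto intro: cvec.span_base)
qed

lemma finite_basis:
  assumes "finite A"
  obtains B where "finite B" "cvec.independent B" "cvec.span B = cvec.span A"
proof -
  obtain B where B: "B \<subseteq> A" "cvec.independent B" "A \<subseteq> cvec.span B"
    using cvec.maximal_independent_subset[of A] by blast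
  have "cvec.span B = cvec.span A"
    using B(1,3) cvec.span_mono[of B A] cvec.span_minimal[OF B(3) cvec.subspace_span] by blast
  with B assms show ?thesis
    by (intro that[of B]) (auto intro: finite_subset)
qed

text \<open>A space of functionals that separates the points of the span of a finite basis contains
  the dual basis. The induction adjoins one basis vector at a time.\<close>

lemma dual_family:
  fixes S :: "('x::complex_vector \<Rightarrow> complex) set"
  assumes "finite B" "cvec.independent B" "cvec.subspace S"
    "\<And>s. s \<in> S \<Longrightarrow> linear_on (cvec.span B) s"
    "\<And>x. x \<in> cvec.span B \<Longrightarrow> (\<And>s. s \<in> S \<Longrightarrow> s x = 0) \<Longrightarrow> x = 0"
  shows "\<exists>\<sigma>. \<forall>b\<in>B. \<sigma> b \<in> S \<and> (\<forall>c\<in>B. \<sigma> b c = (if c = b then 1 else 0))"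
  using assms
proof (induction B rule: finite_induct)
  case empty
  then show ?case by simp
next
  case (insert b B)
  have sub: "cvec.span B \<subseteq> cvec.span (insert b B)"
    by (rule cvec.span_mono) auto
  have indep: "cvec.independent B" "b \<notin> cvec.span B"
    using insert.prems(1) insert.hyps(2) by (auto simp: cvec.independent_insert)
  have "\<exists>\<sigma>. \<forall>b\<in>B. \<sigma> b \<in> S \<and> (\<forall>c\<in>B. \<sigma> b c = (if c = b then 1 else 0))"
    by (rule insert.IH[OF indep(1) insert.prems(2)])
      (use insert.prems(3,4) linear_on_subset[OF _ sub] sub in blast)+
  then obtain \<sigma> where \<sigma>: "\<And>b. b \<in> B \<Longrightarrow> \<sigma> b \<in> S"
    "\<And>b c. b \<in> B \<Longrightarrow> c \<in> B \<Longrightarrow> \<sigma> b c = (if c = b then 1 else 0)"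
    by blast
  have "\<exists>s\<in>S. (\<forall>c\<in>B. s c = 0) \<and> s b \<noteq> 0"
  proof (rule ccontr)
    assume no: "\<not> ?thesis"
    \<comment> \<open>If every functional in \<open>S\<close> that kills \<open>B\<close> also
      killed \<open>b\<close>, then subtracting from \<open>s\<close> its expansion in the \<sigma>
      would show that all of \<open>S\<close> takes equal values at \<open>b\<close> and at this
      \<open>y\<close>. Separation would force \<open>b = y\<close>, against independence.\<close>
    define y where "y = (\<Sum>c\<in>B. \<sigma> c b *\<^sub>C c)"
    have y: "y \<in> cvec.span B"
      unfolding y_def by (intro cvec.span_sum cvec.span_scale cvec.span_base)
    have b: "b \<in> cvec.span (insert b B)"
      by (rule cvec.span_base) simp
    have "s (b - y) = 0" if s: "s \<in> S" for s
    proof -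
      note lin = insert.prems(3)[OF s]
      define t where "t = s - (\<Sum>c\<in>B. s c *\<^sub>C \<sigma> c)"
      have "t \<in> S"
        unfolding t_def
        by (intro cvec.subspace_diff[OF insert.prems(2)] cvec.subspace_sum[OF insert.prems(2)]
            cvec.subspace_scale[OF insert.prems(2)] s \<sigma>(1))
      moreover have "t x = s x - (\<Sum>c\<in>B. s c * \<sigma> c x)" for x
        by (simp add: t_def sum_fun_apply scaleC_complex_def)
      moreover have "(\<Sum>c\<in>B. s c * \<sigma> c d) = s d" if "d \<in> B" for d
      proof -
        have "(\<Sum>c\<in>B. s c * \<sigma> c d) = (\<Sum>c\<in>B. if d = c then s c else 0)"
          using that by (intro sum.cong) (auto simp: \<sigma>(2))
        then show ?thesis
          using that insert.hyps(1) by simp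
      qed
      ultimately have "s b = (\<Sum>c\<in>B. s c * \<sigma> c b)"
        using no by force
      also have "\<dots> = s y"
        unfolding y_def
        by (subst linear_on_sum[OF lin cvec.subspace_span])
          (simp_all add: linear_onD(2)[OF lin] cvec.span_scale cvec.span_base scaleC_complex_def mult.commute)
      finally show ?thesis
        using linear_on_diff[OF lin cvec.subspace_span b] y sub by auto
    qed
    then have "b - y = 0"
      using b y sub by (intro insert.prems(4)) (auto intro: cvec.span_diff)
    then show False
      using y indep(2) by simp
  qed
  then obtain s0 where s0: "s0 \<in> S" "\<And>c. c \<in> B \<Longrightarrow> s0 c = 0" "s0 b \<noteq> 0"
    by blast
  define s where "s = (1 / s0 b) *\<^sub>C s0"
  have s: "s \<in> S" "\<And>c. c \<in> B \<Longrightarrow> s c = 0" "s b = 1"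
    using s0 cvec.subspace_scale[OF insert.prems(2) s0(1)] by (auto simp: s_def scaleC_complex_def)
  \<comment> \<open>The old functionals are corrected to vanish at the new vector \<open>b\<close>;
    as \<open>s\<close> kills \<open>B\<close>, their values on \<open>B\<close> are
    unchanged.\<close>
  define \<sigma>' where "\<sigma>' c = (if c = b then s else \<sigma> c - \<sigma> c b *\<^sub>C s)" for c
  have "\<sigma>' c \<in> S" if "c \<in> insert b B" for c
    using that s \<sigma>(1)
    by (auto simp: \<sigma>'_def intro!: cvec.subspace_diff[OF insert.prems(2)] cvec.subspace_scale[OF insert.prems(2)])
  moreover have "\<sigma>' c d = (if d = c then 1 else 0)" if "c \<in> insert b B" "d \<in> insert b B" for c d
    using that s \<sigma>(2) insert.hyps(2) by (auto simp: \<sigma>'_def scaleC_complex_def)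
  ultimately show ?case by blast
qed

text \<open>In finite dimension a separating subspace of the dual is the whole dual. It is applied
  to evaluations at vectors, which yields reflexivity, and to the span of the components of the
  canonical map.\<close>

lemma separating_functionals:
  fixes S :: "('x::complex_vector \<Rightarrow> complex) set"
  assumes "finite A" "X = cvec.span A" "cvec.subspace S"
    and lin: "\<And>s. s \<in> S \<Longrightarrow> linear_on X s"
    and "\<And>x. x \<in> X \<Longrightarrow> (\<And>s. s \<in> S \<Longrightarrow> s x = 0) \<Longrightarrow> x = 0"
    and "linear_on X \<Phi>"
  shows "\<exists>s\<in>S. \<forall>x\<in>X. s x = \<Phi> x"
proof -
  obtain B where B: "finite B" "cvec.independent B" "cvec.span B = X"
    using finite_basis[OF assms(1)] assms(2) by metis
  obtain \<sigma> where \<sigma>: "\<And>b. b \<in> B \<Longrightarrow> \<sigma> b \<in> S"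
    "\<And>b c. b \<in> B \<Longrightarrow> c \<in> B \<Longrightarrow> \<sigma> b c = (if c = b then 1 else 0)"
    using dual_family[OF B(1,2) assms(3)] assms(4,5) B(3) by metis
  define s where "s = (\<Sum>b\<in>B. \<Phi> b *\<^sub>C \<sigma> b)"
  have s: "s \<in> S"
    unfolding s_def by (intro cvec.subspace_sum[OF assms(3)] cvec.subspace_scale[OF assms(3)] \<sigma>(1))
  have "s c = \<Phi> c" if "c \<in> B" for c
  proof -
    have "s c = (\<Sum>b\<in>B. if c = b then \<Phi> b else 0)"
      unfolding s_def sum_fun_apply by (rule sum.cong) (use \<sigma>(2) that in \<open>auto simp: scaleC_complex_def\<close>)
    then show ?thesis
      using that B(1) by simp
  qed
  then have "s x = \<Phi> x" if "x \<in> X" for x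
    using linear_on_eq_span[of B s \<Phi> x] lin[OF s] assms(6) B(3) that by simp
  with s show ?thesis by blast
qed

section \<open>The contragredient module\<close>

context generalized_module
begin

lemma linear_eq_Sum_wt_comp:
  assumes "linear_on (vspace M) f" "w \<in> vspace M"
  shows "f w = Sum_any (\<lambda>n. f (wt_comp V M w n))"
  using linear_on_Sum_any[OF assms(1) subspace wt_comp_vspace[OF assms(2)] wt_comp(2)[OF assms(2)]]
    wt_comp(3)[OF assms(2)] by simp

lemma linear_zero_homogeneous:
  assumes "linear_on (vspace M) f" "\<And>n w. w \<in> wt_space V M n \<Longrightarrow> f w = 0" "w \<in> vspace M"
  shows "f w = 0"
  using linear_eq_Sum_wt_comp[OF assms(1,3)] assms(2)[OF wt_comp(1)[OF assms(3)]] by simp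

end

lemma contragredient_vspace:
  "f \<in> vspace (contragredient V M) \<longleftrightarrow> linear_on (vspace M) f \<and> (\<forall>w. w \<notin> vspace M \<longrightarrow> f w = 0)
    \<and> finite {n. \<exists>w\<in>wt_space V M n. f w \<noteq> 0}"
  by (simp add: contragredient_def)

lemma contragredient_vop:
  "vop (contragredient V M) v n f w = (if w \<in> vspace M then f (adj_op V M v n w) else 0)"
  by (simp add: contragredient_def adj_op_def)

locale voa_module = voa_gmodule V M + vmodule V M
  for V :: "'v::complex_vector voa" and M :: "('v, 'a::complex_vector) vmod"
begin

abbreviation "M' \<equiv> contragredient V M"

lemma contragredientD:
  assumes "f \<in> vspace M'"
  shows "linear_on (vspace M) f" "w \<notin> vspace M \<Longrightarrow> f w = 0" "finite {n. \<exists>w\<in>wt_space V M n. f w \<noteq> 0}"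
  using assms by (auto simp: contragredient_vspace)

lemma contragredient_subspace: "cvec.subspace (vspace M')"
  unfolding cvec.subspace_def
proof (intro conjI ballI allI)
  show "0 \<in> vspace M'"
    by (simp add: contragredient_vspace linear_on_def)
next
  fix f g assume fg: "f \<in> vspace M'" "g \<in> vspace M'"
  have "finite {n. \<exists>w\<in>wt_space V M n. (f + g) w \<noteq> 0}"
    by (rule finite_subset[OF _ finite_UnI[OF contragredientD(3)[OF fg(1)] contragredientD(3)[OF fg(2)]]]) auto
  with fg show "f + g \<in> vspace M'"
    using linear_on_add_fun[of "vspace M" f g] by (auto simp: contragredient_vspace plus_fun_def)
next
  fix c f assume f: "f \<in> vspace M'"
  have "finite {n. \<exists>w\<in>wt_space V M n. (c *\<^sub>C f) w \<noteq> 0}"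
    by (rule finite_subset[OF _ contragredientD(3)[OF f]]) auto
  with f show "c *\<^sub>C f \<in> vspace M'"
    using linear_on_scale_fun[of "vspace M" f c] by (auto simp: contragredient_vspace scaleC_fun_def)
qed

lemma contragredient_eqI:
  assumes "f \<in> vspace M'" "g \<in> vspace M'" "\<And>w. w \<in> vspace M \<Longrightarrow> f w = g w"
  shows "f = g"
proof
  fix w
  show "f w = g w"
    using contragredientD(2)[OF assms(1)] contragredientD(2)[OF assms(2)] assms(3)
    by (cases "w \<in> vspace M") auto
qed

lemma linear_f_adj_op:
  assumes "f \<in> vspace M'"
  shows "linear_on (vspace M) (\<lambda>w. f (adj_op V M v n w))"
  by (rule linear_on_compose[OF linear_adj_op contragredientD(1)[OF assms] adj_op_closed])

lemma contragredient_vop_closed: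
  assumes f: "f \<in> vspace M'"
  shows "vop M' v n f \<in> vspace M'"
proof -
  let ?Z = "\<lambda>v. {\<mu>. \<exists>w\<in>wt_space V M \<mu>. f (adj_op V M v n w) \<noteq> 0}"
  have "finite (?Z v)"
  proof (rule voa.homogeneous_induct[where P = "\<lambda>v. finite (?Z v)"])
    have lin: "linear_on UNIV (\<lambda>v. f (adj_op V M v n w))" if "w \<in> wt_space V M \<mu>" for w \<mu>
      using that wt_in_vspace
      by (intro linear_on_compose[OF linear_adj_op_left contragredientD(1)[OF f]] adj_op_closed) auto
    have sub: "?Z (c *\<^sub>C v) \<subseteq> ?Z v"
      "?Z (u + v) \<subseteq>
        ?Z u \<union> ?Z v" for c u v
      using linear_onD[OF lin] by auto
    show "cvec.subspace {v. finite (?Z v)}"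
      unfolding cvec.subspace_def
      by (auto simp: linear_on_zero[OF lin cvec.subspace_UNIV] cong: bex_cong
          intro: finite_subset[OF sub(1)] finite_subset[OF sub(2)])
    fix h v assume v: "v \<in> wt_space V (adjoint V) (of_int h)"
    have "?Z v
        \<subseteq> (\<lambda>s. s + of_int h - of_int n - 1) ` {n. \<exists>w\<in>wt_space V M n. f w \<noteq> 0}"
    proof clarify
      fix \<mu> w assume w: "w \<in> wt_space V M \<mu>" "f (adj_op V M v n w) \<noteq> 0"
      then show "\<mu> \<in> (\<lambda>s. s + of_int h - of_int n - 1) ` {n. \<exists>w\<in>wt_space V M n. f w \<noteq> 0}"
        using adj_op_wt[OF v w(1), of n]
        by (intro image_eqI[of _ _ "\<mu> - of_int h + of_int n + 1"]) auto
    qed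
    then show "finite (?Z v)"
      using contragredientD(3)[OF f] by (rule finite_subset[OF _ finite_imageI])
  qed
  then have "finite {\<mu>. \<exists>w\<in>wt_space V M \<mu>. vop M' v n f w \<noteq> 0}"
    by (rule rev_finite_subset) (auto simp: contragredient_vop)
  moreover have "linear_on (vspace M) (vop M' v n f)"
    using linear_f_adj_op[OF f, of v n] subspace
    by (auto simp: linear_on_def contragredient_vop cvec.subspace_def)
  ultimately show ?thesis
    by (simp add: contragredient_vspace contragredient_vop)
qed

lemma contragredient_L0: "w \<in> vspace M \<Longrightarrow> Lop V M' 0 f w = f (Lop V M 0 w)"
  by (simp add: Lop_def contragredient_vop adj_op_conformal)

text \<open>\<open>L(0)\<close> is its own transpose, so a functional of weight \<open>n\<close>
  satisfies n f(w) = m f(w) on the weight space of \<open>m\<close>. The eigenvalue grading is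
  therefore the grading by duals of weight spaces.\<close>

lemma contragredient_wt_space:
  "wt_space V M' n = {f \<in> vspace M'. \<forall>m. m \<noteq> n \<longrightarrow> (\<forall>w\<in>wt_space V M m. f w = 0)}"
proof (intro set_eqI iffI)
  fix f assume f: "f \<in> wt_space V M' n"
  then have f': "f \<in> vspace M'" "Lop V M' 0 f = n *\<^sub>C f"
    by (auto simp: wt_space_def)
  have "f w = 0" if "m \<noteq> n" "w \<in> wt_space V M m" for m w
  proof -
    have "n * f w = m * f w"
      using contragredient_L0[OF wt_in_vspace[OF that(2)], of f] fun_cong[OF f'(2), of w] that(2)
        linear_onD(2)[OF contragredientD(1)[OF f'(1)] wt_in_vspace[OF that(2)]]
      by (simp add: wt_space_def scaleC_complex_def)
    then show ?thesis
      using that(1) by simp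
  qed
  with f' show "f \<in> {f \<in> vspace M'. \<forall>m. m \<noteq> n \<longrightarrow> (\<forall>w\<in>wt_space V M m. f w = 0)}"
    by simp
next
  fix f assume f: "f \<in> {f \<in> vspace M'. \<forall>m. m \<noteq> n \<longrightarrow> (\<forall>w\<in>wt_space V M m. f w = 0)}"
  then have lin: "linear_on (vspace M) f"
    using contragredientD(1) by blast
  have "f (Lop V M 0 w) - n *\<^sub>C f w = 0" if "w \<in> vspace M" for w
  proof (rule linear_zero_homogeneous[OF _ _ that])
    show "linear_on (vspace M) (\<lambda>w. f (Lop V M 0 w) - n *\<^sub>C f w)"
      by (intro linear_on_diff_fun linear_on_scale_fun lin linear_on_compose[OF linear_Lop lin] Lop_closed)
    fix m w assume w: "w \<in> wt_space V M m"
    then have "f (Lop V M 0 w) = m *\<^sub>C f w"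
      using linear_onD(2)[OF lin] by (simp add: wt_space_def)
    with w f show "f (Lop V M 0 w) - n *\<^sub>C f w = 0"
      by (cases "m = n") auto
  qed
  then have "Lop V M' 0 f w = n *\<^sub>C f w" for w
    using contragredient_L0[of w f] contragredientD(2)[of f w] f
    by (cases "w \<in> vspace M") (auto simp: Lop_def contragredient_vop)
  with f show "f \<in> wt_space V M' n"
    by (auto simp: wt_space_def intro!: ext)
qed

text \<open>This is \<open>wt_comp\<close> of the contragredient module, written out explicitly
  because that module's grading is established with its help.\<close>

definition dual_comp :: "('a \<Rightarrow> complex) \<Rightarrow> complex \<Rightarrow> 'a \<Rightarrow> complex" where
  "dual_comp f n w = (if w \<in> vspace M then f (wt_comp V M w n) else 0)"

lemma dual_comp_wt:
  assumes "f \<in> vspace M'"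
  shows "dual_comp f n \<in> wt_space V M' n"
proof -
  have lin: "linear_on (vspace M) (\<lambda>w. f (wt_comp V M w n))"
    by (rule linear_on_compose[OF wt_comp_linear contragredientD(1)[OF assms] wt_comp_vspace])
  have 0: "dual_comp f n w = 0" if "w \<in> wt_space V M m" "m \<noteq> n" for m w
    using that wt_comp_wt[OF that(1)] linear_on_zero[OF contragredientD(1)[OF assms] subspace]
    by (simp add: dual_comp_def)
  have "finite {m. \<exists>w\<in>wt_space V M m. dual_comp f n w \<noteq> 0}"
    by (rule finite_subset[of _ "{n}"]) (use 0 in auto)
  moreover have "linear_on (vspace M) (dual_comp f n)"
    using lin subspace by (auto simp: linear_on_def dual_comp_def cvec.subspace_def)
  ultimately have "dual_comp f n \<in> vspace M'"
    by (simp add: contragredient_vspace dual_comp_def)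
  then show ?thesis
    unfolding contragredient_wt_space using 0 by blast
qed

lemma dual_comp_support:
  assumes "f \<in> vspace M'"
  shows "{n. dual_comp f n \<noteq> 0} \<subseteq> {n. \<exists>w\<in>wt_space V M n. f w \<noteq> 0}"
proof clarify
  fix n assume ne: "dual_comp f n \<noteq> 0"
  show "\<exists>w\<in>wt_space V M n. f w \<noteq> 0"
  proof (rule ccontr)
    assume "\<not> ?thesis"
    then have "dual_comp f n w = 0" for w
      using wt_comp(1) by (auto simp: dual_comp_def)
    then show False
      using ne by (auto simp: fun_eq_iff)
  qed
qed

lemma finite_dual_comp: "f \<in> vspace M' \<Longrightarrow> finite {n. dual_comp f n \<noteq> 0}"
  using finite_subset[OF dual_comp_support contragredientD(3)] .

lemma Sum_any_dual_comp:
  assumes "f \<in> vspace M'"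
  shows "Sum_any (dual_comp f) = f"
proof
  fix w
  show "Sum_any (dual_comp f) w = f w"
    using linear_eq_Sum_wt_comp[OF contragredientD(1)[OF assms], of w] contragredientD(2)[OF assms, of w]
    by (cases "w \<in> vspace M") (simp_all add: Sum_any_fun_apply[OF finite_dual_comp[OF assms]] dual_comp_def)
qed

text \<open>For homogeneous \<open>v\<close> the transposed mode raises weights by an amount growing
  with \<open>n\<close>. The weights seen by \<open>f\<close> are bounded above and those of
  \<open>M\<close> below, so for large \<open>n\<close> nothing can reach the support of
  \<open>f\<close>.\<close>

lemma contragredient_truncation:
  assumes f: "f \<in> vspace M'"
  shows "\<exists>N. \<forall>n\<ge>N. vop M' v n f = 0"
proof -
  define P where "P v \<longleftrightarrow> (\<exists>N. \<forall>n\<ge>N. \<forall>w\<in>vspace M. f (adj_op V M v n w) = 0)" for v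
  have "P v"
  proof (rule voa.homogeneous_induct)
    have lin: "linear_on UNIV (\<lambda>v. f (adj_op V M v n w))" if "w \<in> vspace M" for w n
      using that by (intro linear_on_compose[OF linear_adj_op_left contragredientD(1)[OF f]] adj_op_closed) auto
    show "cvec.subspace {v. P v}"
      unfolding cvec.subspace_def mem_Collect_eq
    proof (intro conjI ballI allI)
      show "P 0"
        using linear_on_zero[OF lin cvec.subspace_UNIV] by (simp add: P_def)
    next
      fix u v assume "u \<in> {v. P v}" "v \<in> {v. P v}"
      then obtain N1 N2 where "\<forall>n\<ge>N1. \<forall>w\<in>vspace M. f (adj_op V M u n w) = 0"
        "\<forall>n\<ge>N2. \<forall>w\<in>vspace M. f (adj_op V M v n w) = 0"
        by (auto simp: P_def)
      then show "P (u + v)"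
        unfolding P_def using linear_onD(1)[OF lin] by (intro exI[of _ "max N1 N2"]) simp
    next
      fix c v assume "v \<in> {v. P v}"
      then show "P (c *\<^sub>C v)"
        unfolding P_def using linear_onD(2)[OF lin] by fastforce
    qed
    fix h v assume v: "v \<in> wt_space V (adjoint V) (of_int h)"
    let ?S = "{n. \<exists>w\<in>wt_space V M n. f w \<noteq> 0}"
    obtain B :: real where B: "\<And>n. Re n < B \<Longrightarrow> wt_space V M n = {0}"
      using bounded_below by blast
    have "bdd_above (Re ` ?S)"
      using contragredientD(3)[OF f] by (intro bdd_above_finite finite_imageI)
    then obtain R where R: "\<And>s. s \<in> ?S \<Longrightarrow> Re s \<le> R"
      by (auto simp: bdd_above_def)
    \<comment> \<open>A nonzero value needs Re \<mu> - h + n + 1 <= R, and this threshold for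
      \<open>n\<close> then puts Re \<mu> below \<open>B\<close>.\<close>
    have "f (adj_op V M v n w) = 0" if n: "n \<ge> \<lceil>R + of_int h - B\<rceil>" and "w \<in> vspace M" for n w
    proof (rule linear_zero_homogeneous[OF linear_f_adj_op[OF f] _ that(2)])
      fix \<mu> w assume w: "w \<in> wt_space V M \<mu>"
      show "f (adj_op V M v n w) = 0"
      proof (rule ccontr)
        assume ne: "f (adj_op V M v n w) \<noteq> 0"
        then have "\<mu> - of_int h + of_int n + 1 \<in> ?S"
          using adj_op_wt[OF v w] by blast
        from R[OF this] have "Re \<mu> < B"
          using n by (simp add: ceiling_le_iff)
        then have "w = 0"
          using B w by blast
        then show False
          using ne linear_on_zero[OF contragredientD(1)[OF f] subspace] by simp
      qed
    qed
    then show "P v"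
      unfolding P_def by blast
  qed
  then show ?thesis
    unfolding P_def by (auto simp: fun_eq_iff contragredient_vop)
qed

lemma contragredient_Sum_any:
  assumes "f \<in> vspace M'" "finite {t. g t \<noteq> 0}" "\<And>t. g t \<in> vspace M"
  shows "f (Sum_any (\<lambda>t. c t *\<^sub>C g t)) = Sum_any (\<lambda>t. c t * f (g t))"
  using linear_on_scaled_Sum_any[OF contragredientD(1)[OF assms(1)] subspace assms(3,2)]
  by (simp add: scaleC_complex_def)

text \<open>\<open>f\<close> is applied to the Borcherds identity for transposed modes. Passing from
  operators to functionals reverses compositions a second time, which restores the original
  order.\<close>

lemma contragredient_jacobi: "jacobi_identity V M'"
  unfolding jacobi_identity_iff
proof (intro allI ballI ext)
  fix u v f m n l w assume f: "f \<in> vspace M'"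
  obtain T where T: "\<And>t. t \<ge> T \<Longrightarrow> vertop V u (l + int t) v = 0"
    using voa.adj.vop_truncation_nat[of v u l] by auto
  obtain T1 T2 where T12: "\<And>t. t \<ge> T1 \<Longrightarrow> vop M' v (n + int t) f = 0" "\<And>t. t \<ge> T2 \<Longrightarrow> vop M' u (m + int t) f = 0"
  proof -
    obtain N1 N2 where "\<forall>n\<ge>N1. vop M' v n f = 0" "\<forall>n\<ge>N2. vop M' u n f = 0"
      using contragredient_truncation[OF f] by metis
    then show ?thesis
      by (intro that[of "nat (N1 - n)" "nat (N2 - m)"]) auto
  qed
  have vop0: "vop M' v n 0 = 0" for v n
    by (simp add: fun_eq_iff contragredient_vop)
  have vop0': "vop M' 0 n f = 0" for n
    using linear_on_zero[OF contragredientD(1)[OF f] subspace] by (auto simp: fun_eq_iff contragredient_vop)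
  show "iterate_side V M' u v m n l f w = product_side M' u v m n l f w"
  proof (cases "w \<in> vspace M")
    case True
    let ?P = "Sum_any (\<lambda>t. sgn_binom l t *\<^sub>C adj_op V M v (n + int t) (adj_op V M u (m + l - int t) w))"
    let ?Q = "Sum_any (\<lambda>t. ((-1) powi l * sgn_binom l t) *\<^sub>C adj_op V M u (m + int t) (adj_op V M v (n + l - int t) w))"
    have "iterate_side V M' u v m n l f w
        = Sum_any (\<lambda>i. (of_int m gchoose i) * f (adj_op V M (vertop V u (l + int i) v) (m + n - int i) w))"
      unfolding iterate_side_def
      by (subst Sum_any_fun_apply[OF finite_support_lessThan[of T]])
        (simp_all add: T vop0' contragredient_vop True scaleC_complex_def)
    also have "\<dots> = f (Sum_any (\<lambda>i. (of_int m gchoose i) *\<^sub>C adj_op V M (vertop V u (l + int i) v) (m + n - int i) w))"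
      by (rule contragredient_Sum_any[symmetric, OF f finite_support_lessThan[of T] adj_op_closed[OF True]])
        (simp add: T True)
    also have "\<dots> = f (?P
      - ?Q)"
      by (simp only: adj_op_borcherds[OF True])
    also have "\<dots> = f (?P)
      - f (?Q)"
      by (intro linear_on_diff[OF contragredientD(1)[OF f] subspace] subspace_Sum_any[OF subspace]
          cvec.subspace_scale[OF subspace] adj_op_closed True)
    also have "f (?P)
      = Sum_any (\<lambda>i. sgn_binom l i *\<^sub>C vop M' u (m + l - int i) (vop M' v (n + int i) f)) w"
    proof -
      obtain T' where "\<And>t. t \<ge> T' \<Longrightarrow> adj_op V M u (m + l - int t) w = 0"
        using adj_op_truncation_nat[OF True] by blast
      then show ?thesis
        by (subst contragredient_Sum_any[OF f finite_support_lessThan[of T']])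
          (auto simp: Sum_any_fun_apply[OF finite_support_lessThan[of T1]] T12 vop0 True
            contragredient_vop adj_op_closed scaleC_complex_def)
    qed
    also have "f (?Q)
      = Sum_any (\<lambda>i. ((-1) powi l * sgn_binom l i) *\<^sub>C vop M' v (n + l - int i) (vop M' u (m + int i) f)) w"
    proof -
      obtain T' where "\<And>t. t \<ge> T' \<Longrightarrow> adj_op V M v (n + l - int t) w = 0"
        using adj_op_truncation_nat[OF True] by blast
      then show ?thesis
        by (subst contragredient_Sum_any[OF f finite_support_lessThan[of T']])
          (auto simp: Sum_any_fun_apply[OF finite_support_lessThan[of T2]] T12 vop0 True
            contragredient_vop adj_op_closed scaleC_complex_def)
    qed
    finally show ?thesis
      by (simp only: product_side_def minus_apply)
  next
    case False
    have 0: "Sum_any (\<lambda>i. c i *\<^sub>C vop M' (a i) (q i) (g i)) w = 0" for c a q g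
      unfolding Sum_any.expand_set sum_fun_apply using False by (simp add: contragredient_vop)
    show ?thesis
      unfolding iterate_side_def product_side_def by (simp add: 0)
  qed
qed

lemma contragredient_generalized_module: "generalized_module V M'"
proof
  show "cvec.subspace (vspace M')" by (rule contragredient_subspace)
  show "vop M' v n w \<in> vspace M'" if "w \<in> vspace M'" for w v n
    using that by (rule contragredient_vop_closed)
  show "bilinear_on UNIV (vspace M') (\<lambda>v. vop M' v n)" for n
  proof -
    have "linear_on UNIV (\<lambda>v. vop M' v n f)" if "f \<in> vspace M'" for f
    proof -
      have "linear_on UNIV (\<lambda>v. f (adj_op V M v n w))" if "w \<in> vspace M" for w
        using that \<open>f \<in> vspace M'\<close>
        by (intro linear_on_compose[OF linear_adj_op_left contragredientD(1)] adj_op_closed) auto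
      then show ?thesis
        by (auto simp: linear_on_def fun_eq_iff contragredient_vop)
    qed
    then show ?thesis
      by (auto simp: bilinear_on_def linear_on_def fun_eq_iff contragredient_vop)
  qed
  show "vspace M' = cvec.span (\<Union>n. wt_space V M' n)"
  proof
    show "cvec.span (\<Union>n. wt_space V M' n) \<subseteq> vspace M'"
      by (rule cvec.span_minimal[OF _ contragredient_subspace]) (auto simp: wt_space_def)
    show "vspace M' \<subseteq> cvec.span (\<Union>n. wt_space V M' n)"
    proof
      fix f assume f: "f \<in> vspace M'"
      have "Sum_any (dual_comp f) \<in> cvec.span (\<Union>n. wt_space V M' n)"
        using dual_comp_wt[OF f]
        by (intro subspace_Sum_any[OF cvec.subspace_span] cvec.span_base) auto
      then show "f \<in> cvec.span (\<Union>n. wt_space V M' n)"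
        by (simp add: Sum_any_dual_comp[OF f])
    qed
  qed
  show "\<exists>N. \<forall>n\<ge>N. vop M' v n w = 0" if "w \<in> vspace M'" for w v
    using that by (rule contragredient_truncation)
  show "vop M' (vacuum V) n f = (if n = -1 then f else 0)" if "f \<in> vspace M'" for f n
    using contragredientD(2)[OF that] linear_on_zero[OF contragredientD(1)[OF that] subspace]
    by (auto simp: fun_eq_iff contragredient_vop adj_op_vacuum)
  show "jacobi_identity V M'" by (rule contragredient_jacobi)
  show "L_derivative V M'"
    unfolding L_derivative_def
  proof (intro allI ballI ext)
    fix v n f w assume f: "f \<in> vspace M'"
    show "vop M' (Lop V (adjoint V) (-1) v) n f w = ((- of_int n) *\<^sub>C vop M' v (n - 1) f) w"
    proof (cases "w \<in> vspace M")
      case True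
      show ?thesis
        unfolding scaleC_fun_apply contragredient_vop adj_op_L_minus_one[OF True]
        using linear_onD(2)[OF contragredientD(1)[OF f] adj_op_closed[OF True]] True by (simp only: if_True)
    qed (simp add: contragredient_vop)
  qed
qed

section \<open>Dual bases, the weight spaces of the contragredient module, and reflexivity\<close>

lemma wt_functional:
  assumes "f \<in> wt_space V M' n" "w \<in> vspace M"
  shows "f w = f (wt_comp V M w n)"
proof -
  have f: "f \<in> vspace M'" "\<And>m w. m \<noteq> n \<Longrightarrow> w \<in> wt_space V M m \<Longrightarrow> f w = 0"
    using assms(1) by (auto simp: contragredient_wt_space)
  have "f w = Sum_any (\<lambda>m. f (wt_comp V M w m))"
    using linear_eq_Sum_wt_comp[OF contragredientD(1)[OF f(1)] assms(2)] .
  also have "\<dots> = f (wt_comp V M w n)"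
    by (rule Sum_any_singleton) (use f(2) wt_comp(1)[OF assms(2)] in blast)
  finally show ?thesis .
qed

lemma dual_basis:
  "\<exists>B e. finite B \<and> cvec.span B = wt_space V M n \<and> (\<forall>b. e b \<in> wt_space V M' n)
    \<and> (\<forall>w\<in>wt_space V M n. (\<Sum>b\<in>B. e b w *\<^sub>C b) = w)"
proof -
  obtain B where B: "finite B" "cvec.independent B" "cvec.span B = wt_space V M n"
    using fin_dim[of n] finite_basis by metis
  define e where "e b w = (if w \<in> vspace M then cvec.representation B (wt_comp V M w n) b else 0)" for b w
  have rep: "y \<in> wt_space V M n \<Longrightarrow> cvec.representation B (x + y) b = cvec.representation B x b + cvec.representation B y b"
    "cvec.representation B (c *\<^sub>C x) b = c * cvec.representation B x b"
    if "x \<in> wt_space V M n" for x y b c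
    using that B by (auto simp: cvec.representation_add cvec.representation_scale)
  have 0: "e b w = 0" if "w \<in> wt_space V M m" "m \<noteq> n" for b m w
    using that wt_comp_wt[OF that(1)] by (simp add: e_def cvec.representation_zero)
  have "finite {m. \<exists>w\<in>wt_space V M m. e b w \<noteq> 0}" for b
    by (rule finite_subset[of _ "{n}"]) (use 0 in auto)
  moreover have "linear_on (vspace M) (e b)" for b
    using subspace wt_comp(1) rep
    by (auto simp: linear_on_def e_def cvec.subspace_def linear_onD[OF wt_comp_linear] scaleC_complex_def)
  ultimately have "e b \<in> vspace M'" for b
    by (simp add: contragredient_vspace e_def)
  then have "e b \<in> wt_space V M' n" for b
    unfolding contragredient_wt_space using 0 by blast
  moreover have "(\<Sum>b\<in>B. e b w *\<^sub>C b) = w" if "w \<in> wt_space V M n" for w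
    using cvec.sum_representation_eq[OF B(2) _ B(1) subset_refl, of w] that B(3) wt_in_vspace[OF that]
    by (simp add: e_def wt_comp_wt[OF that])
  ultimately show ?thesis
    using B by blast
qed

theorem contragredient_vmodule: "vmodule V M'"
proof -
  interpret C: generalized_module V M' by (rule contragredient_generalized_module)
  show ?thesis
  proof
    fix n
    obtain B e where B: "finite B" "cvec.span B = wt_space V M n" "\<And>b. e b \<in> wt_space V M' n"
      "\<And>w. w \<in> wt_space V M n \<Longrightarrow> (\<Sum>b\<in>B. e b w *\<^sub>C b) = w"
      using dual_basis[of n] by metis
    have "f \<in> cvec.span (e ` B)" if f: "f \<in> wt_space V M' n" for f
    proof -
      have f': "f \<in> vspace M'"
        using f by (rule C.wt_in_vspace)
      have "f = (\<Sum>b\<in>B. f b *\<^sub>C e b)"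
      proof (rule contragredient_eqI[OF f'])
        show "(\<Sum>b\<in>B. f b *\<^sub>C e b) \<in> vspace M'"
          using B(3) by (intro cvec.subspace_sum[OF contragredient_subspace]
            cvec.subspace_scale[OF contragredient_subspace] C.wt_in_vspace)
        fix w assume w: "w \<in> vspace M"
        let ?w = "wt_comp V M w n"
        have b: "b \<in> vspace M" if "b \<in> B" for b
          using that B(2) wt_in_vspace cvec.span_base by metis
        have "f w = f (\<Sum>b\<in>B. e b ?w *\<^sub>C b)"
          using B(4)[OF wt_comp(1)[OF w]] wt_functional[OF f w] by simp
        also have "\<dots> = (\<Sum>b\<in>B. e b ?w * f b)"
          using linear_on_sum[OF contragredientD(1)[OF f'] subspace, of B "\<lambda>b. e b ?w *\<^sub>C b"] b
          by (simp add: cvec.subspace_scale[OF subspace] linear_onD(2)[OF contragredientD(1)[OF f']] scaleC_complex_def)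
        also have "\<dots> = (\<Sum>b\<in>B. f b *\<^sub>C e b) w"
          unfolding sum_fun_apply
          by (intro sum.cong refl) (simp add: wt_functional[OF B(3) w] scaleC_complex_def)
        finally show "f w = (\<Sum>b\<in>B. f b *\<^sub>C e b) w" .
      qed
      also have "\<dots> \<in> cvec.span (e ` B)"
        by (intro cvec.span_sum cvec.span_scale cvec.span_base) auto
      finally show ?thesis .
    qed
    moreover have "cvec.span (e ` B) \<subseteq> wt_space V M' n"
      by (rule cvec.span_minimal[OF _ C.wt_subspace]) (use B(3) in auto)
    ultimately have "wt_space V M' n = cvec.span (e ` B)"
      by blast
    with B(1) show "\<exists>B. finite B \<and> wt_space V M' n = cvec.span B"
      by (intro exI[of _ "e ` B"]) auto
  next
    obtain N :: real where N: "\<And>n. Re n < N \<Longrightarrow> wt_space V M n = {0}"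
      using bounded_below by blast
    have "wt_space V M' n = {0}" if "Re n < N" for n
    proof -
      have "f = 0" if f: "f \<in> wt_space V M' n" for f
      proof
        fix w
        have f': "f \<in> vspace M'"
          using f by (rule C.wt_in_vspace)
        show "f w = 0 w"
        proof (cases "w \<in> vspace M")
          case True
          then have "wt_comp V M w n = 0"
            using wt_comp(1)[OF True, of n] N[OF \<open>Re n < N\<close>] by simp
          then show ?thesis
            using wt_functional[OF f True] linear_on_zero[OF contragredientD(1)[OF f'] subspace] by simp
        qed (use contragredientD(2)[OF f'] in simp)
      qed
      then show ?thesis
        using cvec.subspace_0[OF C.wt_subspace] by blast
    qed
    then show "\<exists>N::real. \<forall>n. Re n < N \<longrightarrow> wt_space V M' n = {0}" by blast
  qed
qed

lemma contragredient_wt_comp: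
  assumes "f \<in> vspace M'"
  shows "wt_comp V M' f n = dual_comp f n"
proof -
  interpret C: generalized_module V M' by (rule contragredient_generalized_module)
  show ?thesis
    using C.wt_comp_unique[OF dual_comp_wt[OF assms] finite_dual_comp[OF assms] Sum_any_dual_comp[OF assms]] by simp
qed

lemma contragredient_separates:
  assumes "w \<in> vspace M" "\<And>f. f \<in> vspace M' \<Longrightarrow> f w = 0"
  shows "w = 0"
proof -
  have "wt_comp V M w n = 0" for n
  proof -
    obtain B e where B: "finite B" "cvec.span B = wt_space V M n" "\<And>b. e b \<in> wt_space V M' n"
      "\<And>w. w \<in> wt_space V M n \<Longrightarrow> (\<Sum>b\<in>B. e b w *\<^sub>C b) = w"
      using dual_basis[of n] by metis
    have "e b (wt_comp V M w n) = 0" for b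
      using wt_functional[OF B(3) assms(1)] assms(2)[of "e b"] B(3)[of b] by (simp add: wt_space_def)
    then show ?thesis
      using B(4)[OF wt_comp(1)[OF assms(1), of n]] by simp
  qed
  then show ?thesis
    using wt_comp(3)[OF assms(1)] by simp
qed

text \<open>Reflexivity, proved one weight at a time: evaluations at weight-\<open>n\<close> vectors
  separate the finite-dimensional weight-\<open>n\<close> functionals, so each restriction of \<Phi>
  is such an evaluation. The finite weight support of \<Phi> lets the representing vectors be added
  up.\<close>

lemma double_dual:
  assumes lin: "linear_on (vspace M') \<Phi>" and fin: "finite {n. \<exists>f\<in>wt_space V M' n. \<Phi> f \<noteq> 0}"
  shows "\<exists>w\<in>vspace M. \<forall>f\<in>vspace M'. f w = \<Phi> f"
proof -
  interpret C: vmodule V M' by (rule contragredient_vmodule)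
  have "\<exists>w\<in>wt_space V M n. \<forall>f\<in>wt_space V M' n. f w = \<Phi> f" for n
  proof -
    \<comment> \<open>Setting the value to 0 off the contragredient module makes \<open>ev\<close>
      linear in \<open>w\<close> as a map into all functions, also at arguments \<open>f\<close>
      that are not linear.\<close>
    define ev where "ev w f = (if f \<in> vspace M' then f w else 0)" for w and f :: "'a \<Rightarrow> complex"
    obtain A where A: "finite A" "wt_space V M' n = cvec.span A"
      using C.fin_dim by blast
    have "\<exists>s\<in>ev ` wt_space V M n. \<forall>f\<in>wt_space V M' n. s f = \<Phi> f"
    proof (rule separating_functionals[OF A])
      have "linear_on (wt_space V M n) ev"
        using linear_onD[OF contragredientD(1)] wt_in_vspace
        by (auto simp: linear_on_def ev_def fun_eq_iff)
      then show "cvec.subspace (ev ` wt_space V M n)"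
        using linear_on_span_image[of "wt_space V M n" ev] cvec.subspace_span
        by (metis cvec.span_eq_iff wt_subspace)
    next
      show "linear_on (wt_space V M' n) s" if "s \<in> ev ` wt_space V M n" for s
        using that C.wt_in_vspace cvec.subspace_add[OF contragredient_subspace]
          cvec.subspace_scale[OF contragredient_subspace]
        by (auto simp: linear_on_def ev_def)
    next
      fix f assume f: "f \<in> wt_space V M' n" and 0: "\<And>s. s \<in> ev ` wt_space V M n \<Longrightarrow> s f = 0"
      then have f': "f \<in> vspace M'"
        using C.wt_in_vspace by blast
      have "f w = 0" if "w \<in> wt_space V M n" for w
        using 0[of "ev w"] that f' by (simp add: ev_def)
      then show "f = 0"
        using contragredientD(2)[OF f'] wt_functional[OF f] wt_comp(1) by (metis ext zero_fun_apply)
    next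
      show "linear_on (wt_space V M' n) \<Phi>"
        using lin by (rule linear_on_subset) (auto intro: C.wt_in_vspace)
    qed
    then show ?thesis
      using C.wt_in_vspace by (auto simp: ev_def)
  qed
  then obtain \<omega> where \<omega>: "\<And>n. \<omega> n \<in> wt_space V M n" "\<And>n f. f \<in> wt_space V M' n \<Longrightarrow> f (\<omega> n) = \<Phi> f"
    by metis
  define S where "S = {n. \<exists>f\<in>wt_space V M' n. \<Phi> f \<noteq> 0}"
  have "f (sum \<omega> S) = \<Phi> f" if f: "f \<in> vspace M'" for f
  proof -
    have "f (sum \<omega> S) = (\<Sum>n\<in>S. f (\<omega> n))"
      by (rule linear_on_sum[OF contragredientD(1)[OF f] subspace]) (use \<omega>(1) wt_in_vspace in blast)
    also have "\<dots> = (\<Sum>n\<in>S. \<Phi> (dual_comp f n))"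
    proof (rule sum.cong[OF refl])
      fix n
      show "f (\<omega> n) = \<Phi> (dual_comp f n)"
        using \<omega>(2)[OF dual_comp_wt[OF f], of n] wt_comp_wt[OF \<omega>(1), of n n] wt_in_vspace[OF \<omega>(1), of n]
        by (simp add: dual_comp_def)
    qed
    also have "\<dots> = Sum_any (\<lambda>n. \<Phi> (dual_comp f n))"
      by (rule Sum_any.expand_superset[symmetric])
        (use fin dual_comp_wt[OF f] in \<open>auto simp: S_def\<close>)
    also have "\<dots> = \<Phi> f"
      using linear_on_Sum_any[OF lin contragredient_subspace C.wt_in_vspace[OF dual_comp_wt[OF f]] finite_dual_comp[OF f]]
      by (simp add: Sum_any_dual_comp[OF f])
    finally show ?thesis .
  qed
  moreover have "sum \<omega> S \<in> vspace M"
    using \<omega>(1) by (intro cvec.subspace_sum[OF subspace] wt_in_vspace)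
  ultimately show ?thesis by blast
qed

end

section \<open>Images of modules\<close>

context voa_module
begin

lemma iterate_side_image:
  assumes "linear_on (vspace M) \<phi>" "w \<in> vspace M"
    and "\<And>v n w. w \<in> vspace M \<Longrightarrow> vop N v n (\<phi> w) = \<phi> (vop M v n w)"
  shows "iterate_side V N u v m n l (\<phi> w) = \<phi> (iterate_side V M u v m n l w)"
proof -
  obtain T where "\<And>t. t \<ge> T \<Longrightarrow> vertop V u (l + int t) v = 0"
    using voa.adj.vop_truncation_nat[of v u l] by auto
  then show ?thesis
    unfolding iterate_side_def
    by (subst linear_on_scaled_Sum_any[OF assms(1) subspace _ finite_support_lessThan[of T]])
      (simp_all add: assms(2,3) vop_closed)
qed

lemma product_side_image:
  assumes "linear_on (vspace M) \<phi>" "w \<in> vspace M"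
    and "\<And>v n w. w \<in> vspace M \<Longrightarrow> vop N v n (\<phi> w) = \<phi> (vop M v n w)"
  shows "product_side N u v m n l (\<phi> w) = \<phi> (product_side M u v m n l w)"
proof -
  obtain T1 T2 where T: "\<And>t. t \<ge> T1 \<Longrightarrow> vop M v (n + int t) w = 0" "\<And>t. t \<ge> T2 \<Longrightarrow> vop M u (m + int t) w = 0"
    using vop_truncation_nat[OF assms(2)] by metis
  have "\<phi> (product_side M u v m n l w)
      = \<phi> (Sum_any (\<lambda>i. sgn_binom l i *\<^sub>C vop M u (m + l - int i) (vop M v (n + int i) w)))
      - \<phi> (Sum_any (\<lambda>i. ((-1) powi l * sgn_binom l i) *\<^sub>C vop M v (n + l - int i) (vop M u (m + int i) w)))"
    unfolding product_side_def
    by (intro linear_on_diff[OF assms(1) subspace] subspace_Sum_any[OF subspace]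
        cvec.subspace_scale[OF subspace] vop_closed assms(2))
  moreover have "\<phi> (Sum_any (\<lambda>i. sgn_binom l i *\<^sub>C vop M u (m + l - int i) (vop M v (n + int i) w)))
      = Sum_any (\<lambda>i. sgn_binom l i *\<^sub>C vop N u (m + l - int i) (vop N v (n + int i) (\<phi> w)))"
    by (subst linear_on_scaled_Sum_any[OF assms(1) subspace _ finite_support_lessThan[of T1]])
      (simp_all add: assms(2,3) vop_closed T)
  moreover have "\<phi> (Sum_any (\<lambda>i. ((-1) powi l * sgn_binom l i) *\<^sub>C vop M v (n + l - int i) (vop M u (m + int i) w)))
      = Sum_any (\<lambda>i. ((-1) powi l * sgn_binom l i) *\<^sub>C vop N v (n + l - int i) (vop N u (m + int i) (\<phi> w)))"
    by (subst linear_on_scaled_Sum_any[OF assms(1) subspace _ finite_support_lessThan[of T2]])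
      (simp_all add: assms(2,3) vop_closed T)
  ultimately show ?thesis
    unfolding product_side_def by simp
qed

text \<open>The map \<phi> may have a kernel, and \<open>N\<close> is controlled only on the image.
  The identities among the axioms are transported along \<phi>; by uniqueness of weight components,
  weight spaces map onto weight spaces, which carries over the grading conditions.\<close>

lemma image_vmodule:
  fixes N :: "('v, 'b::complex_vector) vmod"
  assumes lin: "linear_on (vspace M) \<phi>"
    and N: "vspace N = \<phi> ` vspace M"
    and comm: "\<And>v n w. w \<in> vspace M \<Longrightarrow> vop N v n (\<phi> w) = \<phi> (vop M v n w)"
  shows "vmodule V N"
proof -
  have span: "cvec.span (vspace M) = vspace M"
    using subspace by (simp add: cvec.span_eq_iff)
  have sub: "cvec.subspace (vspace N)"
    using linear_on_span_image[of "vspace M" \<phi>] lin cvec.subspace_span by (metis N span)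
  have L0: "Lop V N 0 (\<phi> w) = \<phi> (Lop V M 0 w)" if "w \<in> vspace M" for w
    using comm[OF that] by (simp add: Lop_def)
  have wt: "\<phi> w \<in> wt_space V N n" if "w \<in> wt_space V M n" for w n
    using that L0 N linear_onD(2)[OF lin] by (auto simp: wt_space_def)
  have sum: "Sum_any (\<lambda>n. \<phi> (wt_comp V M w n)) = \<phi> w" if "w \<in> vspace M" for w
    using linear_eq_Sum_wt_comp[OF lin that] by simp
  interpret N: generalized_module V N
  proof
    show "cvec.subspace (vspace N)" by (rule sub)
    show "vop N v n w \<in> vspace N" if "w \<in> vspace N" for w v n
      using that unfolding N by (auto simp: comm vop_closed)
    show "bilinear_on UNIV (vspace N) (\<lambda>v. vop N v n)" for n
      unfolding bilinear_on_def N
    proof (intro conjI ballI)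
      fix b assume "b \<in> \<phi> ` vspace M"
      then obtain w where w: "b = \<phi> w" "w \<in> vspace M" by auto
      show "linear_on UNIV (\<lambda>a. vop N a n b)"
        unfolding w(1) comm[OF w(2)]
        by (rule linear_on_compose[OF vop_linear_left[OF w(2)] lin]) (rule vop_closed[OF w(2)])
    next
      fix v
      have "linear_on (vspace M) (\<lambda>w. \<phi> (vop M v n w))"
        by (rule linear_on_compose[OF vop_linear lin vop_closed])
      then show "linear_on (\<phi> ` vspace M) (vop N v n)"
        using cvec.subspace_add[OF subspace] cvec.subspace_scale[OF subspace]
        by (auto simp: linear_on_def comm simp flip: linear_onD[OF lin])
    qed
    show "vspace N = cvec.span (\<Union>n. wt_space V N n)"
    proof
      show "cvec.span (\<Union>n. wt_space V N n) \<subseteq> vspace N"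
        by (rule cvec.span_minimal[OF _ sub]) (auto simp: wt_space_def)
      show "vspace N \<subseteq> cvec.span (\<Union>n. wt_space V N n)"
      proof
        fix y assume "y \<in> vspace N"
        then obtain w where w: "y = \<phi> w" "w \<in> vspace M" using N by auto
        have "Sum_any (\<lambda>n. \<phi> (wt_comp V M w n)) \<in> cvec.span (\<Union>n. wt_space V N n)"
          using wt[OF wt_comp(1)[OF w(2)]]
          by (intro subspace_Sum_any[OF cvec.subspace_span] cvec.span_base) auto
        then show "y \<in> cvec.span (\<Union>n. wt_space V N n)"
          by (simp add: sum[OF w(2)] w(1))
      qed
    qed
    show "\<exists>K. \<forall>n\<ge>K. vop N v n w = 0" if wN: "w \<in> vspace N" for w v
    proof -
      obtain w' where w: "w = \<phi> w'" "w' \<in> vspace M" using wN N by auto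
      show ?thesis
        unfolding w(1) comm[OF w(2)]
        using lower_truncation[OF w(2), of v] linear_on_zero[OF lin subspace] by metis
    qed
    show "vop N (vacuum V) n w = (if n = -1 then w else 0)" if "w \<in> vspace N" for w n
      using that linear_on_zero[OF lin subspace] unfolding N by (auto simp: comm vacuum_property)
    show "jacobi_identity V N"
      unfolding jacobi_identity_iff N
      by (auto simp: iterate_side_image[OF lin _ comm] product_side_image[OF lin _ comm] borcherds)
    show "L_derivative V N"
      unfolding L_derivative_def
    proof (intro allI ballI)
      fix v n w assume "w \<in> vspace N"
      then obtain w' where w: "w = \<phi> w'" "w' \<in> vspace M" using N by auto
      show "vop N (Lop V (adjoint V) (-1) v) n w = (- of_int n) *\<^sub>C vop N v (n - 1) w"
        unfolding w(1) comm[OF w(2)] L_minus_one_mode[OF w(2)]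
        by (rule linear_onD(2)[OF lin vop_closed[OF w(2)]])
    qed
  qed
  have wt_N: "wt_space V N n = \<phi> ` wt_space V M n" for n
  proof
    show "\<phi> ` wt_space V M n \<subseteq> wt_space V N n" using wt by auto
    show "wt_space V N n \<subseteq> \<phi> ` wt_space V M n"
    proof
      fix y assume y: "y \<in> wt_space V N n"
      then obtain w where w: "y = \<phi> w" "w \<in> vspace M" using N by (auto simp: wt_space_def)
      have "wt_comp V N y = (\<lambda>n. \<phi> (wt_comp V M w n))"
      proof (rule N.wt_comp_unique)
        show "finite {n. \<phi> (wt_comp V M w n) \<noteq> 0}"
          by (rule finite_subset[OF _ wt_comp(2)[OF w(2)]]) (use linear_on_zero[OF lin subspace] in auto)
      qed (use wt wt_comp(1)[OF w(2)] sum[OF w(2)] w(1) in auto)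
      then have "y = \<phi> (wt_comp V M w n)"
        using N.wt_comp_wt[OF y, of n] by simp
      then show "y \<in> \<phi> ` wt_space V M n"
        using wt_comp(1)[OF w(2)] by blast
    qed
  qed
  show ?thesis
  proof
    fix n
    obtain A where A: "finite A" "wt_space V M n = cvec.span A"
      using fin_dim by blast
    have "wt_space V N n = cvec.span (\<phi> ` A)"
      unfolding wt_N A(2)
      by (rule linear_on_span_image) (use A(2) lin wt_in_vspace in \<open>blast intro: linear_on_subset\<close>)
    with A(1) show "\<exists>B. finite B \<and> wt_space V N n = cvec.span B" by blast
    show "\<exists>K::real. \<forall>n. Re n < K \<longrightarrow> wt_space V N n = {0}"
      using bounded_below linear_on_zero[OF lin subspace] unfolding wt_N by fastforce
  qed
qed

section \<open>The pairing of the contragredient module with the completion\<close>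

lemma contragredient_voa_module: "voa_module V M'"
  by (intro voa_module.intro voa_gmodule.intro contragredient_vmodule
      contragredient_generalized_module voa.vertex_operator_algebra_axioms)

text \<open>The modes of the contragredient module are transposes of Y*, so their opposites are
  transposes of Y** = Y.\<close>

lemma vop_transpose:
  assumes f: "f \<in> vspace M'" and w: "w \<in> vspace M"
  shows "f (vop M v q w) = adj_op V M' v q f w"
proof -
  interpret C: voa_module V M' by (rule contragredient_voa_module)
  have "adj_op V M' v q f w = Sum_any (\<lambda>k. vop M' (opp V v k) (- k - q - 2) f w)"
    unfolding adj_op_eq by (rule Sum_any_fun_apply[OF C.finite_adj_op_support[OF f]])
  also have "\<dots> = Sum_any (\<lambda>k. f (adj_op V M (opp V v k) (- k - q - 2) w))"
    using w by (simp add: contragredient_vop)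
  also have "\<dots> = f (Sum_any (\<lambda>k. adj_op V M (opp V v k) (- k - q - 2) w))"
  proof (rule linear_on_Sum_any[OF contragredientD(1)[OF f] subspace, symmetric])
    show "finite {k. adj_op V M (opp V v k) (- k - q - 2) w \<noteq> 0}"
      by (rule finite_subset[OF _ voa.finite_opp[of v]]) (use w in auto)
  qed (use adj_op_closed[OF w] in auto)
  finally show ?thesis
    by (simp add: adj_op_involution[OF w])
qed

text \<open>A mode is a finite sum of operators that shift the weight by a constant. The set
  \<open>S\<close> of shifts does not depend on the vector, which is what makes
  \<open>extend_op\<close> a finite sum.\<close>

lemma mode_weights:
  "\<exists>S. finite S \<and> (\<forall>\<mu> \<nu>. \<forall>w\<in>wt_space V M \<mu>. \<nu> - \<mu> \<notin> S \<longrightarrow> wt_comp V M (vop M v n w) \<nu> = 0)"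
proof -
  define P where "P v S \<longleftrightarrow> (\<forall>\<mu> \<nu>. \<forall>w\<in>wt_space V M \<mu>. \<nu> - \<mu> \<notin> S \<longrightarrow> wt_comp V M (vop M v n w) \<nu> = 0)" for v S
  have lin: "linear_on UNIV (\<lambda>v. wt_comp V M (vop M v n w) \<nu>)" if "w \<in> wt_space V M \<mu>" for w \<mu> \<nu>
    using wt_in_vspace[OF that] by (intro linear_on_compose[OF vop_linear_left wt_comp_linear] vop_closed)
  have "\<exists>S. finite S \<and> P v S"
  proof (rule voa.homogeneous_induct)
    show "cvec.subspace {v. \<exists>S. finite S \<and> P v S}"
      unfolding cvec.subspace_def mem_Collect_eq
    proof (intro conjI ballI allI)
      show "\<exists>S. finite S \<and> P 0 S"
        using linear_on_zero[OF lin cvec.subspace_UNIV] by (intro exI[of _ "{}"]) (simp add: P_def)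
    next
      fix u v assume "u \<in> {v. \<exists>S. finite S \<and> P v S}" "v \<in> {v. \<exists>S. finite S \<and> P v S}"
      then obtain S1 S2 where S: "finite S1" "P u S1" "finite S2" "P v S2"
        by blast
      then have "P (u + v) (S1 \<union> S2)"
        by (auto simp: P_def linear_onD(1)[OF lin])
      with S show "\<exists>S. finite S \<and> P (u + v) S"
        by (intro exI[of _ "S1 \<union> S2"]) simp
    next
      fix c v assume "v \<in> {v. \<exists>S. finite S \<and> P v S}"
      then show "\<exists>S. finite S \<and> P (c *\<^sub>C v) S"
        by (auto simp: P_def linear_onD(2)[OF lin])
    qed
    fix h v assume v: "v \<in> wt_space V (adjoint V) (of_int h)"
    have "P v {of_int h - of_int n - 1}"
      unfolding P_def
    proof (intro allI ballI impI)
      fix \<mu> \<nu> w assume w: "w \<in> wt_space V M \<mu>" "\<nu> - \<mu> \<notin> {of_int h - of_int n - 1}"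
      then have "\<nu> \<noteq> \<mu> + of_int h - of_int n - 1" by auto
      then show "wt_comp V M (vop M v n w) \<nu> = 0"
        using wt_comp_wt[OF vop_wt[OF w(1) v, of n], of \<nu>] by simp
    qed
    then show "\<exists>S. finite S \<and> P v S"
      by blast
  qed
  then show ?thesis
    by (simp add: P_def)
qed

lemma completionD: "x \<in> completion V M \<Longrightarrow> x n \<in> wt_space V M n"
  by (simp add: completion_def)

lemma finite_extend_op:
  assumes "x \<in> completion V M"
  shows "finite {m. wt_comp V M (vop M v q (x m)) n \<noteq> 0}"
proof -
  obtain S where S: "finite S"
    "\<And>\<mu> \<nu> w. w \<in> wt_space V M \<mu> \<Longrightarrow> \<nu> - \<mu> \<notin> S \<Longrightarrow> wt_comp V M (vop M v q w) \<nu> = 0"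
    using mode_weights[of v q] by metis
  have "m \<in> (\<lambda>s. n - s) ` S" if "wt_comp V M (vop M v q (x m)) n \<noteq> 0" for m
  proof (rule image_eqI[of _ _ "n - m"])
    show "n - m \<in> S"
      using S(2)[OF completionD[OF assms], of n m] that by blast
  qed simp
  then have "{m. wt_comp V M (vop M v q (x m)) n \<noteq> 0} \<subseteq> (\<lambda>s. n - s) ` S"
    by blast
  then show ?thesis
    by (rule finite_subset) (use S(1) in simp)
qed

lemma extend_op_wt:
  assumes "x \<in> completion V M"
  shows "extend_op V M (vop M v q) x n \<in> wt_space V M n"
  unfolding extend_op_def
  by (rule subspace_Sum_any[OF wt_subspace]) (intro wt_comp(1) vop_closed wt_in_vspace[OF completionD[OF assms]])

lemma linear_extend_op:
  assumes "x \<in> completion V M"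
  shows "linear_on UNIV (\<lambda>v. extend_op V M (vop M v q) x n)"
  unfolding extend_op_def
proof (rule linear_on_Sum_any_fun)
  show "linear_on UNIV (\<lambda>v. wt_comp V M (vop M v q (x m)) n)" for m
    using wt_in_vspace[OF completionD[OF assms]]
    by (intro linear_on_compose[OF vop_linear_left wt_comp_linear] vop_closed)
qed (rule finite_extend_op[OF assms])

text \<open>A homogeneous \<open>v\<close> reaches the fixed weight \<open>n\<close> from weight n -
  h + q + 1 only, and for very negative \<open>q\<close> that weight space is zero. This makes the
  left side of the intertwining identity a finite sum in each weight.\<close>

lemma extend_op_truncation:
  assumes x: "x \<in> completion V M"
  shows "\<exists>Q. \<forall>q\<le>Q. extend_op V M (vop M v q) x n = 0"
proof (rule voa.homogeneous_induct)
  note lin = linear_extend_op[OF x]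
  show "cvec.subspace {v. \<exists>Q. \<forall>q\<le>Q. extend_op V M (vop M v q) x n = 0}"
    unfolding cvec.subspace_def mem_Collect_eq
  proof (intro conjI ballI allI)
    show "\<exists>Q. \<forall>q\<le>Q. extend_op V M (vop M 0 q) x n = 0"
      using linear_on_zero[OF lin cvec.subspace_UNIV] by simp
  next
    fix u v assume "u \<in> {v. \<exists>Q. \<forall>q\<le>Q. extend_op V M (vop M v q) x n = 0}"
      "v \<in> {v. \<exists>Q. \<forall>q\<le>Q. extend_op V M (vop M v q) x n = 0}"
    then obtain Q1 Q2 where "\<forall>q\<le>Q1. extend_op V M (vop M u q) x n = 0"
      "\<forall>q\<le>Q2. extend_op V M (vop M v q) x n = 0" by blast
    then show "\<exists>Q. \<forall>q\<le>Q. extend_op V M (vop M (u + v) q) x n = 0"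
      using linear_onD(1)[OF lin] by (intro exI[of _ "min Q1 Q2"]) simp
  next
    fix c v assume "v \<in> {v. \<exists>Q. \<forall>q\<le>Q. extend_op V M (vop M v q) x n = 0}"
    then show "\<exists>Q. \<forall>q\<le>Q. extend_op V M (vop M (c *\<^sub>C v) q) x n = 0"
      using linear_onD(2)[OF lin] by fastforce
  qed
  fix h v assume v: "v \<in> wt_space V (adjoint V) (of_int h)"
  obtain B :: real where B: "\<And>n. Re n < B \<Longrightarrow> wt_space V M n = {0}"
    using bounded_below by blast
  have "wt_comp V M (vop M v q (x m)) n = 0" if q: "q < \<lfloor>B - Re n + of_int h - 1\<rfloor>" for q m
  proof (cases "n = m + of_int h - of_int q - 1")
    case True
    have "of_int q < B - Re n + of_int h - 1"
      using q by linarith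
    with True have "Re m < B" by simp
    then have "x m = 0"
      using B completionD[OF x, of m] by auto
    then show ?thesis
      using linear_on_zero[OF wt_comp_linear subspace] by simp
  next
    case False
    then show ?thesis
      using wt_comp_wt[OF vop_wt[OF completionD[OF x] v]] by simp
  qed
  then show "\<exists>Q. \<forall>q\<le>Q. extend_op V M (vop M v q) x n = 0"
    unfolding extend_op_def by (intro exI[of _ "\<lfloor>B - Re n + of_int h - 1\<rfloor> - 1"]) simp
qed

definition pairing :: "('a \<Rightarrow> complex) \<Rightarrow> (complex \<Rightarrow> 'a) \<Rightarrow> complex" where
  "pairing f x = Sum_any (\<lambda>n. f (x n))"

lemma finite_pairing:
  assumes "f \<in> vspace M'" "\<And>n. x n \<in> wt_space V M n"
  shows "finite {n. f (x n) \<noteq> 0}"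
  by (rule finite_subset[OF _ contragredientD(3)[OF assms(1)]]) (use assms(2) in auto)

lemma linear_pairing:
  assumes "x \<in> completion V M"
  shows "linear_on (vspace M') (\<lambda>f. pairing f x)"
  unfolding pairing_def
proof (rule linear_on_Sum_any_fun)
  show "linear_on (vspace M') (\<lambda>f. f (x n))" for n
    by (simp add: linear_on_def)
  show "finite {n. f (x n) \<noteq> 0}" if "f \<in> vspace M'" for f
    using finite_pairing[OF that completionD[OF assms]] .
qed

lemma linear_pairing_right:
  assumes "f \<in> vspace M'"
  shows "linear_on (completion V M) (pairing f)"
proof -
  note lin = linear_onD[OF contragredientD(1)[OF assms]]
  have x: "x n \<in> vspace M" if "x \<in> completion V M" for x n
    using that completionD wt_in_vspace by blast
  have "finite {n. f (x n) \<noteq> 0}" if "x \<in> completion V M" for x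
    using finite_pairing[OF assms] completionD[OF that] by blast
  then show ?thesis
    unfolding linear_on_def pairing_def
    by (auto simp: lin x Sum_any.distrib Sum_any_scaleC)
qed

lemma pairing_wt:
  assumes "f \<in> wt_space V M' n" "x \<in> completion V M"
  shows "pairing f x = f (x n)"
  unfolding pairing_def
  by (rule Sum_any_singleton) (use assms completionD in \<open>auto simp: contragredient_wt_space\<close>)

lemma pairing_dual_comp:
  assumes "f \<in> vspace M'" "x \<in> completion V M"
  shows "pairing (dual_comp f n) x = f (x n)"
  using pairing_wt[OF dual_comp_wt[OF assms(1)] assms(2)] wt_in_vspace[OF completionD[OF assms(2)]]
  by (simp add: dual_comp_def wt_comp_wt[OF completionD[OF assms(2)]])

text \<open>Extends \<open>vop_transpose\<close> to the completion. The sum over target and source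
  weights is finite because \<open>f\<close> sees finitely many targets and each target is reached
  from finitely many sources.\<close>

lemma pairing_extend_op:
  assumes f: "f \<in> vspace M'" and x: "x \<in> completion V M"
  shows "pairing f (extend_op V M (vop M v q) x) = pairing (adj_op V M' v q f) x"
proof -
  have x': "x m \<in> vspace M" for m
    using wt_in_vspace[OF completionD[OF x]] .
  define g where "g n m = f (wt_comp V M (vop M v q (x m)) n)" for n m
  have f0: "f 0 = 0"
    by (rule linear_on_zero[OF contragredientD(1)[OF f] subspace])
  have fin: "finite {(n, m). g n m \<noteq> 0}"
  proof -
    let ?S = "{n. \<exists>w\<in>wt_space V M n. f w \<noteq> 0}"
    have "{(n, m). g n m \<noteq> 0} \<subseteq> Sigma ?S (\<lambda>n. {m. wt_comp V M (vop M v q (x m)) n \<noteq> 0})"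
      using wt_comp(1)[OF vop_closed[OF x']] by (auto simp: g_def f0)
    then show ?thesis
      by (rule finite_subset) (use contragredientD(3)[OF f] finite_extend_op[OF x] in auto)
  qed
  have "pairing f (extend_op V M (vop M v q) x) = Sum_any (\<lambda>n. Sum_any (g n))"
    unfolding pairing_def extend_op_def g_def
    by (subst linear_on_Sum_any[OF contragredientD(1)[OF f] subspace wt_comp_vspace[OF vop_closed[OF x']] finite_extend_op[OF x]])
      (rule refl)
  also have "\<dots> = Sum_any (\<lambda>m. Sum_any (\<lambda>n. g n m))"
    by (rule Sum_any_swap[OF fin])
  also have "\<dots> = Sum_any (\<lambda>m. f (vop M v q (x m)))"
    unfolding g_def by (simp flip: linear_eq_Sum_wt_comp[OF contragredientD(1)[OF f] vop_closed[OF x']])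
  also have "\<dots> = pairing (adj_op V M' v q f) x"
    unfolding pairing_def by (simp add: vop_transpose[OF f x'])
  finally show ?thesis .
qed

end

section \<open>Intertwining maps and the action on the dual of the tensor product\<close>

text \<open>The coefficients of the \<open>i\<close>-th terms of the three delta functions of the intertwining identity,
  at \<open>x\<^sub>0\<^sup>a x\<^sub>1\<^sup>b\<close>.\<close>

definition coeff_left :: "complex \<Rightarrow> int \<Rightarrow> nat \<Rightarrow> complex" where
  "coeff_left z a i = sgn_binom (- a - 1) i * z ^ i"

definition coeff_first :: "complex \<Rightarrow> int \<Rightarrow> nat \<Rightarrow> complex" where
  "coeff_first z b i = (of_int (- b - 1) gchoose i) * z powi (- b - 1 - int i)"

definition coeff_second :: "complex \<Rightarrow> int \<Rightarrow> nat \<Rightarrow> complex" where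
  "coeff_second z a i = (-1) powi (a + 1) * sgn_binom (- a - 1) i * z powi (- a - 1 - int i)"

text \<open>The exponent -1 of x_0 is the residue: the delta function on the left contributes just
  1.\<close>

lemma coeff_left_minus_one: "coeff_left z (-1) i = (if i = 0 then 1 else 0)"
  by (simp add: coeff_left_def sgn_binom_0)

lemma Pz_intertwining_map_iff:
  "Pz_intertwining_map V z M1 M2 M3 F \<longleftrightarrow>
     bilinear_on (vspace M1) (vspace M2) F
     \<and> (\<forall>w1\<in>vspace M1. \<forall>w2\<in>vspace M2. F w1 w2 \<in> completion V M3)
     \<and> (\<forall>v. \<forall>w1\<in>vspace M1. \<forall>w2\<in>vspace M2. \<forall>a b n.
          Sum_any (\<lambda>i. coeff_left z a i *\<^sub>C extend_op V M3 (vop M3 v (- a - b - 2 - int i)) (F w1 w2) n)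
          = Sum_any (\<lambda>i. coeff_first z b i *\<^sub>C F (Ycoeff M1 v (a - int i) w1) w2 n)
            + Sum_any (\<lambda>i. coeff_second z a i *\<^sub>C F w1 (Ycoeff M2 v (b - int i) w2) n))"
proof -
  have Y: "Ycoeff M3 v (a + b + 1 + int i) = vop M3 v (- a - b - 2 - int i)" for v a b i
    by (simp add: Ycoeff_def[abs_def] algebra_simps)
  show ?thesis
    unfolding Pz_intertwining_map_def sum_fdelta_Pz sum_fdelta_Pz_first
      sum_fdelta_Pz_second[where H = "\<lambda>p. F _ (Ycoeff M2 _ p _) _"]
      coeff_left_def coeff_first_def coeff_second_def Y ..
qed

locale Pz_setting = voa: vertex_operator_algebra V + A: voa_gmodule V W1 + B: voa_gmodule V W2
  for V :: "'v::complex_vector voa" and z :: complex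
    and W1 :: "('v, 'a::complex_vector) vmod" and W2 :: "('v, 'b::complex_vector) vmod"
begin

abbreviation "DT \<equiv> dual_tensor (vspace W1) (vspace W2)"
abbreviation "tau \<equiv> tau_delta V z W1 W2"

text \<open>The right-hand side of the intertwining identity for a scalar-valued form, before any
  passage to opposite operators.\<close>

definition Pz_rhs :: "'v \<Rightarrow> int \<Rightarrow> int \<Rightarrow> ('a \<Rightarrow> 'b \<Rightarrow> complex) \<Rightarrow> 'a \<Rightarrow> 'b \<Rightarrow> complex" where
  "Pz_rhs v a b f w1 w2 =
     Sum_any (\<lambda>i. coeff_first z b i *\<^sub>C f (Ycoeff W1 v (a - int i) w1) w2)
     + Sum_any (\<lambda>i. coeff_second z a i *\<^sub>C f w1 (Ycoeff W2 v (b - int i) w2))"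

lemma dual_tensorD:
  assumes "f \<in> DT"
  shows "w2 \<in> vspace W2 \<Longrightarrow> linear_on (vspace W1) (\<lambda>w1. f w1 w2)"
    "w1 \<in> vspace W1 \<Longrightarrow> linear_on (vspace W2) (f w1)"
    "w1 \<notin> vspace W1 \<or> w2 \<notin> vspace W2 \<Longrightarrow> f w1 w2 = 0"
  using assms by (auto simp: dual_tensor_def bilinear_on_def)

lemma dual_tensor_eqI:
  assumes "f \<in> DT" "g \<in> DT" "\<And>w1 w2. w1 \<in> vspace W1 \<Longrightarrow> w2 \<in> vspace W2 \<Longrightarrow> f w1 w2 = g w1 w2"
  shows "f = g"
proof (intro ext)
  fix w1 w2
  show "f w1 w2 = g w1 w2"
    using assms(3)[of w1 w2] dual_tensorD(3)[OF assms(1), of w1 w2] dual_tensorD(3)[OF assms(2), of w1 w2]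
    by (cases "w1 \<in> vspace W1 \<and> w2 \<in> vspace W2") auto
qed

lemma dual_tensor_subspace: "cvec.subspace DT"
  unfolding cvec.subspace_def dual_tensor_def bilinear_on_def
  by (auto simp: linear_on_def scaleC_complex_def algebra_simps)

lemma dual_tensor_zero:
  assumes "f \<in> DT"
  shows "f 0 w2 = 0" "f w1 0 = 0"
  using linear_on_zero[OF dual_tensorD(1)[OF assms] A.subspace]
    linear_on_zero[OF dual_tensorD(2)[OF assms] B.subspace] dual_tensorD(3)[OF assms]
  by blast+

lemma Ycoeff_truncation:
  assumes "w1 \<in> vspace W1"
  shows "\<exists>T. \<forall>i\<ge>T. Ycoeff W1 v (a - int i) w1 = 0"
  using A.vop_truncation_nat[OF assms, of v "- a - 1"] by (simp add: Ycoeff_def algebra_simps)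

lemma Ycoeff_truncation':
  assumes "w2 \<in> vspace W2"
  shows "\<exists>T. \<forall>i\<ge>T. Ycoeff W2 v (b - int i) w2 = 0"
  using B.vop_truncation_nat[OF assms, of v "- b - 1"] by (simp add: Ycoeff_def algebra_simps)

lemma finite_Pz_rhs:
  assumes "f \<in> DT" "w1 \<in> vspace W1" "w2 \<in> vspace W2"
  shows "finite {i. c i *\<^sub>C f (Ycoeff W1 v (a - int i) w1) w2 \<noteq> 0}"
    "finite {i. c i *\<^sub>C f w1 (Ycoeff W2 v (b - int i) w2) \<noteq> 0}"
proof -
  obtain T1 T2 where "\<And>i. i \<ge> T1 \<Longrightarrow> Ycoeff W1 v (a - int i) w1 = 0" "\<And>i. i \<ge> T2 \<Longrightarrow> Ycoeff W2 v (b - int i) w2 = 0"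
    using Ycoeff_truncation[OF assms(2)] Ycoeff_truncation'[OF assms(3)] by metis
  then show "finite {i. c i *\<^sub>C f (Ycoeff W1 v (a - int i) w1) w2 \<noteq> 0}"
    "finite {i. c i *\<^sub>C f w1 (Ycoeff W2 v (b - int i) w2) \<noteq> 0}"
    by (intro finite_support_lessThan[of T1] finite_support_lessThan[of T2]; simp add: dual_tensor_zero[OF assms(1)])+
qed

lemma linear_Pz_rhs:
  assumes "f \<in> DT" "w1 \<in> vspace W1" "w2 \<in> vspace W2"
  shows "linear_on UNIV (\<lambda>v. Pz_rhs v a b f w1 w2)"
  unfolding Pz_rhs_def Ycoeff_def
  by (intro linear_on_add_fun linear_on_Sum_any_fun linear_on_scale_fun
      linear_on_compose[OF A.vop_linear_left[OF assms(2)] dual_tensorD(1)[OF assms(1,3)]]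
      linear_on_compose[OF B.vop_linear_left[OF assms(3)] dual_tensorD(2)[OF assms(1,2)]]
      A.vop_closed B.vop_closed assms finite_Pz_rhs[unfolded Ycoeff_def])

lemma linear_Pz_rhs_functional:
  assumes "w1 \<in> vspace W1" "w2 \<in> vspace W2"
  shows "linear_on DT (\<lambda>f. Pz_rhs v a b f w1 w2)"
  unfolding Pz_rhs_def
  by (intro linear_on_add_fun linear_on_Sum_any_fun linear_on_scale_fun finite_Pz_rhs assms)
    (auto simp: linear_on_def)

lemma Pz_rhs_zero:
  "f \<in> DT \<Longrightarrow> w1 \<in> vspace W1 \<Longrightarrow> w2 \<in> vspace W2 \<Longrightarrow> Pz_rhs 0 a b f w1 w2 = 0"
  by (rule linear_on_zero[OF linear_Pz_rhs cvec.subspace_UNIV])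

text \<open>The definition of \<tau> shows the opposite operator explicitly in the first summand and
  hides it in Y* in the second. Summing both over the exponent \<open>k\<close> coming from
  \<open>opp\<close> exhibits the same transform of \<open>Pz_rhs\<close>; inverting x_1 turns its
  exponent b - k into k - b.\<close>

lemma tau_eq:
  assumes f: "f \<in> DT" and w1: "w1 \<in> vspace W1" and w2: "w2 \<in> vspace W2"
  shows "tau v a b f w1 w2 = Sum_any (\<lambda>k. Pz_rhs (opp V v k) a (k - b) f w1 w2)"
proof -
  define P where "P k i = coeff_first z (k - b) i *\<^sub>C f (Ycoeff W1 (opp V v k) (a - int i) w1) w2" for k i
  define Q where "Q k i = coeff_second z a i *\<^sub>C f w1 (Ycoeff W2 (opp V v k) (k - b - int i) w2)" for k i
  have Y0: "Ycoeff W1 0 p w1 = 0" "Ycoeff W2 0 p w2 = 0" for p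
    using w1 w2 by (simp_all add: Ycoeff_def)
  have finP: "finite {(k, i). P k i \<noteq> 0}"
  proof (rule finite_support_iterated[where A = "\<lambda>k. {i. P k i \<noteq> 0}"])
    show "finite {k. {i. P k i \<noteq> 0} \<noteq> {}}"
      by (rule finite_subset[OF _ voa.finite_opp[of v]]) (auto simp: P_def Y0 dual_tensor_zero[OF f])
    show "finite {i. P k i \<noteq> 0}" for k
      unfolding P_def by (rule finite_Pz_rhs[OF f w1 w2])
  qed auto
  have finQ: "finite {(k, i). Q k i \<noteq> 0}"
  proof (rule finite_support_iterated[where A = "\<lambda>k. {i. Q k i \<noteq> 0}"])
    show "finite {k. {i. Q k i \<noteq> 0} \<noteq> {}}"
      by (rule finite_subset[OF _ voa.finite_opp[of v]]) (auto simp: Q_def Y0 dual_tensor_zero[OF f])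
    show "finite {i. Q k i \<noteq> 0}" for k
      unfolding Q_def by (rule finite_Pz_rhs[OF f w1 w2])
  qed auto
  have "Sum_any (\<lambda>(r, k, p). fdelta r (k - b) (a - p) * z powi r * f (Ycoeff W1 (opp V v k) p w1) w2)
      = Sum_any (\<lambda>k. Sum_any (P k))"
  proof -
    let ?g = "\<lambda>(r, k, p). fdelta r (k - b) (a - p) * z powi r * f (Ycoeff W1 (opp V v k) p w1) w2"
    \<comment> \<open>The delta function forces a - p to be some \<open>i\<close> >= 0 and then
      determines \<open>r\<close>.\<close>
    let ?\<phi> = "\<lambda>(k, i). (b - k - 1 - int i, k, a - int i)"
    have "Sum_any ?g = Sum_any (\<lambda>x. ?g (?\<phi> x))"
    proof (rule Sum_any_reindex)
      show "inj ?\<phi>" by (auto simp: inj_def)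
      show "{x. ?g x \<noteq> 0} \<subseteq> range ?\<phi>"
      proof
        fix x assume "x \<in> {x. ?g x \<noteq> 0}"
        moreover obtain r k p where x: "x = (r, k, p)" by (cases x)
        ultimately have "fdelta r (k - b) (a - p) \<noteq> 0" by auto
        from fdelta_support[OF this] show "x \<in> range ?\<phi>"
          by (intro image_eqI[of _ _ "(k, nat (a - p))"]) (auto simp: x)
      qed
    qed
    also have "\<dots> = Sum_any (\<lambda>(k, i). P k i)"
    proof (rule Sum_any.cong)
      fix x :: "int \<times> nat"
      obtain k i where x: "x = (k, i)" by (cases x)
      have "fdelta (b - k - 1 - int i) (k - b) (int i) = of_int (- (k - b) - 1) gchoose i"
        using sgn_binom_flip[of i "- (k - b) - 1"] by (simp add: fdelta_nat algebra_simps)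
      moreover have "- (k - b) - 1 - int i = b - k - 1 - int i" by simp
      ultimately show "?g (?\<phi> x) = (case x of (k, i) \<Rightarrow> P k i)"
        by (simp add: x P_def coeff_first_def scaleC_complex_def)
    qed
    finally show ?thesis
      by (simp only: Sum_any_iterated[OF finP])
  qed
  moreover have "Sum_any (\<lambda>(r, p). fdelta_neg a r (p - b) * z powi r * f w1 (Ystar V W2 v p w2))
      = Sum_any (\<lambda>k. Sum_any (Q k))"
  proof -
    have "Sum_any (\<lambda>(r, p). fdelta_neg a r (p - b) * z powi r * f w1 (Ystar V W2 v p w2))
        = Sum_any (\<lambda>(r, p). (fdelta_neg a r (p - b) * z powi r) *\<^sub>C f w1 (Ystar V W2 v p w2))"
      by (simp add: scaleC_complex_def)
    also have "\<dots> = Sum_any (\<lambda>i. coeff_second z a i *\<^sub>C f w1 (Ystar V W2 v (b + int i) w2))"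
    proof (rule sum_reparam)
      show "\<exists>i::nat. r = - a - 1 - int i \<and> p = b + int i" if "fdelta_neg a r (p - b) * z powi r \<noteq> 0" for r p
        using fdelta_neg_support[of a r "p - b"] that by (intro exI[of _ "nat (p - b)"]) auto
    qed (auto simp: inj_def fdelta_neg_nat coeff_second_def)
    also have "\<dots> = Sum_any (\<lambda>i. Sum_any (\<lambda>k. Q k i))"
    proof (rule Sum_any.cong)
      fix i
      have "f w1 (Ystar V W2 v (b + int i) w2) = Sum_any (\<lambda>k. f w1 (Ycoeff W2 (opp V v k) (k - (b + int i)) w2))"
        unfolding Ystar_def
        by (rule linear_on_Sum_any[OF dual_tensorD(2)[OF f w1] B.subspace])
          (auto simp: Ycoeff_def B.vop_closed w2 B.finite_adj_op_support)
      then show "coeff_second z a i *\<^sub>C f w1 (Ystar V W2 v (b + int i) w2) = Sum_any (\<lambda>k. Q k i)"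
        by (simp add: Q_def Sum_any_scaleC algebra_simps)
    qed
    finally show ?thesis
      by (simp only: Sum_any_swap[OF finQ])
  qed
  ultimately have "tau v a b f w1 w2 = Sum_any (\<lambda>k. Sum_any (P k)) + Sum_any (\<lambda>k. Sum_any (Q k))"
    using w1 w2 by (simp add: tau_delta_def)
  also have "\<dots> = Sum_any (\<lambda>k. Sum_any (P k) + Sum_any (Q k))"
    by (rule Sum_any.distrib[symmetric]; rule finite_subset[OF _ voa.finite_opp[of v]])
      (auto simp: P_def Q_def Y0 dual_tensor_zero[OF f])
  finally show ?thesis
    by (simp add: Pz_rhs_def P_def Q_def)
qed

lemma tau_off: "w1 \<notin> vspace W1 \<or> w2 \<notin> vspace W2 \<Longrightarrow> tau v a b f w1 w2 = 0"
  by (auto simp: tau_delta_def)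

lemma linear_tau: "linear_on DT (tau v a b)"
proof -
  have "linear_on DT (\<lambda>f. tau v a b f w1 w2)" for w1 w2
  proof (cases "w1 \<in> vspace W1 \<and> w2 \<in> vspace W2")
    case True
    then have w: "w1 \<in> vspace W1" "w2 \<in> vspace W2" by auto
    have "linear_on DT (\<lambda>f. Sum_any (\<lambda>k. Pz_rhs (opp V v k) a (k - b) f w1 w2))"
    proof (rule linear_on_Sum_any_fun[OF linear_Pz_rhs_functional[OF w]])
      show "finite {k. Pz_rhs (opp V v k) a (k - b) f w1 w2 \<noteq> 0}" if "f \<in> DT" for f
        by (rule finite_subset[OF _ voa.finite_opp[of v]]) (auto simp: Pz_rhs_zero[OF that w])
    qed
    then show ?thesis
      using tau_eq[OF _ w] cvec.subspace_add[OF dual_tensor_subspace] cvec.subspace_scale[OF dual_tensor_subspace]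
      by (simp add: linear_on_def)
  next
    case False
    then have "tau v a b f w1 w2 = 0" for f
      using tau_off by blast
    then show ?thesis by (simp add: linear_on_def)
  qed
  then show ?thesis
    by (simp add: linear_on_def fun_eq_iff)
qed

section \<open>Compatible functionals and the diamond space\<close>

lemma Pz_compatible_iff:
  "Pz_compatible V z W1 W2 f \<longleftrightarrow> (\<forall>v. (\<exists>N. \<forall>p<N. tau v (-1) p f = 0)
     \<and> (\<forall>a b. tau v a b f = Sum_any (\<lambda>i. coeff_left z a i *\<^sub>C tau v (-1) (b - a - 1 - int i) f)))"
proof -
  have Y: "Ycoeff (Pz_dual V z W1 W2 U) v p f = tau v (-1) p f" for U v p
    by (simp add: Ycoeff_def Pz_dual_def)
  show ?thesis
    unfolding Pz_compatible_def Let_def Y sum_fdelta_Pz_inverse coeff_left_def ..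
qed

lemma finite_tau_modes:
  assumes "\<exists>N. \<forall>p<N. tau v (-1) p f = 0"
  shows "finite {i. c i *\<^sub>C tau v (-1) (b - int i) f \<noteq> 0}"
proof -
  obtain N where "\<And>p. p < N \<Longrightarrow> tau v (-1) p f = 0"
    using assms by blast
  then show ?thesis
    by (intro finite_support_lessThan[of "nat (b - N + 1)"]) auto
qed

text \<open>Both parts of compatibility are linear in \<open>f\<close>. The diamond space is a span
  of compatible modules, so its elements inherit compatibility from this.\<close>

lemma compatible_subspace: "cvec.subspace {f \<in> DT. Pz_compatible V z W1 W2 f}"
proof -
  let ?K = "\<lambda>v a b f i. coeff_left z a i *\<^sub>C tau v (-1) (b - a - 1 - int i) f"
  define T where "T f v \<longleftrightarrow> (\<exists>N. \<forall>p<N. tau v (-1) p f = 0)" for f v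
  define E where "E f v \<longleftrightarrow> (\<forall>a b. tau v a b f = Sum_any (\<lambda>i. ?K v a b f i))" for f v
  note lin = linear_onD[OF linear_tau]
  have tau0: "tau v a b 0 = 0" for v a b
    by (rule linear_on_zero[OF linear_tau dual_tensor_subspace])
  have "T 0 v \<and> E 0 v" for v
    by (simp add: T_def E_def tau0)
  moreover have "T (f + g) v \<and> E (f + g) v"
    if f: "f \<in> DT" "T f v" "E f v" and g: "g \<in> DT" "T g v" "E g v" for f g v
  proof
    obtain N1 N2 where "\<forall>p<N1. tau v (-1) p f = 0" "\<forall>p<N2. tau v (-1) p g = 0"
      using f(2) g(2) by (auto simp: T_def)
    then show "T (f + g) v"
      unfolding T_def by (intro exI[of _ "min N1 N2"]) (simp add: lin f g)
    show "E (f + g) v"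
      unfolding E_def
    proof (intro allI)
      fix a b
      have fin: "finite {i. ?K v a b h i \<noteq> 0}" if "T h v" for h
        using finite_tau_modes that by (simp add: T_def)
      have "tau v a b (f + g) = tau v a b f + tau v a b g"
        by (rule lin(1)[OF f(1) g(1)])
      also have "\<dots> = Sum_any (\<lambda>i. ?K v a b f i)
          + Sum_any (\<lambda>i. ?K v a b g i)"
        using f(3) g(3) unfolding E_def by metis
      also have "\<dots> = Sum_any (\<lambda>i. ?K v a b (f + g) i)"
        unfolding lin(1)[OF f(1) g(1)] scaleC_add_right
        by (rule Sum_any.distrib[symmetric]) (intro fin f g)+
      finally show "tau v a b (f + g) = Sum_any (\<lambda>i. ?K v a b (f + g) i)" .
    qed
  qed
  moreover have "T (c *\<^sub>C f) v \<and> E (c *\<^sub>C f) v" if f: "f \<in> DT" "T f v" "E f v" for f v c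
  proof
    show "T (c *\<^sub>C f) v"
      using f(2) unfolding T_def lin(2)[OF f(1)] by fastforce
    show "E (c *\<^sub>C f) v"
      unfolding E_def
    proof (intro allI)
      fix a b
      have "tau v a b (c *\<^sub>C f) = c *\<^sub>C Sum_any (\<lambda>i. ?K v a b f i)"
        using f(3) unfolding E_def lin(2)[OF f(1)] by metis
      also have "\<dots> = Sum_any (\<lambda>i. ?K v a b (c *\<^sub>C f) i)"
        unfolding lin(2)[OF f(1)] Sum_any_scaleC[symmetric] scaleC_scaleC by (simp only: mult.commute)
      finally show "tau v a b (c *\<^sub>C f) = Sum_any (\<lambda>i. ?K v a b (c *\<^sub>C f) i)" .
    qed
  qed
  ultimately show ?thesis
    using cvec.subspace_0[OF dual_tensor_subspace] cvec.subspace_add[OF dual_tensor_subspace]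
      cvec.subspace_scale[OF dual_tensor_subspace]
    unfolding cvec.subspace_def Pz_compatible_iff T_def[symmetric] E_def[symmetric] by blast
qed

abbreviation "D \<equiv> diamond V z W1 W2"

lemma vop_diamond: "vop D v n f = tau v (-1) (- n - 1) f"
  by (simp add: diamond_def Pz_dual_def)

lemma diamond_vspace_subset: "vspace D \<subseteq> {f \<in> DT. Pz_compatible V z W1 W2 f}"
  unfolding diamond_def Pz_dual_def
  by simp (rule cvec.span_minimal[OF _ compatible_subspace], auto)

lemma compatible_module_subset_diamond:
  assumes "U \<subseteq> DT" "vmodule V (Pz_dual V z W1 W2 U)" "\<And>f. f \<in> U \<Longrightarrow> Pz_compatible V z W1 W2 f"
  shows "U \<subseteq> vspace D"
proof -
  have "U \<subseteq> \<Union>{U. U \<subseteq> DT \<and> vmodule V (Pz_dual V z W1 W2 U) \<and> (\<forall>f\<in>U. Pz_compatible V z W1 W2 f)}"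
    using assms by blast
  then show ?thesis
    unfolding diamond_def Pz_dual_def using cvec.span_superset by (simp add: Pz_dual_def) blast
qed

lemma diamondD:
  assumes "f \<in> vspace D"
  shows "f \<in> DT" "Pz_compatible V z W1 W2 f"
  using assms diamond_vspace_subset by blast+

text \<open>For compatible functionals, inverting \<^const>\<open>opp\<close> in the definition of the action recovers the
  right-hand side of the intertwining identity.\<close>

lemma Pz_rhs_compatible:
  assumes f: "f \<in> DT" "Pz_compatible V z W1 W2 f" and w: "w1 \<in> vspace W1" "w2 \<in> vspace W2"
  shows "Pz_rhs v a b f w1 w2 = Sum_any (\<lambda>i. coeff_left z a i *\<^sub>C
    Sum_any (\<lambda>k. tau (opp V v k) (-1) (k - (a + b + 1 + int i)) f w1 w2))"
proof -
  let ?K = "\<lambda>k i. coeff_left z a i *\<^sub>C tau (opp V v k) (-1) (k - b - a - 1 - int i) f"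
  have compat: "\<exists>N. \<forall>p<N. tau v (-1) p f = 0"
    "tau v a b f = Sum_any (\<lambda>i. coeff_left z a i *\<^sub>C tau v (-1) (b - a - 1 - int i) f)" for v a b
    using f(2) unfolding Pz_compatible_iff by blast+
  \<comment> \<open>The double transform is inserted by \<open>opp_opp\<close>; by
    \<open>tau_eq\<close> the inner sum over \<open>k'\<close> is then \<tau> for
    \<open>opp V v k\<close>, to which compatibility applies.\<close>
  have "Pz_rhs v a b f w1 w2 = Sum_any (\<lambda>k. Sum_any (\<lambda>k'. Pz_rhs (opp V (opp V v k) k') a (k' - k + b) f w1 w2))"
    using voa.opp_opp[of "\<lambda>v d. Pz_rhs v a (d + b) f w1 w2" v] linear_Pz_rhs[OF f(1) w] by simp
  also have "\<dots> = Sum_any (\<lambda>k. tau (opp V v k) a (k - b) f w1 w2)"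
    by (simp add: tau_eq[OF f(1) w] algebra_simps)
  also have "\<dots> = Sum_any (\<lambda>k. Sum_any (\<lambda>i. ?K k i w1 w2))"
  proof (rule Sum_any.cong)
    fix k
    have "tau (opp V v k) a (k - b) f w1 w2
        = Sum_any (\<lambda>i. ?K k i) w1 w2"
      using compat(2) by metis
    also have "\<dots> = Sum_any (\<lambda>i. (?K k i) w1) w2"
      by (subst Sum_any_fun_apply[OF finite_tau_modes[OF compat(1)]]) (rule refl)
    also have "\<dots> = Sum_any (\<lambda>i. (?K k i) w1 w2)"
      by (rule Sum_any_fun_apply, rule finite_subset[OF _ finite_tau_modes[OF compat(1)[of "opp V v k"], where c = "coeff_left z a" and b = "k - b - a - 1"]]) auto
    finally show "tau (opp V v k) a (k - b) f w1 w2
        = Sum_any (\<lambda>i. ?K k i w1 w2)"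
      by simp
  qed
  also have "\<dots> = Sum_any (\<lambda>i. Sum_any (\<lambda>k. ?K k i w1 w2))"
  proof (rule Sum_any_swap, rule finite_support_iterated)
    let ?A = "\<lambda>k. {i. ?K k i w1 w2 \<noteq> 0}"
    have "tau 0 (-1) p f w1 w2 = 0" for p
      by (simp add: tau_eq[OF f(1) w] Pz_rhs_zero[OF f(1) w])
    then show "finite {k. ?A k \<noteq> {}}"
      by (intro finite_subset[OF _ voa.finite_opp[of v]]) auto
    show "finite (?A k)" for k
      by (rule finite_subset[OF _ finite_tau_modes[OF compat(1)[of "opp V v k"], where c = "coeff_left z a" and b = "k - b - a - 1"]]) auto
  qed auto
  finally show ?thesis
    by (simp add: Sum_any_scaleC algebra_simps)
qed

end

section \<open>The canonical map is an intertwining map\<close>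

context voa_module
begin

lemma finite_extend_op_support:
  assumes "x \<in> completion V M"
  shows "finite {i. c i *\<^sub>C extend_op V M (vop M v (q - int i)) x n \<noteq> 0}"
proof -
  obtain Q where "\<And>q. q \<le> Q \<Longrightarrow> extend_op V M (vop M v q) x n = 0"
    using extend_op_truncation[OF assms] by blast
  then show ?thesis
    by (intro finite_support_lessThan[of "nat (q - Q)"]) auto
qed

lemma pairing_Sum_any:
  assumes f: "f \<in> vspace M'" and x: "\<And>i. x i \<in> completion V M" and fin: "\<And>n. finite {i. c i *\<^sub>C x i n \<noteq> 0}"
  shows "pairing f (\<lambda>n. Sum_any (\<lambda>i. c i *\<^sub>C x i n)) = Sum_any (\<lambda>i. c i *\<^sub>C pairing f (x i))"
proof -
  have xV: "x i n \<in> vspace M" for i n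
    using wt_in_vspace[OF completionD[OF x]] .
  note lin = contragredientD(1)[OF f]
  define g where "g n i = f (c i *\<^sub>C x i n)" for n i
  have fin': "finite {(n, i). g n i \<noteq> 0}"
  proof -
    let ?S = "{n. \<exists>w\<in>wt_space V M n. f w \<noteq> 0}"
    have "{(n, i). g n i \<noteq> 0} \<subseteq> Sigma ?S (\<lambda>n. {i. c i *\<^sub>C x i n \<noteq> 0})"
      using cvec.subspace_scale[OF wt_subspace completionD[OF x]] linear_on_zero[OF lin subspace]
      by (auto simp: g_def)
    then show ?thesis
      by (rule finite_subset) (use contragredientD(3)[OF f] fin in auto)
  qed
  have "pairing f (\<lambda>n. Sum_any (\<lambda>i. c i *\<^sub>C x i n)) = Sum_any (\<lambda>n. Sum_any (g n))"
    unfolding pairing_def g_def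
    by (intro Sum_any.cong linear_on_Sum_any[OF lin subspace _ fin] cvec.subspace_scale[OF subspace] xV)
  also have "\<dots> = Sum_any (\<lambda>i. Sum_any (\<lambda>n. g n i))"
    by (rule Sum_any_swap[OF fin'])
  also have "\<dots> = Sum_any (\<lambda>i. c i *\<^sub>C pairing f (x i))"
    unfolding pairing_def g_def by (simp add: linear_onD(2)[OF lin xV] Sum_any_scaleC)
  finally show ?thesis .
qed

lemma extend_op_contragredient:
  assumes x: "x \<in> completion V M'" and f: "f \<in> vspace M"
  shows "extend_op V M' (vop M' v q) x n f = Sum_any (\<lambda>m. x m (adj_op V M v q (wt_comp V M f n)))"
proof -
  interpret C: voa_module V M' by (rule contragredient_voa_module)
  have x': "vop M' v q (x m) \<in> vspace M'" for m
    by (rule C.vop_closed[OF C.wt_in_vspace[OF C.completionD[OF x]]])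
  have "extend_op V M' (vop M' v q) x n f = Sum_any (\<lambda>m. wt_comp V M' (vop M' v q (x m)) n f)"
    unfolding extend_op_def by (rule Sum_any_fun_apply[OF C.finite_extend_op[OF x]])
  also have "\<dots> = Sum_any (\<lambda>m. x m (adj_op V M v q (wt_comp V M f n)))"
    using f wt_comp_vspace[OF f]
    by (simp add: contragredient_wt_comp[OF x'] dual_comp_def contragredient_vop)
  finally show ?thesis .
qed

end

context Pz_setting
begin

abbreviation "F \<equiv> boxtimes_map V z W1 W2"

lemma diamond_voa_module: "vmodule V D \<Longrightarrow> voa_module V D"
  by (intro voa_module.intro voa_gmodule.intro vmodule.axioms(1) voa.vertex_operator_algebra_axioms)

lemma boxtimes_map_apply:
  "f \<in> vspace D \<Longrightarrow> F w1 w2 n f = wt_comp V D f n w1 w2"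
  by (simp add: boxtimes_map_def)

lemma boxtimes_map_completion:
  assumes "vmodule V D"
  shows "F w1 w2 \<in> completion V (contragredient V D)"
proof -
  interpret D: voa_module V D
    by (rule diamond_voa_module[OF assms])
  have "F w1 w2 n \<in> wt_space V D.M' n" for n
  proof -
    have 0: "F w1 w2 n f = 0" if "m \<noteq> n" "f \<in> wt_space V D m" for m f
      using that D.wt_in_vspace[OF that(2)] by (simp add: boxtimes_map_apply D.wt_comp_wt[OF that(2)])
    have "linear_on (vspace D) (F w1 w2 n)"
      using cvec.subspace_add[OF D.subspace] cvec.subspace_scale[OF D.subspace]
      by (simp add: linear_on_def boxtimes_map_apply linear_onD[OF D.wt_comp_linear])
    moreover have "finite {m. \<exists>f\<in>wt_space V D m. F w1 w2 n f \<noteq> 0}"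
      by (rule finite_subset[of _ "{n}"]) (use 0 in auto)
    ultimately have "F w1 w2 n \<in> vspace D.M'"
      by (simp add: contragredient_vspace boxtimes_map_def)
    then show ?thesis
      using 0 by (simp add: D.contragredient_wt_space)
  qed
  then show ?thesis
    by (simp add: completion_def)
qed

lemma boxtimes_map_intertwining:
  assumes "vmodule V D"
  shows "Pz_intertwining_map V z W1 W2 (contragredient V D) F"
proof -
  interpret D: voa_module V D
    by (rule diamond_voa_module[OF assms])
  interpret C: voa_module V D.M' by (rule D.contragredient_voa_module)
  have comp: "wt_comp V D f n \<in> DT" "Pz_compatible V z W1 W2 (wt_comp V D f n)" if "f \<in> vspace D" for f n
    using diamondD[OF D.wt_comp_vspace[OF that]] .
  note F_completion = boxtimes_map_completion[OF assms]
  have bilinear: "bilinear_on (vspace W1) (vspace W2) F"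
    unfolding bilinear_on_def
  proof (intro conjI ballI)
    fix w2 assume w2: "w2 \<in> vspace W2"
    show "linear_on (vspace W1) (\<lambda>w1. F w1 w2)"
      using linear_onD[OF dual_tensorD(1)[OF comp(1) w2]]
      by (auto simp: linear_on_def fun_eq_iff boxtimes_map_def scaleC_complex_def)
  next
    fix w1 assume w1: "w1 \<in> vspace W1"
    show "linear_on (vspace W2) (F w1)"
      using linear_onD[OF dual_tensorD(2)[OF comp(1) w1]]
      by (auto simp: linear_on_def fun_eq_iff boxtimes_map_def scaleC_complex_def)
  qed
  have identity: "Sum_any (\<lambda>i. coeff_left z a i *\<^sub>C extend_op V D.M' (vop D.M' v (- a - b - 2 - int i)) (F w1 w2) n)
      = Sum_any (\<lambda>i. coeff_first z b i *\<^sub>C F (Ycoeff W1 v (a - int i) w1) w2 n)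
        + Sum_any (\<lambda>i. coeff_second z a i *\<^sub>C F w1 (Ycoeff W2 v (b - int i) w2) n)" (is "?L = ?R1 + ?R2")
    if w: "w1 \<in> vspace W1" "w2 \<in> vspace W2" for v w1 w2 a b n
  proof
    fix f
    let ?e = "\<lambda>i. extend_op V D.M' (vop D.M' v (- a - b - 2 - int i)) (F w1 w2) n"
    have L: "?L f = Sum_any (\<lambda>i. coeff_left z a i *\<^sub>C ?e i f)"
      by (subst Sum_any_fun_apply[OF C.finite_extend_op_support[OF F_completion]]) simp
    obtain T1 T2 where T: "\<And>i. i \<ge> T1 \<Longrightarrow> Ycoeff W1 v (a - int i) w1 = 0" "\<And>i. i \<ge> T2 \<Longrightarrow> Ycoeff W2 v (b - int i) w2 = 0"
      using Ycoeff_truncation[OF w(1)] Ycoeff_truncation'[OF w(2)] by metis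
    have F0: "F 0 w2 n = 0" "F w1 0 n = 0"
      using dual_tensor_zero[OF comp(1)] by (auto simp: fun_eq_iff boxtimes_map_def)
    have R1: "?R1 f = Sum_any (\<lambda>i. coeff_first z b i *\<^sub>C F (Ycoeff W1 v (a - int i) w1) w2 n f)"
      by (subst Sum_any_fun_apply[OF finite_support_lessThan[of T1]]) (simp_all add: T F0)
    have R2: "?R2 f = Sum_any (\<lambda>i. coeff_second z a i *\<^sub>C F w1 (Ycoeff W2 v (b - int i) w2) n f)"
      by (subst Sum_any_fun_apply[OF finite_support_lessThan[of T2]]) (simp_all add: T F0)
    show "?L f = (?R1 + ?R2) f"
    proof (cases "f \<in> vspace D")
      case True
      let ?g = "wt_comp V D f n"
      have g: "?g \<in> vspace D" by (rule D.wt_comp_vspace[OF True])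
      have e: "?e i f = Sum_any (\<lambda>k. tau (opp V v k) (-1) (k - (a + b + 1 + int i)) ?g w1 w2)" for i
      proof -
        \<comment> \<open>The weight-\<open>n\<close> part of the left side sees only the component
          of \<open>f\<close> of weight \<open>n\<close>. Transposing the mode onto it and summing
          over all weights \<open>m\<close> pairs the canonical map with \<open>?h\<close>, that is,
          evaluates \<open>?h\<close> at \<open>w1\<close> and \<open>w2\<close>.\<close>
        let ?h = "adj_op V D v (- a - b - 2 - int i) ?g"
        have "?e i f = Sum_any (\<lambda>m. F w1 w2 m ?h)"
          by (rule D.extend_op_contragredient[OF F_completion True])
        also have "\<dots> = ?h w1 w2"
          by (rule boxtimes_map_pairing[OF assms D.adj_op_closed[OF g]])
        also have "\<dots> = Sum_any (\<lambda>k. vop D (opp V v k) (- k - (- a - b - 2 - int i) - 2) ?g w1) w2"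
          unfolding adj_op_eq by (subst Sum_any_fun_apply[OF D.finite_adj_op_support[OF g]]) (rule refl)
        also have "\<dots> = Sum_any (\<lambda>k. vop D (opp V v k) (- k - (- a - b - 2 - int i) - 2) ?g w1 w2)"
          by (rule Sum_any_fun_apply, rule finite_subset[OF _ voa.finite_opp[of v]]) (use g in auto)
        finally show ?thesis
          by (simp add: vop_diamond algebra_simps)
      qed
      have "?L f = Pz_rhs v a b ?g w1 w2"
        unfolding L e Pz_rhs_compatible[OF comp[OF True] w] ..
      then show ?thesis
        unfolding plus_fun_apply R1 R2 Pz_rhs_def by (simp add: boxtimes_map_apply True)
    next
      case False
      \<comment> \<open>Functionals on the diamond space are normalised to vanish off it, so the
        identity has to be checked there too, where every term is 0.\<close>
      have "?e i f = 0" for i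
      proof -
        have "?e i \<in> vspace D.M'"
          by (rule C.wt_in_vspace[OF C.extend_op_wt[OF F_completion]])
        then show ?thesis
          using D.contragredientD(2) False by blast
      qed
      with False show ?thesis
        unfolding plus_fun_apply L R1 R2 by (simp add: boxtimes_map_def)
    qed
  qed
  show ?thesis
    unfolding Pz_intertwining_map_iff using bilinear F_completion identity by blast
qed

lemma boxtimes_map_span:
  assumes "vmodule V D" and \<phi>: "\<phi> \<in> wt_space V (contragredient V D) n"
  shows "\<phi> \<in> cvec.span {F w1 w2 n | w1 w2. w1 \<in> vspace W1 \<and> w2 \<in> vspace W2}"
proof -
  interpret D: voa_module V D
    by (rule diamond_voa_module[OF assms(1)])
  interpret C: voa_module V D.M' by (rule D.contragredient_voa_module)
  define S where "S = cvec.span {F w1 w2 n | w1 w2. w1 \<in> vspace W1 \<and> w2 \<in> vspace W2}"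
  have S: "S \<subseteq> wt_space V D.M' n"
    unfolding S_def using boxtimes_map_completion[OF assms(1)]
    by (intro cvec.span_minimal[OF _ C.wt_subspace]) (auto simp: completion_def)
  obtain A where A: "finite A" "wt_space V D n = cvec.span A"
    using D.fin_dim by blast
  have "\<exists>s\<in>S. \<forall>f\<in>wt_space V D n. s f = \<phi> f"
  proof (rule separating_functionals[OF A])
    show "cvec.subspace S"
      unfolding S_def by (rule cvec.subspace_span)
    have lin: "linear_on (wt_space V D n) s" if "s \<in> wt_space V D.M' n" for s
      using D.contragredientD(1)[OF C.wt_in_vspace[OF that]] by (rule linear_on_subset) (auto intro: D.wt_in_vspace)
    then show "linear_on (wt_space V D n) s" if "s \<in> S" for s
      using that S by blast
    show "linear_on (wt_space V D n) \<phi>"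
      by (rule lin[OF \<phi>])
    fix f assume f: "f \<in> wt_space V D n" and 0: "\<And>s. s \<in> S \<Longrightarrow> s f = 0"
    \<comment> \<open>On \<open>f\<close> of weight \<open>n\<close>, the component
      \<open>F w1 w2 n\<close> is evaluation at \<open>w1\<close> and \<open>w2\<close>.\<close>
    have "f w1 w2 = 0" if w: "w1 \<in> vspace W1" "w2 \<in> vspace W2" for w1 w2
    proof -
      have "F w1 w2 n \<in> S"
        unfolding S_def using w by (intro cvec.span_base) blast
      from 0[OF this] show ?thesis
        using D.wt_in_vspace[OF f] by (simp add: boxtimes_map_apply D.wt_comp_wt[OF f])
    qed
    then show "f = 0"
      using diamondD(1)[OF D.wt_in_vspace[OF f]] cvec.subspace_0[OF dual_tensor_subspace]
      by (intro dual_tensor_eqI) auto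
  qed
  then obtain s where s: "s \<in> S" "\<And>f. f \<in> wt_space V D n \<Longrightarrow> s f = \<phi> f"
    by blast
  have s': "s \<in> wt_space V D.M' n"
    using s(1) S by blast
  have "s = \<phi>"
  proof (rule D.contragredient_eqI[OF C.wt_in_vspace[OF s'] C.wt_in_vspace[OF \<phi>]])
    fix f assume f: "f \<in> vspace D"
    show "s f = \<phi> f"
      using D.wt_functional[OF s' f] D.wt_functional[OF \<phi> f] s(2)[OF D.wt_comp(1)[OF f]] by simp
  qed
  with s(1) show ?thesis
    by (simp add: S_def)
qed

end

section \<open>The universal property\<close>

locale Pz_product_setting = Pz_setting V z W1 W2 + M: voa_module V M4
  for V :: "'v::complex_vector voa" and z :: complex
    and W1 :: "('v, 'a::complex_vector) vmod" and W2 :: "('v, 'b::complex_vector) vmod"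
    and M4 :: "('v, 'd::complex_vector) vmod" +
  fixes G :: "'a \<Rightarrow> 'b \<Rightarrow> complex \<Rightarrow> 'd"
  assumes intertwining: "Pz_intertwining_map V z W1 W2 M4 G"
begin

definition dual_map :: "('d \<Rightarrow> complex) \<Rightarrow> 'a \<Rightarrow> 'b \<Rightarrow> complex" where
  "dual_map \<alpha> w1 w2 = (if w1 \<in> vspace W1 \<and> w2 \<in> vspace W2 then M.pairing \<alpha> (G w1 w2) else 0)"

lemma G_completion: "w1 \<in> vspace W1 \<Longrightarrow> w2 \<in> vspace W2 \<Longrightarrow> G w1 w2 \<in> completion V M4"
  using intertwining by (simp add: Pz_intertwining_map_iff)

lemma G_linear:
  "w2 \<in> vspace W2 \<Longrightarrow> linear_on (vspace W1) (\<lambda>w1. G w1 w2)"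
  "w1 \<in> vspace W1 \<Longrightarrow> linear_on (vspace W2) (G w1)"
  using intertwining by (simp_all add: Pz_intertwining_map_iff bilinear_on_def)

lemma dual_map_dual_tensor:
  assumes "\<alpha> \<in> vspace M.M'"
  shows "dual_map \<alpha> \<in> DT"
proof -
  note lin = M.linear_pairing_right[OF assms]
  have "linear_on (vspace W1) (\<lambda>w1. dual_map \<alpha> w1 w2)" if "w2 \<in> vspace W2" for w2
    using linear_on_compose[OF G_linear(1)[OF that] lin G_completion[OF _ that]]
      cvec.subspace_add[OF A.subspace] cvec.subspace_scale[OF A.subspace] that
    by (simp add: linear_on_def dual_map_def)
  moreover have "linear_on (vspace W2) (dual_map \<alpha> w1)" if "w1 \<in> vspace W1" for w1
    using linear_on_compose[OF G_linear(2)[OF that] lin G_completion[OF that]]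
      cvec.subspace_add[OF B.subspace] cvec.subspace_scale[OF B.subspace] that
    by (simp add: linear_on_def dual_map_def)
  ultimately show ?thesis
    by (auto simp: dual_tensor_def bilinear_on_def dual_map_def)
qed

lemma linear_dual_map: "linear_on (vspace M.M') dual_map"
  using linear_onD[OF M.linear_pairing[OF G_completion]]
  by (auto simp: linear_on_def fun_eq_iff dual_map_def)

lemma dual_map_zero: "dual_map 0 = 0"
  by (rule linear_on_zero[OF linear_dual_map M.contragredient_subspace])

text \<open>The intertwining identity for \<open>G\<close>, paired with \<alpha>. On its left side
  \<open>pairing_extend_op\<close> moves the modes of \<open>M4\<close> to opposite modes acting on
  \<alpha>.\<close>

lemma Pz_rhs_dual_map:
  assumes \<alpha>: "\<alpha> \<in> vspace M.M'" and w: "w1 \<in> vspace W1" "w2 \<in> vspace W2"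
  shows "Pz_rhs v a b (dual_map \<alpha>) w1 w2
    = Sum_any (\<lambda>i. coeff_left z a i *\<^sub>C dual_map (adj_op V M.M' v (- a - b - 2 - int i) \<alpha>) w1 w2)"
proof -
  note x = G_completion[OF w]
  let ?e = "\<lambda>i. extend_op V M4 (vop M4 v (- a - b - 2 - int i)) (G w1 w2)"
  obtain T1 T2 where T: "\<And>i. i \<ge> T1 \<Longrightarrow> Ycoeff W1 v (a - int i) w1 = 0" "\<And>i. i \<ge> T2 \<Longrightarrow> Ycoeff W2 v (b - int i) w2 = 0"
    using Ycoeff_truncation[OF w(1)] Ycoeff_truncation'[OF w(2)] by metis
  have G0: "G 0 w2 = 0" "G w1 0 = 0"
    using linear_on_zero[OF G_linear(1)[OF w(2)] A.subspace] linear_on_zero[OF G_linear(2)[OF w(1)] B.subspace] .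
  have Y: "Ycoeff W1 v p w1 \<in> vspace W1" "Ycoeff W2 v p w2 \<in> vspace W2" for p
    using w by (simp_all add: Ycoeff_def A.vop_closed B.vop_closed)
  let ?R1 = "\<lambda>n. Sum_any (\<lambda>i. coeff_first z b i *\<^sub>C G (Ycoeff W1 v (a - int i) w1) w2 n)"
  let ?R2 = "\<lambda>n. Sum_any (\<lambda>i. coeff_second z a i *\<^sub>C G w1 (Ycoeff W2 v (b - int i) w2) n)"
  have fin1: "finite {i. coeff_first z b i *\<^sub>C G (Ycoeff W1 v (a - int i) w1) w2 n \<noteq> 0}" for n
    by (rule finite_support_lessThan[of T1]) (simp add: T G0)
  have fin2: "finite {i. coeff_second z a i *\<^sub>C G w1 (Ycoeff W2 v (b - int i) w2) n \<noteq> 0}" for n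
    by (rule finite_support_lessThan[of T2]) (simp add: T G0)
  have comp: "?R1 \<in> completion V M4" "?R2 \<in> completion V M4"
    using M.completionD[OF G_completion[OF Y(1) w(2)]] M.completionD[OF G_completion[OF w(1) Y(2)]]
    unfolding completion_def
    by (auto intro!: subspace_Sum_any[OF M.wt_subspace] cvec.subspace_scale[OF M.wt_subspace])
  have "Pz_rhs v a b (dual_map \<alpha>) w1 w2 = M.pairing \<alpha> ?R1 + M.pairing \<alpha> ?R2"
    unfolding Pz_rhs_def
    by (subst M.pairing_Sum_any[OF \<alpha> G_completion[OF Y(1) w(2)] fin1],
        subst M.pairing_Sum_any[OF \<alpha> G_completion[OF w(1) Y(2)] fin2])
      (simp add: dual_map_def Y w)
  also have "\<dots> = M.pairing \<alpha> (?R1 + ?R2)"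
    by (rule linear_onD(1)[OF M.linear_pairing_right[OF \<alpha>] comp, symmetric])
  also have "?R1 + ?R2 = (\<lambda>n. Sum_any (\<lambda>i. coeff_left z a i *\<^sub>C ?e i n))"
    using intertwining w by (auto simp: Pz_intertwining_map_iff fun_eq_iff)
  also have "M.pairing \<alpha> \<dots> = Sum_any (\<lambda>i. coeff_left z a i *\<^sub>C M.pairing \<alpha> (?e i))"
    by (rule M.pairing_Sum_any[OF \<alpha>])
      (use M.extend_op_wt[OF x] M.finite_extend_op_support[OF x] in \<open>auto simp: completion_def\<close>)
  also have "\<dots> = Sum_any (\<lambda>i. coeff_left z a i *\<^sub>C dual_map (adj_op V M.M' v (- a - b - 2 - int i) \<alpha>) w1 w2)"
    by (simp add: M.pairing_extend_op[OF \<alpha> x] dual_map_def w)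
  finally show ?thesis .
qed

text \<open>The \<open>opp\<close> transform is applied to both sides of
  \<open>Pz_rhs_dual_map\<close>: on the left it yields \<tau>, on the right it undoes the opposite
  modes by \<open>adj_op_involution\<close>. The formula covers every exponent \<open>a\<close> of
  x_0 at once, so it contains both the action and compatibility.\<close>

lemma tau_dual_map:
  assumes \<alpha>: "\<alpha> \<in> vspace M.M'"
  shows "tau v a b (dual_map \<alpha>) = Sum_any (\<lambda>i. coeff_left z a i *\<^sub>C dual_map (vop M.M' v (a - b + int i) \<alpha>))"
proof (intro ext)
  interpret C: voa_module V M.M' by (rule M.contragredient_voa_module)
  fix w1 w2
  obtain T where T: "\<And>i. i \<ge> T \<Longrightarrow> vop M.M' v (a - b + int i) \<alpha> = 0"
    using C.vop_truncation_nat[OF \<alpha>] by blast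
  have "Sum_any (\<lambda>i. coeff_left z a i *\<^sub>C dual_map (vop M.M' v (a - b + int i) \<alpha>)) w1 w2
      = Sum_any (\<lambda>i. (coeff_left z a i *\<^sub>C dual_map (vop M.M' v (a - b + int i) \<alpha>)) w1) w2"
    by (subst Sum_any_fun_apply[OF finite_support_lessThan[of T]]) (simp_all add: T dual_map_zero)
  also have "\<dots> = Sum_any (\<lambda>i. (coeff_left z a i *\<^sub>C dual_map (vop M.M' v (a - b + int i) \<alpha>)) w1 w2)"
    by (rule Sum_any_fun_apply[OF finite_support_lessThan[of T]]) (simp add: T dual_map_zero)
  finally have R: "Sum_any (\<lambda>i. coeff_left z a i *\<^sub>C dual_map (vop M.M' v (a - b + int i) \<alpha>)) w1 w2
      = Sum_any (\<lambda>i. coeff_left z a i *\<^sub>C dual_map (vop M.M' v (a - b + int i) \<alpha>) w1 w2)"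
    by simp
  show "tau v a b (dual_map \<alpha>) w1 w2 = Sum_any (\<lambda>i. coeff_left z a i *\<^sub>C dual_map (vop M.M' v (a - b + int i) \<alpha>)) w1 w2"
  proof (cases "w1 \<in> vspace W1 \<and> w2 \<in> vspace W2")
    case True
    then have w: "w1 \<in> vspace W1" "w2 \<in> vspace W2" by auto
    \<comment> \<open>The mode index - a - (k - b) - 2 - i is regrouped into the form that
      \<open>adj_op_involution\<close> consumes.\<close>
    define g where "g k i = coeff_left z a i *\<^sub>C dual_map (adj_op V M.M' (opp V v k) (- k - (a - b + int i) - 2) \<alpha>) w1 w2" for k i
    have fin: "finite {(k, i). g k i \<noteq> 0}"
    proof (rule finite_support_iterated[where A = "\<lambda>k. {i. g k i \<noteq> 0}"])
      show "finite {k. {i. g k i \<noteq> 0} \<noteq> {}}"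
        by (rule finite_subset[OF _ voa.finite_opp[of v]]) (auto simp: g_def \<alpha> dual_map_zero)
      show "finite {i. g k i \<noteq> 0}" for k
      proof -
        obtain T where "\<And>t. t \<ge> T \<Longrightarrow> adj_op V M.M' (opp V v k) ((- k - (a - b) - 2) - int t) \<alpha> = 0"
          using C.adj_op_truncation_nat[OF \<alpha>] by blast
        then show ?thesis
          by (intro finite_support_lessThan[of T]) (simp add: g_def dual_map_zero algebra_simps)
      qed
    qed auto
    have "tau v a b (dual_map \<alpha>) w1 w2 = Sum_any (\<lambda>k. Pz_rhs (opp V v k) a (k - b) (dual_map \<alpha>) w1 w2)"
      by (rule tau_eq[OF dual_map_dual_tensor[OF \<alpha>] w])
    also have "\<dots> = Sum_any (\<lambda>k. Sum_any (g k))"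
      by (simp add: Pz_rhs_dual_map[OF \<alpha> w] g_def algebra_simps)
    also have "\<dots> = Sum_any (\<lambda>i. Sum_any (\<lambda>k. g k i))"
      by (rule Sum_any_swap[OF fin])
    also have "\<dots> = Sum_any (\<lambda>i. coeff_left z a i *\<^sub>C dual_map (vop M.M' v (a - b + int i) \<alpha>) w1 w2)"
    proof (rule Sum_any.cong)
      fix i
      let ?h = "\<lambda>k. adj_op V M.M' (opp V v k) (- k - (a - b + int i) - 2) \<alpha>"
      have "linear_on (vspace M.M') (\<lambda>\<beta>. dual_map \<beta> w1 w2)"
        using linear_dual_map by (simp add: linear_on_def)
      then have "dual_map (Sum_any ?h) w1 w2 = Sum_any (\<lambda>k. dual_map (?h k) w1 w2)"
      proof (rule linear_on_Sum_any[OF _ M.contragredient_subspace C.adj_op_closed[OF \<alpha>]])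
        show "finite {k. ?h k \<noteq> 0}"
          by (rule finite_subset[OF _ voa.finite_opp[of v]]) (auto simp: \<alpha>)
      qed
      then show "Sum_any (\<lambda>k. g k i) = coeff_left z a i *\<^sub>C dual_map (vop M.M' v (a - b + int i) \<alpha>) w1 w2"
        unfolding g_def Sum_any_scaleC C.adj_op_involution[OF \<alpha>] by simp
    qed
    finally show ?thesis by (simp only: R)
  next
    case False
    then have "tau v a b (dual_map \<alpha>) w1 w2 = 0"
      using tau_off by blast
    with False show ?thesis
      unfolding R by (auto simp: dual_map_def)
  qed
qed

lemma tau_dual_map_residue:
  assumes "\<alpha> \<in> vspace M.M'"
  shows "tau v (-1) b (dual_map \<alpha>) = dual_map (vop M.M' v (- 1 - b) \<alpha>)"
  unfolding tau_dual_map[OF assms] by (subst Sum_any_singleton[of 0]) (simp_all add: coeff_left_minus_one scaleC_one)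

text \<open>The residue formula rewrites the action in terms of the modes on \<alpha>; its mode
  index -1 - (b - a - 1 - i) equals a - b + i, the one in \<open>tau_dual_map\<close>.\<close>

lemma dual_map_compatible:
  assumes \<alpha>: "\<alpha> \<in> vspace M.M'"
  shows "Pz_compatible V z W1 W2 (dual_map \<alpha>)"
  unfolding Pz_compatible_iff
proof (intro allI conjI)
  fix v a b
  obtain N where N: "\<And>n. n \<ge> N \<Longrightarrow> vop M.M' v n \<alpha> = 0"
    using M.contragredient_truncation[OF \<alpha>] by blast
  then show "\<exists>N. \<forall>p<N. tau v (-1) p (dual_map \<alpha>) = 0"
    by (intro exI[of _ "- N"]) (simp add: tau_dual_map_residue[OF \<alpha>] dual_map_zero)
  show "tau v a b (dual_map \<alpha>) = Sum_any (\<lambda>i. coeff_left z a i *\<^sub>C tau v (-1) (b - a - 1 - int i) (dual_map \<alpha>))"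
    unfolding tau_dual_map_residue[OF \<alpha>] tau_dual_map[OF \<alpha>, of v a b] by (simp add: algebra_simps)
qed

lemma dual_map_module: "vmodule V (Pz_dual V z W1 W2 (dual_map ` vspace M.M'))"
proof -
  interpret C: voa_module V M.M' by (rule M.contragredient_voa_module)
  show ?thesis
    by (rule C.image_vmodule[OF linear_dual_map]) (simp_all add: Pz_dual_def tau_dual_map_residue)
qed

lemma dual_map_diamond: "\<alpha> \<in> vspace M.M' \<Longrightarrow> dual_map \<alpha> \<in> vspace D"
  using compatible_module_subset_diamond[of "dual_map ` vspace M.M'"] dual_map_module dual_map_dual_tensor dual_map_compatible
  by blast

lemma vop_dual_map: "\<alpha> \<in> vspace M.M' \<Longrightarrow> vop D v n (dual_map \<alpha>) = dual_map (vop M.M' v n \<alpha>)"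
  by (simp add: vop_diamond tau_dual_map_residue)

section \<open>Uniqueness and existence of the morphism\<close>

lemma morphism_unique:
  assumes "vmodule V D"
    and \<eta>: "Pz_product_morphism W1 W2 (contragredient V D) F M4 G \<eta>"
    and \<eta>': "Pz_product_morphism W1 W2 (contragredient V D) F M4 G \<eta>'"
    and \<phi>: "\<phi> \<in> vspace (contragredient V D)"
  shows "\<eta>' \<phi> = \<eta> \<phi>"
proof -
  interpret D: voa_module V D
    by (rule diamond_voa_module[OF assms(1)])
  interpret C: voa_module V D.M' by (rule D.contragredient_voa_module)
  have lin: "linear_on (vspace D.M') \<eta>" "linear_on (vspace D.M') \<eta>'"
    using \<eta> \<eta>' by (auto simp: Pz_product_morphism_def module_map_def)
  have agree: "\<eta>' (F w1 w2 n) = \<eta> (F w1 w2 n)" if "w1 \<in> vspace W1" "w2 \<in> vspace W2" for w1 w2 n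
  proof -
    have "G w1 w2 = (\<lambda>n. \<eta> (F w1 w2 n))" "G w1 w2 = (\<lambda>n. \<eta>' (F w1 w2 n))"
      using \<eta> \<eta>' that by (auto simp: Pz_product_morphism_def)
    then show ?thesis by metis
  qed
  have hom: "\<eta>' \<psi> = \<eta> \<psi>" if \<psi>: "\<psi> \<in> wt_space V D.M' n" for \<psi> n
  proof (rule linear_on_eq_span[OF _ _ _ boxtimes_map_span[OF assms(1) \<psi>]])
    let ?B = "{F w1 w2 n | w1 w2. w1 \<in> vspace W1 \<and> w2 \<in> vspace W2}"
    have "?B \<subseteq> vspace D.M'"
      by (auto intro: C.wt_in_vspace[OF C.completionD[OF boxtimes_map_completion[OF assms(1)]]])
    then have "cvec.span ?B \<subseteq> vspace D.M'"
      by (rule cvec.span_minimal[OF _ C.subspace])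
    with lin show "linear_on (cvec.span ?B) \<eta>" "linear_on (cvec.span ?B) \<eta>'"
      by (auto intro: linear_on_subset)
  qed (auto simp: agree)
  have "\<eta>' \<phi> = Sum_any (\<lambda>n. \<eta>' (wt_comp V D.M' \<phi> n))"
    by (rule C.linear_eq_Sum_wt_comp[OF lin(2) \<phi>])
  also have "\<dots> = Sum_any (\<lambda>n. \<eta> (wt_comp V D.M' \<phi> n))"
    by (simp add: hom[OF C.wt_comp(1)[OF \<phi>]])
  also have "\<dots> = \<eta> \<phi>"
    by (rule C.linear_eq_Sum_wt_comp[OF lin(1) \<phi>, symmetric])
  finally show ?thesis .
qed

lemma morphism_exists:
  assumes "vmodule V D"
  shows "\<exists>\<eta>. Pz_product_morphism W1 W2 (contragredient V D) F M4 G \<eta>"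
proof -
  interpret D: voa_module V D
    by (rule diamond_voa_module[OF assms])
  interpret C: voa_module V D.M' by (rule D.contragredient_voa_module)
  interpret M': voa_module V M.M' by (rule M.contragredient_voa_module)
  have dual_map_wt: "dual_map \<alpha> \<in> wt_space V D n" if "\<alpha> \<in> wt_space V M.M' n" for \<alpha> n
    using that dual_map_diamond vop_dual_map[of \<alpha> "conformal V" 1] linear_onD(2)[OF linear_dual_map]
    by (auto simp: wt_space_def Lop_def)
  have "\<exists>w\<in>vspace M4. \<forall>\<alpha>\<in>vspace M.M'. \<alpha> w = \<phi> (dual_map \<alpha>)" if \<phi>: "\<phi> \<in> vspace D.M'" for \<phi>
  proof (rule M.double_dual)
    show "linear_on (vspace M.M') (\<lambda>\<alpha>. \<phi> (dual_map \<alpha>))"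
      by (rule linear_on_compose[OF linear_dual_map D.contragredientD(1)[OF \<phi>] dual_map_diamond])
    \<comment> \<open>\<open>dual_map\<close> preserves weights, so only weights seen by \<phi> can
      occur.\<close>
    show "finite {n. \<exists>\<alpha>\<in>wt_space V M.M' n. \<phi> (dual_map \<alpha>) \<noteq> 0}"
      by (rule finite_subset[OF _ D.contragredientD(3)[OF \<phi>]]) (use dual_map_wt in auto)
  qed
  then obtain \<eta> where \<eta>: "\<And>\<phi>. \<phi> \<in> vspace D.M' \<Longrightarrow> \<eta> \<phi> \<in> vspace M4"
    "\<And>\<phi> \<alpha>. \<phi> \<in> vspace D.M' \<Longrightarrow> \<alpha> \<in> vspace M.M' \<Longrightarrow> \<alpha> (\<eta> \<phi>) = \<phi> (dual_map \<alpha>)"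
    by metis
  \<comment> \<open>\<eta> is known only through its pairings with \<alpha>. Since these separate
    points, linearity, compatibility with modes and the factorization of \<open>G\<close> can all be
    tested after applying \<alpha>.\<close>
  have eqI: "x = y" if "x \<in> vspace M4" "y \<in> vspace M4" "\<And>\<alpha>. \<alpha> \<in> vspace M.M' \<Longrightarrow> \<alpha> x = \<alpha> y" for x y
  proof -
    have "x - y = 0"
    proof (rule M.contragredient_separates)
      show "x - y \<in> vspace M4"
        using that by (intro cvec.subspace_diff[OF M.subspace])
      show "\<alpha> (x - y) = 0" if "\<alpha> \<in> vspace M.M'" for \<alpha>
        using linear_on_diff[OF M.contragredientD(1)[OF that] M.subspace \<open>x \<in> vspace M4\<close> \<open>y \<in> vspace M4\<close>]
          \<open>\<And>\<alpha>. \<alpha> \<in> vspace M.M' \<Longrightarrow> \<alpha> x = \<alpha> y\<close>[OF that] by simp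
    qed
    then show ?thesis by simp
  qed
  have add: "\<eta> (\<phi> + \<psi>) = \<eta> \<phi> + \<eta> \<psi>" if "\<phi> \<in> vspace D.M'" "\<psi> \<in> vspace D.M'" for \<phi> \<psi>
  proof (rule eqI)
    have s: "\<phi> + \<psi> \<in> vspace D.M'"
      using that by (rule cvec.subspace_add[OF C.subspace])
    show "\<eta> (\<phi> + \<psi>) \<in> vspace M4" "\<eta> \<phi> + \<eta> \<psi> \<in> vspace M4"
      using \<eta>(1) that s by (auto intro: cvec.subspace_add[OF M.subspace])
    show "\<alpha> (\<eta> (\<phi> + \<psi>)) = \<alpha> (\<eta> \<phi> + \<eta> \<psi>)" if "\<alpha> \<in> vspace M.M'" for \<alpha>
      using \<eta>(1) \<eta>(2)[OF s that] \<eta>(2)[OF \<open>\<phi> \<in> vspace D.M'\<close> that] \<eta>(2)[OF \<open>\<psi> \<in> vspace D.M'\<close> that]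
        \<open>\<phi> \<in> vspace D.M'\<close> \<open>\<psi> \<in> vspace D.M'\<close>
      by (simp add: linear_onD(1)[OF M.contragredientD(1)[OF that]])
  qed
  have scale: "\<eta> (c *\<^sub>C \<phi>) = c *\<^sub>C \<eta> \<phi>" if "\<phi> \<in> vspace D.M'" for c \<phi>
  proof (rule eqI)
    have s: "c *\<^sub>C \<phi> \<in> vspace D.M'"
      using that by (rule cvec.subspace_scale[OF C.subspace])
    show "\<eta> (c *\<^sub>C \<phi>) \<in> vspace M4" "c *\<^sub>C \<eta> \<phi> \<in> vspace M4"
      using \<eta>(1) that s by (auto intro: cvec.subspace_scale[OF M.subspace])
    show "\<alpha> (\<eta> (c *\<^sub>C \<phi>)) = \<alpha> (c *\<^sub>C \<eta> \<phi>)" if "\<alpha> \<in> vspace M.M'" for \<alpha>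
      using \<eta>(1) \<eta>(2)[OF s that] \<eta>(2)[OF \<open>\<phi> \<in> vspace D.M'\<close> that] \<open>\<phi> \<in> vspace D.M'\<close>
      by (simp add: linear_onD(2)[OF M.contragredientD(1)[OF that]])
  qed
  have adj_dual_map: "adj_op V D v n (dual_map \<alpha>) = dual_map (adj_op V M.M' v n \<alpha>)" if \<alpha>: "\<alpha> \<in> vspace M.M'" for v n \<alpha>
    unfolding adj_op_eq vop_dual_map[OF \<alpha>]
    by (rule linear_on_Sum_any[OF linear_dual_map M'.subspace M'.vop_closed[OF \<alpha>] M'.finite_adj_op_support[OF \<alpha>], symmetric])
  have modes: "\<eta> (vop D.M' v n \<phi>) = vop M4 v n (\<eta> \<phi>)" if \<phi>: "\<phi> \<in> vspace D.M'" for v n \<phi>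
  proof (rule eqI)
    show "\<eta> (vop D.M' v n \<phi>) \<in> vspace M4" "vop M4 v n (\<eta> \<phi>) \<in> vspace M4"
      using \<eta>(1) \<phi> by (auto intro: C.vop_closed M.vop_closed)
    fix \<alpha> assume \<alpha>: "\<alpha> \<in> vspace M.M'"
    have "\<alpha> (\<eta> (vop D.M' v n \<phi>)) = \<phi> (adj_op V D v n (dual_map \<alpha>))"
      using \<eta>(2)[OF C.vop_closed[OF \<phi>] \<alpha>] dual_map_diamond[OF \<alpha>] by (simp add: contragredient_vop)
    also have "\<dots> = \<alpha> (vop M4 v n (\<eta> \<phi>))"
      using \<eta>(2)[OF \<phi> M'.adj_op_closed[OF \<alpha>]] by (simp add: adj_dual_map[OF \<alpha>] M.vop_transpose[OF \<alpha> \<eta>(1)[OF \<phi>]])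
    finally show "\<alpha> (\<eta> (vop D.M' v n \<phi>)) = \<alpha> (vop M4 v n (\<eta> \<phi>))" .
  qed
  have "G w1 w2 n = \<eta> (F w1 w2 n)" if w: "w1 \<in> vspace W1" "w2 \<in> vspace W2" for w1 w2 n
  proof (rule eqI)
    have F: "F w1 w2 n \<in> vspace D.M'"
      by (rule C.wt_in_vspace[OF C.completionD[OF boxtimes_map_completion[OF assms]]])
    show "G w1 w2 n \<in> vspace M4" "\<eta> (F w1 w2 n) \<in> vspace M4"
      using M.wt_in_vspace[OF M.completionD[OF G_completion[OF w]]] \<eta>(1)[OF F] by auto
    fix \<alpha> assume \<alpha>: "\<alpha> \<in> vspace M.M'"
    \<comment> \<open>A weight-preserving linear map commutes with taking components. This matches
      the weight-\<open>n\<close> part of the canonical map, which reads a component in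
      \<open>D\<close>, with the weight-\<open>n\<close> part of \<open>G\<close>, which is read by
      a component of \<alpha>.\<close>
    have "wt_comp V D (dual_map \<alpha>) = (\<lambda>n. dual_map (wt_comp V M.M' \<alpha> n))"
    proof (rule D.wt_comp_unique)
      show "dual_map (wt_comp V M.M' \<alpha> n) \<in> wt_space V D n" for n
        by (rule dual_map_wt[OF M'.wt_comp(1)[OF \<alpha>]])
      show "finite {n. dual_map (wt_comp V M.M' \<alpha> n) \<noteq> 0}"
        by (rule finite_subset[OF _ M'.wt_comp(2)[OF \<alpha>]]) (auto simp: dual_map_zero)
      show "Sum_any (\<lambda>n. dual_map (wt_comp V M.M' \<alpha> n)) = dual_map \<alpha>"
        by (rule M'.linear_eq_Sum_wt_comp[OF linear_dual_map \<alpha>, symmetric])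
    qed
    then have "\<alpha> (\<eta> (F w1 w2 n)) = dual_map (wt_comp V M.M' \<alpha> n) w1 w2"
      using \<eta>(2)[OF F \<alpha>] by (simp add: boxtimes_map_apply[OF dual_map_diamond[OF \<alpha>]])
    then show "\<alpha> (G w1 w2 n) = \<alpha> (\<eta> (F w1 w2 n))"
      by (simp add: dual_map_def w M.contragredient_wt_comp[OF \<alpha>] M.pairing_dual_comp[OF \<alpha> G_completion[OF w]])
  qed
  then have "Pz_product_morphism W1 W2 D.M' F M4 G \<eta>"
    using \<eta>(1) add scale modes
    by (auto simp: Pz_product_morphism_def module_map_def linear_on_def)
  then show ?thesis by blast
qed

end

theorem proposition13p6:
  fixes V :: "'v::complex_vector voa" and z :: complex
    and W1 :: "('v, 'a::complex_vector) vmod" and W2 :: "('v, 'b::complex_vector) vmod"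
  assumes "vertex_operator_algebra V"
    and "z \<noteq> 0"
    and "vmodule V W1"
    and "vmodule V W2"
    and "vmodule V (diamond V z W1 W2)"
  shows "Pz_tensor_product TYPE('d::complex_vector) V z W1 W2
    (boxtimes V z W1 W2) (boxtimes_map V z W1 W2)"
proof -
  interpret Pz_setting V z W1 W2
    by (intro Pz_setting.intro voa_gmodule.intro assms vmodule.axioms(1)[OF assms(3)] vmodule.axioms(1)[OF assms(4)])
  interpret D: voa_module V D
    by (rule diamond_voa_module[OF assms(5)])
  have "\<exists>\<eta>. Pz_product_morphism W1 W2 D.M' F M4 G \<eta>
      \<and> (\<forall>\<eta>'. Pz_product_morphism W1 W2 D.M' F M4 G \<eta>' \<longrightarrow> (\<forall>w\<in>vspace D.M'. \<eta>' w = \<eta> w))"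
    if "Pz_product V z W1 W2 M4 G" for M4 :: "('v, 'd) vmod" and G
  proof -
    interpret Pz_product_setting V z W1 W2 M4 G
      using that unfolding Pz_product_def
      by (intro Pz_product_setting.intro Pz_product_setting_axioms.intro Pz_setting_axioms
          voa_module.intro voa_gmodule.intro assms(1)) (auto intro: vmodule.axioms(1))
    show ?thesis
      using morphism_exists[OF assms(5)] morphism_unique[OF assms(5)] by blast
  qed
  then show ?thesis
    unfolding Pz_tensor_product_def boxtimes_def Pz_product_def
    using D.contragredient_vmodule boxtimes_map_intertwining[OF assms(5)] by blast
qed

end
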